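(* For each integer $n\geq 3$, there exists an odd $\frac{2\pi}{n}$-periodic function $f\in C^{1/2}(\mathbb{T})$ with $\widehat{f}_n\neq 0$ such that: (i) $f$ is a (time-independent) solution of $$\partial_t f+2\,\mathcal{S}f\,\partial_x f-\partial_x(\mathcal{S}f)\,f=0,$$ that is, of $2\,\mathcal{S}f\,\partial_x f=f\,\partial_x\mathcal{S}f$ on $\mathbb{T}$ (in the weak sense given in the context); (ii) the $n$-fold symmetric function $\Theta:\mathbb{R}^2\to\mathbb{R}$ given in polar coordinates $(r,x)$ by $\Theta(x_1,x_2):=r f(x)$ is a stationary solution of the inviscid SQG equation $\partial_t\theta+\nabla^\perp u\cdot\nabla\theta=0$, $u=-\Lambda^{-1}\theta$ (in the distributional sense given in the context). (iii) Moreover, if $q\in L^2(\mathbb{T})$ is an odd $\frac{2\pi}{n}$-periodic (time-independent) solution of $2\,\mathcal{S}q\,\partial_x q=q\,\partial_x\mathcal{S}q$ (in the same weak sense) and $\mathcal{S}q$ does not vanish on $\left(0,\frac{\pi}{n}\right)$, then $q$ is a multiple of $f$.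
   Context: $\mathbb{T}=\mathbb{R}/2\pi\mathbb{Z}$, identified with $(-\pi,\pi]$; $\widehat{f}_k$ are the Fourier coefficients of $f$ on $\mathbb{T}$. $C^{1/2}(\mathbb{T})$ is the space of Hölder continuous functions of exponent $1/2$. The operator $\mathcal{S}$ acts on functions $f\in L^2(\mathbb{T})$ with $\widehat{f}_k=0$ for $|k|\leq 2$ (in particular on odd $\frac{2\pi}{n}$-periodic functions with $n\ge 3$) as the Fourier multiplier $$\widehat{(\mathcal{S}f)}_k=-\frac{1}{|k|}\,\frac{k^2-1}{k^2-4}\,\widehat{f}_k,\qquad |k|\geq 3,$$ and $\widehat{(\mathcal Sf)}_k=0$ for $|k|\le 2$. It maps $L^2$ to $H^1(\mathbb{T})\subset C(\mathbb{T})$. Weak sense: for $f\in L^2(\mathbb{T})$, "$\alpha\,\mathcal{S}f\,\partial_x f=f\,\partial_x\mathcal{S}f$" means $$-\alpha\int_{-\pi}^{\pi} f\,\mathcal{S}f\,\partial_x\psi\,dx=(\alpha+1)\int_{-\pi}^{\pi} f\,\partial_x(\mathcal{S}f)\,\psi\,dx\qquad\text{for every }\psi\in C^\infty(\mathbb{T})$$ (here with $\alpha=2$). Polar coordinates: $x_1=r\cos x$, $x_2=r\sin x$, $(r,x)\in\mathbb{R}^+\times\mathbb{T}$. $\Lambda=(-\Delta)^{1/2}$, $\nabla^\perp=(-\partial_{x_2},\partial_{x_1})$. For $\Theta=rf(x)$ with $\widehat f_k=0$ for $|k|\le 2$ (which is unbounded at infinity), $-\Lambda^{-1}\Theta$ is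 understood as the function $u(x_1,x_2)=r^2\,\mathcal{S}f(x)$. That $\Theta$ is a stationary solution of SQG means that $\Theta\nabla^\perp u$ is locally integrable and $$\int_{\mathbb{R}^2}\Theta\,\nabla^\perp u\cdot\nabla\psi\,dx_1dx_2=0\qquad\text{for every }\psi\in C_c^\infty(\mathbb{R}^2).$$ *)

theory Defs
  imports "HOL-Analysis.Analysis"
begin

section \<open>Functions on the circle\<close>

text \<open>
  A function on \<open>\<real>/2\<pi>\<int>\<close> is a \<open>2\<pi>\<close>-periodic function on \<open>\<real>\<close>; integrals over the circle are taken
  over \<open>(-\<pi>, \<pi>]\<close>.
\<close>

definition periodic :: "real \<Rightarrow> (real \<Rightarrow> 'b) \<Rightarrow> bool" where
  "periodic T f \<longleftrightarrow> (\<forall>x. f (x + T) = f x)"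

abbreviation circle :: "real set" where
  "circle \<equiv> {-pi<..pi}"

definition odd_fun :: "(real \<Rightarrow> real) \<Rightarrow> bool" where
  "odd_fun f \<longleftrightarrow> (\<forall>x. f (- x) = - f x)"

text \<open>
  An element of \<open>L\<^sup>2\<close> is given by a representative, so its symmetries are required only almost
  everywhere.
\<close>

definition AE_odd :: "(real \<Rightarrow> real) \<Rightarrow> bool" where
  "AE_odd f \<longleftrightarrow> (AE x in lborel. f (- x) = - f x)"

definition AE_periodic :: "real \<Rightarrow> (real \<Rightarrow> real) \<Rightarrow> bool" where
  "AE_periodic T f \<longleftrightarrow> (AE x in lborel. f (x + T) = f x)"

definition L2_circle :: "(real \<Rightarrow> real) \<Rightarrow> bool" where
  "L2_circle f \<longleftrightarrow> periodic (2 * pi) f \<and> f \<in> borel_measurable borel \<and>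
     set_integrable lborel circle (\<lambda>x. (f x)\<^sup>2)"

text \<open>
  For periodic functions the Hoelder condition with respect to the distance of the circle is
  the same as the one with respect to the distance of \<open>\<real>\<close>.
\<close>

definition holder_circle :: "real \<Rightarrow> (real \<Rightarrow> real) \<Rightarrow> bool" where
  "holder_circle \<gamma> f \<longleftrightarrow> periodic (2 * pi) f \<and>
     (\<exists>C. \<forall>x y. \<bar>f x - f y\<bar> \<le> C * \<bar>x - y\<bar> powr \<gamma>)"

definition fourier_coeff :: "(real \<Rightarrow> real) \<Rightarrow> int \<Rightarrow> complex" where
  "fourier_coeff f k =
     (LINT x:circle|lborel. complex_of_real (f x) * cis (- (of_int k * x))) / (2 * pi)"

definition S_symbol :: "int \<Rightarrow> real" where
  "S_symbol k = (if \<bar>k\<bar> \<le> 2 then 0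
     else - (1 / \<bar>of_int k\<bar>) * (((of_int k)\<^sup>2 - 1) / ((of_int k)\<^sup>2 - 4)))"

text \<open>
  The operator \<open>S\<close>, given by its Fourier series. For \<open>f\<close> in \<open>L\<^sup>2\<close> the series converges absolutely
  and uniformly (the symbol is \<open>O(1/\<bar>k\<bar>)\<close>), so \<open>S f\<close> is the continuous representative; since \<open>f\<close> is
  real and the symbol is real and even, the sum is real and \<open>Re\<close> only adjusts the type.
\<close>

definition S_op :: "(real \<Rightarrow> real) \<Rightarrow> real \<Rightarrow> real" where
  "S_op f x =
     Re (\<Sum>\<^sub>\<infinity>k::int. complex_of_real (S_symbol k) * fourier_coeff f k * cis (of_int k * x))"


section \<open>Smooth functions and weak derivatives\<close>

primrec C_k :: "nat \<Rightarrow> ('a::euclidean_space \<Rightarrow> 'b::real_normed_vector) \<Rightarrow> bool" where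
  "C_k 0 f \<longleftrightarrow> continuous_on UNIV f"
| "C_k (Suc k) f \<longleftrightarrow> (\<forall>x. f differentiable (at x)) \<and>
     (\<forall>v. C_k k (\<lambda>x. frechet_derivative f (at x) v))"

definition smooth :: "('a::euclidean_space \<Rightarrow> 'b::real_normed_vector) \<Rightarrow> bool" where
  "smooth f \<longleftrightarrow> (\<forall>k. C_k k f)"

definition smooth_circle :: "(real \<Rightarrow> real) set" where
  "smooth_circle = {\<psi>. periodic (2 * pi) \<psi> \<and> smooth \<psi>}"

definition weak_deriv_circle :: "(real \<Rightarrow> real) \<Rightarrow> (real \<Rightarrow> real) \<Rightarrow> bool" where
  "weak_deriv_circle g h \<longleftrightarrow> L2_circle h \<and>
     (\<forall>\<psi>\<in>smooth_circle.
        (LINT x:circle|lborel. g x * deriv \<psi> x) = - (LINT x:circle|lborel. h x * \<psi> x))"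

text \<open>
  Weak solutions of \<open>\<alpha> S f \<partial>\<^sub>x f = f \<partial>\<^sub>x (S f)\<close>. The function \<open>h\<close> is the weak derivative of
  \<open>S f \<in> H\<^sup>1\<close>; it exists for every \<open>f\<close> in \<open>L\<^sup>2\<close> and is unique almost everywhere.
\<close>

definition weak_solution :: "real \<Rightarrow> (real \<Rightarrow> real) \<Rightarrow> bool" where
  "weak_solution \<alpha> f \<longleftrightarrow> L2_circle f \<and>
     (\<exists>h. weak_deriv_circle (S_op f) h \<and>
       (\<forall>\<psi>\<in>smooth_circle.
          - \<alpha> * (LINT x:circle|lborel. f x * S_op f x * deriv \<psi> x) =
          (\<alpha> + 1) * (LINT x:circle|lborel. f x * h x * \<psi> x)))"


section \<open>The SQG equation in the plane\<close>

type_synonym plane = "real \<times> real"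

definition test_functions :: "(plane \<Rightarrow> real) set" where
  "test_functions = {\<psi>. smooth \<psi> \<and> compact (closure {p. \<psi> p \<noteq> 0})}"

definition locally_integrable :: "(plane \<Rightarrow> 'b::{banach, second_countable_topology}) \<Rightarrow> bool" where
  "locally_integrable g \<longleftrightarrow> (\<forall>K. compact K \<longrightarrow> set_integrable lborel K g)"

definition grad :: "(plane \<Rightarrow> real) \<Rightarrow> plane \<Rightarrow> plane" where
  "grad \<psi> p = (frechet_derivative \<psi> (at p) (1, 0), frechet_derivative \<psi> (at p) (0, 1))"

definition weak_grad :: "(plane \<Rightarrow> real) \<Rightarrow> (plane \<Rightarrow> plane) \<Rightarrow> bool" where
  "weak_grad u G \<longleftrightarrow> locally_integrable u \<and> locally_integrable G \<and>
     (\<forall>\<psi>\<in>test_functions. (LINT p|lborel. u p *\<^sub>R grad \<psi> p) = - (LINT p|lborel. \<psi> p *\<^sub>R G p))"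

definition perp :: "plane \<Rightarrow> plane" where
  "perp v = (- snd v, fst v)"

text \<open>
  \<open>\<theta>\<close> is a stationary distributional solution of \<open>\<partial>\<^sub>t \<theta> + \<nabla>\<^sup>\<bottom>u \<cdot> \<nabla>\<theta> = 0\<close>, where \<open>u\<close> plays the role
  of \<open>-\<Lambda>\<^sup>-\<^sup>1\<theta>\<close> and \<open>\<nabla>\<^sup>\<bottom>u = perp (G p)\<close> is taken in the weak sense.
\<close>

definition sqg_stationary :: "(plane \<Rightarrow> real) \<Rightarrow> (plane \<Rightarrow> real) \<Rightarrow> bool" where
  "sqg_stationary \<theta> u \<longleftrightarrow>
     (\<exists>G. weak_grad u G \<and> locally_integrable (\<lambda>p. \<theta> p *\<^sub>R perp (G p)) \<and>
       (\<forall>\<psi>\<in>test_functions. (LINT p|lborel. (\<theta> p *\<^sub>R perp (G p)) \<bullet> grad \<psi> p) = 0))"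

definition polar_angle :: "plane \<Rightarrow> real" where
  "polar_angle p = Arg (Complex (fst p) (snd p))"

definition Theta :: "(real \<Rightarrow> real) \<Rightarrow> plane \<Rightarrow> real" where
  "Theta f p = norm p * f (polar_angle p)"

text \<open>
  \<open>Theta f\<close> grows linearly, so \<open>-\<Lambda>\<^sup>-\<^sup>1 (Theta f)\<close> is by convention the function \<open>r\<^sup>2 S f(x)\<close>.
\<close>

definition neg_inv_Lambda_Theta :: "(real \<Rightarrow> real) \<Rightarrow> plane \<Rightarrow> real" where
  "neg_inv_Lambda_Theta f p = (norm p)\<^sup>2 * S_op f (polar_angle p)"

definition rot :: "real \<Rightarrow> plane \<Rightarrow> plane" where
  "rot a p = (fst p * cos a - snd p * sin a, fst p * sin a + snd p * cos a)"

definition n_fold_symmetric :: "nat \<Rightarrow> (plane \<Rightarrow> real) \<Rightarrow> bool" where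
  "n_fold_symmetric n \<theta> \<longleftrightarrow> (\<forall>p. \<theta> (rot (2 * pi / real n) p) = \<theta> p)"

lemma periodic_int:
  assumes "periodic T f"
  shows "f (x + of_int k * T) = f x"
proof -
  have nat: "f (y + real m * T) = f y" for y m
  proof (induction m)
    case (Suc m)
    have "f (y + real (Suc m) * T) = f ((y + real m * T) + T)"
      by (simp add: algebra_simps)
    then show ?case using Suc assms by (simp add: periodic_def)
  qed simp
  show ?thesis
  proof (cases "k \<ge> 0")
    case True
    then show ?thesis using nat[of x "nat k"] by simp
  next
    case False
    then show ?thesis using nat[of "x + of_int k * T" "nat (- k)"] by simp
  qed
qed

lemma Theta_polar:
  assumes "periodic (2 * pi) f" "r > 0"
  shows "Theta f (r * cos x, r * sin x) = r * f x"
proof -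
  let ?z = "Complex (r * cos x) (r * sin x)"
  have z: "?z = of_real r * cis x" by (simp add: complex_eq_iff)
  have nz: "?z \<noteq> 0" using assms(2) by (simp add: z)
  have nm: "norm (r * cos x, r * sin x) = r"
  proof -
    have "(r * cos x)\<^sup>2 + (r * sin x)\<^sup>2 = r\<^sup>2"
      by (metis distrib_left mult.right_neutral power_mult_distrib sin_cos_squared_add2)
    then show ?thesis using assms(2) by (simp add: norm_Pair)
  qed
  have "cis (Arg ?z) = cis x"
    using nz assms(2) by (simp add: cis_Arg z sgn_mult sgn_of_real)
  then obtain m :: int where "Arg ?z = x + of_int m * (2 * pi)"
    by (metis cis.simps sin_cos_eq_iff mult.commute mult.left_commute)
  then have "f (Arg ?z) = f x" using periodic_int[OF assms(1)] by metis
  then show ?thesis by (simp add: Theta_def polar_angle_def nm)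
qed

end

theory Submission
  imports Defs
begin

text \<open>
  For odd \<open>2\<pi>/n\<close>-periodic \<open>f\<close> that are positive on \<open>(0, \<pi>/n)\<close> the equation \<open>2 S f f' = f (S f)'\<close>
  integrates to \<open>f\<^sup>2 = c S f\<close>, and after scaling to the fixed point equation \<open>f\<^sup>2 = K f\<close> with \<open>K = - S\<close>.
  Rescaled to \<open>(0, \<pi>)\<close>, \<open>K\<close> is a positive superposition of the kernels \<open>\<Sum>\<^sub>j r\<^sup>j sin(j a) sin(j y) > 0\<close>,
  hence symmetric, order preserving, and \<open>K \<phi>(a) \<ge> c sin a \<integral> \<phi> sin\<close>. The monotone iteration
  \<open>\<phi> \<mapsto> \<surd>(K \<phi>)\<close>, started at a small multiple of \<open>\<surd>sin\<close>, stays below every supersolution and converges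
  to a fixed point. For two fixed points \<open>f, q\<close> the supersolution \<open>min f q\<close> lies above a third one \<open>\<phi>\<close>,
  and \<open>\<integral> \<phi> f (f - \<phi>) = \<integral> (\<phi> K f - f K \<phi>) = 0\<close> gives \<open>f = \<phi> = q\<close>.

  A fixed point is Hoelder continuous, hence \<open>K f\<close> is \<open>C\<^sup>1\<close> by bounds on the derivative of the
  Poisson kernel, and \<open>f = \<surd>(K f)\<close> is \<open>C\<^bsup>1/2\<^esup>\<close>. In the plane \<open>\<Theta>\<close> is the signed square root of the
  \<open>C\<^sup>1\<close> function \<open>- u\<close>, so \<open>\<Theta> \<nabla>\<^sup>\<bottom>u\<close> is itself a perpendicular gradient and divergence free. For a general
  \<open>q\<close> in \<open>L\<^sup>2\<close>, the weak equation makes \<open>S q\<close> and \<open>q S q\<close> primitives of integrable functions, from which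
  \<open>q\<^sup>2 = c S q\<close> follows where \<open>S q\<close> does not vanish.
\<close>

section \<open>Integration over an open interval\<close>

text \<open>Dividing by \<open>f * S f\<close> turns the equation into 2 f'/f = (S f)'/S f, the
  origin of f^2 = c S f. For a solution that is only square integrable neither this division nor a
  chain rule is at hand, so uniqueness must recover the relation from integrated identities on
  intervals where \<open>S q\<close> has no zero. The square root is not Lipschitz at 0, the value
  approached at both endpoints of (0, pi); this rules out a plain contraction argument and makes
  order the natural tool. The barrier sqrt(sin) is dictated by the lower bound for \<open>K\<close>:
  the image of c sqrt(sin) is at least a constant times c sin, while its square is only c^2 sin, so
  a small \<open>c\<close> gives a subsolution. The same Poisson kernels that give positivity also
  give the derivative bounds, so no Green function has to be computed. The bound n >= 3 enters
  through the weight of the superposition: it is singular like s^(-3) at 0, and the factor s^n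
  compensates exactly this. Regularity is a bootstrap: Bessel's inequality alone gives a small
  Hoelder exponent, and that is already enough for \<open>K\<close> to produce a continuous
  derivative.\<close>

definition ivl :: "real \<Rightarrow> real \<Rightarrow> real measure" where
  "ivl a b = restrict_space lborel {a<..<b}"

lemma space_ivl [simp]: "space (ivl a b) = {a<..<b}"
  by (simp add: ivl_def space_restrict_space)

lemma borel_measurable_ivlI: "f \<in> borel_measurable borel \<Longrightarrow> f \<in> borel_measurable (ivl a b)"
  unfolding ivl_def by (intro measurable_restrict_space1) simp

lemma measurable_ident_ivl [measurable]: "(\<lambda>x. x) \<in> borel_measurable (ivl a b)"
  by (intro borel_measurable_ivlI) simp

lemma finite_measure_ivl: "finite_measure (ivl a b)"
  by (rule finite_measureI)
     (cases "a \<le> b"; simp add: ivl_def emeasure_restrict_space space_restrict_space)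

lemma integrable_ivl_iff:
  fixes f :: "real \<Rightarrow> 'b::{banach, second_countable_topology}"
  shows "integrable (ivl a b) f \<longleftrightarrow> set_integrable lborel {a<..<b} f"
  unfolding ivl_def set_integrable_def by (subst integrable_restrict_space) auto

lemma integral_ivl:
  fixes f :: "real \<Rightarrow> 'b::{banach, second_countable_topology}"
  shows "integral\<^sup>L (ivl a b) f = (LINT x:{a<..<b}|lborel. f x)"
  unfolding ivl_def set_lebesgue_integral_def by (subst integral_restrict_space) auto

lemma AE_ivl_iff: "(AE x in ivl a b. P x) \<longleftrightarrow> (AE x in lborel. a < x \<and> x < b \<longrightarrow> P x)"
  unfolding ivl_def by (subst AE_restrict_space_iff) auto

lemma AE_ivlI: "(\<And>x. a < x \<Longrightarrow> x < b \<Longrightarrow> P x) \<Longrightarrow> AE x in ivl a b. P x"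
  by (rule AE_I2) auto

lemma integrable_ivl_bounded:
  fixes f :: "real \<Rightarrow> 'b::{banach, second_countable_topology}"
  assumes "f \<in> borel_measurable (ivl a b)" "\<And>x. a < x \<Longrightarrow> x < b \<Longrightarrow> norm (f x) \<le> B"
  shows "integrable (ivl a b) f"
  by (rule finite_measure.integrable_const_bound[OF finite_measure_ivl, where B = B]) (auto intro!: AE_ivlI assms)

lemma integrable_ivl_continuous:
  fixes f :: "real \<Rightarrow> real"
  assumes "continuous_on {a..b} f"
  shows "integrable (ivl a b) f"
  unfolding integrable_ivl_iff
  by (rule set_integrable_subset[OF borel_integrable_atLeastAtMost'[OF assms]]) auto

lemma integral_ivl_Icc:
  fixes f :: "real \<Rightarrow> real"
  shows "integral\<^sup>L (ivl a b) f = (LINT x:{a..b}|lborel. f x)"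
  unfolding integral_ivl set_lebesgue_integral_def
  by (rule integral_discrete_difference[of "{a,b}"]) (auto simp: indicator_def)

lemma integral_ivl_Ioc:
  fixes f :: "real \<Rightarrow> 'b::{banach, second_countable_topology}"
  shows "integral\<^sup>L (ivl a b) f = (LINT x:{a<..b}|lborel. f x)"
  unfolding integral_ivl set_lebesgue_integral_def
  by (rule integral_discrete_difference[of "{b}"]) (auto simp: indicator_def)

lemma integrable_ivl_Ioc:
  fixes f :: "real \<Rightarrow> 'b::{banach, second_countable_topology}"
  shows "integrable (ivl a b) f \<longleftrightarrow> set_integrable lborel {a<..b} f"
  unfolding integrable_ivl_iff set_integrable_def
  by (rule integrable_discrete_difference[of "{b}"]) (auto simp: indicator_def)

text \<open>A nonnegative integrand with zero integral vanishes almost everywhere, which would make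
  the nonempty open interval a null set.\<close>

lemma integral_ivl_pos:
  fixes f :: "real \<Rightarrow> real"
  assumes "a < b" "integrable (ivl a b) f" "\<And>x. a < x \<Longrightarrow> x < b \<Longrightarrow> 0 < f x"
  shows "0 < integral\<^sup>L (ivl a b) f"
proof -
  have ae: "AE x in ivl a b. 0 \<le> f x" by (rule AE_ivlI) (rule less_imp_le[OF assms(3)])
  have "integral\<^sup>L (ivl a b) f \<noteq> 0"
  proof
    assume "integral\<^sup>L (ivl a b) f = 0"
    with integral_nonneg_eq_0_iff_AE[OF assms(2) ae] have "AE x in ivl a b. f x = 0" by blast
    moreover have "AE x in ivl a b. f x \<noteq> 0" by (rule AE_ivlI) (metis assms(3) less_irrefl)
    ultimately have "AE x in ivl a b. False" by (rule eventually_elim2) auto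
    then have "emeasure (ivl a b) (space (ivl a b)) = 0"
      by (simp add: eventually_False ae_filter_eq_bot_iff del: space_ivl)
    then show False using assms(1) by (simp add: ivl_def emeasure_restrict_space)
  qed
  moreover have "0 \<le> integral\<^sup>L (ivl a b) f" using ae by (rule integral_nonneg_AE)
  ultimately show ?thesis by simp
qed

lemma FTC_ivl:
  fixes F f :: "real \<Rightarrow> real"
  assumes "a \<le> b" "\<And>x. a \<le> x \<Longrightarrow> x \<le> b \<Longrightarrow> (F has_real_derivative f x) (at x)"
    "continuous_on {a..b} f"
  shows "integral\<^sup>L (ivl a b) f = F b - F a"
proof -
  have "(LBINT x. indicator {a..b} x *\<^sub>R f x) = F b - F a"
    using assms by (intro integral_FTC_Icc)
      (auto simp: has_real_derivative_iff_has_vector_derivative intro: has_vector_derivative_at_within)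
  then show ?thesis by (simp add: integral_ivl_Icc set_lebesgue_integral_def)
qed

section \<open>Trigonometric sums\<close>

text \<open>This is the squared modulus of \<open>1 - r * cis t\<close>, the denominator of the
  Poisson kernel at radius \<open>r\<close>.\<close>

definition pdenom :: "real \<Rightarrow> real \<Rightarrow> real" where
  "pdenom r t = 1 - 2 * r * cos t + r\<^sup>2"

lemma pdenom_alt: "pdenom r t = (1 - r)\<^sup>2 + 2 * r * (1 - cos t)"
  by (simp add: pdenom_def power2_eq_square algebra_simps)

lemma pdenom_ge: "0 \<le> r \<Longrightarrow> (1 - r)\<^sup>2 \<le> pdenom r t"
  by (simp add: pdenom_alt)

lemma pdenom_pos: "0 \<le> r \<Longrightarrow> r < 1 \<Longrightarrow> 0 < pdenom r t"
  by (rule less_le_trans[OF _ pdenom_ge]) auto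

lemma pdenom_le: "0 \<le> r \<Longrightarrow> r \<le> 1 \<Longrightarrow> pdenom r t \<le> 4"
proof -
  assume r: "0 \<le> r" "r \<le> 1"
  have "pdenom r t \<le> (1 - r)\<^sup>2 + 2 * r * 2"
    unfolding pdenom_alt using r cos_ge_minus_one[of t] by (intro add_left_mono mult_left_mono) auto
  also have "\<dots> = (1 + r)\<^sup>2" by (simp add: power2_eq_square algebra_simps)
  also have "\<dots> \<le> 2\<^sup>2" using r by (intro power_mono) auto
  finally show ?thesis by simp
qed

text \<open>In \<open>pdenom_alt\<close> the second summand controls \<open>1 - cos t\<close> unless
  \<open>r\<close> is small, and for small \<open>r\<close> the first is bounded below. The
  threshold has to satisfy both \<open>8 r >= 1\<close> and \<open>4 (1 - r)^2 >= 2\<close>; 1/4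
  does.\<close>

lemma one_minus_cos_le_pdenom:
  assumes "0 \<le> r" "r < 1"
  shows "1 - cos t \<le> 4 * pdenom r t"
proof (cases "r \<ge> 1 / 4")
  case True
  have "1 * (1 - cos t) \<le> 8 * r * (1 - cos t)" using True by (intro mult_right_mono) auto
  moreover have "4 * pdenom r t = 4 * (1 - r)\<^sup>2 + 8 * r * (1 - cos t)"
    by (simp add: pdenom_alt algebra_simps)
  ultimately show ?thesis by (smt (verit) zero_le_power2)
next
  case False
  then have "(3/4)\<^sup>2 \<le> (1 - r)\<^sup>2" by (intro power_mono) auto
  then have "2 \<le> 4 * pdenom r t" using pdenom_ge[OF assms(1), of t] by (simp add: power2_eq_square)
  then show ?thesis using cos_ge_minus_one[of t] by linarith
qed

lemma cis_geometric:
  fixes r t :: real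
  assumes "0 \<le> r" "r < 1"
  defines "z \<equiv> of_real r * cis t"
  shows "norm z < 1" "(1 - z) * cnj (1 - z) = of_real (pdenom r t)" "1 - z \<noteq> 0"
proof -
  show 1: "norm z < 1" using assms by (simp add: norm_mult)
  then show "1 - z \<noteq> 0" by auto
  have "(1 - r * cos t)\<^sup>2 + (r * sin t)\<^sup>2 = pdenom r t"
    using sin_cos_squared_add[of t] unfolding pdenom_def by algebra
  then show "(1 - z) * cnj (1 - z) = of_real (pdenom r t)"
    unfolding complex_mult_cnj z_def by (simp add: complex_eq_iff)
qed

lemma sums_cos:
  assumes "0 \<le> r" "r < 1"
  shows "(\<lambda>j. r ^ j * cos (real j * t)) sums ((1 - r * cos t) / pdenom r t)"
proof -
  define z where "z = of_real r * cis t"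
  note z = cis_geometric[OF assms, of t, folded z_def]
  have "(\<lambda>j. z ^ j) sums (1 / (1 - z))" using z(1) by (rule geometric_sums)
  then have "(\<lambda>j. Re (z ^ j)) sums Re (1 / (1 - z))" by (rule sums_Re)
  moreover have "Re (z ^ j) = r ^ j * cos (real j * t)" for j
    by (simp add: z_def power_mult_distrib Complex.DeMoivre)
  moreover have "1 / (1 - z) = cnj (1 - z) / of_real (pdenom r t)"
    using z(2,3) pdenom_pos[OF assms, of t] by (simp add: field_simps)
  then have "Re (1 / (1 - z)) = (1 - r * cos t) / pdenom r t"
    by (simp add: z_def)
  ultimately show ?thesis by simp
qed

text \<open>Twice the real part of a geometric series minus 1: the Poisson kernel, whose constant
  term counts once.\<close>

lemma sums_poisson:
  assumes "0 \<le> r" "r < 1"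
  shows "(\<lambda>j. if j = 0 then 1 else 2 * r ^ j * cos (real j * t)) sums ((1 - r\<^sup>2) / pdenom r t)"
proof -
  have "(\<lambda>j. 2 * (r ^ j * cos (real j * t)) - (if j = 0 then 1 else 0)) sums
     (2 * ((1 - r * cos t) / pdenom r t) - 1)"
    using sums_single[of 0 "\<lambda>_. 1::real"] by (intro sums_diff sums_mult sums_cos assms) simp_all
  moreover have "2 * ((1 - r * cos t) / pdenom r t) - 1 = (1 - r\<^sup>2) / pdenom r t"
    using pdenom_pos[OF assms, of t] by (simp add: field_simps) (simp add: pdenom_def)
  moreover have "(\<lambda>j. 2 * (r ^ j * cos (real j * t)) - (if j = 0 then 1 else 0)) =
      (\<lambda>j. if j = 0 then 1 else 2 * r ^ j * cos (real j * t))"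
    by (rule ext) simp
  ultimately show ?thesis by simp
qed

text \<open>The product formula gives a difference of two cosine series, at \<open>a - y\<close> and
  \<open>a + y\<close>. Over the common denominator the numerator factors through
  \<open>sin a * sin y\<close>, so the kernel is visibly positive for 0 < r < 1 and
  \<open>a\<close>, \<open>y\<close> in (0, pi). All positivity of \<open>K\<close> comes from
  here.\<close>

lemma sums_sin_sin:
  assumes "0 \<le> r" "r < 1"
  shows "(\<lambda>j. r ^ j * (sin (real j * a) * sin (real j * y))) sums
    (r * (1 - r\<^sup>2) * sin a * sin y / (pdenom r (a - y) * pdenom r (a + y)))"
proof -
  let ?d = "pdenom r (a - y)" and ?e = "pdenom r (a + y)"
  have "(\<lambda>j. (r ^ j * cos (real j * (a - y)) - r ^ j * cos (real j * (a + y))) / 2) sums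
     (((1 - r * cos (a - y)) / ?d - (1 - r * cos (a + y)) / ?e) / 2)"
    by (intro sums_divide sums_diff sums_cos assms)
  moreover have "(r ^ j * cos (real j * (a - y)) - r ^ j * cos (real j * (a + y))) / 2 =
     r ^ j * (sin (real j * a) * sin (real j * y))" for j
    by (simp add: algebra_simps cos_add cos_diff)
  moreover have "((1 - r * cos (a - y)) / ?d - (1 - r * cos (a + y)) / ?e) / 2 =
     ((1 - r * cos (a - y)) * ?e - (1 - r * cos (a + y)) * ?d) / 2 / (?d * ?e)"
    using pdenom_pos[OF assms, of "a - y"] pdenom_pos[OF assms, of "a + y"]
    by (simp add: field_simps)
  moreover have "((1 - r * cos (a - y)) * ?e - (1 - r * cos (a + y)) * ?d) / 2 =
     r * (1 - r\<^sup>2) * sin a * sin y"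
    unfolding pdenom_def cos_add cos_diff by algebra
  ultimately show ?thesis by simp
qed

text \<open>Imaginary part of \<open>z / (1 - z)^2\<close> at \<open>z = r cis t\<close>. The sum is
  -1/2 times the derivative in \<open>t\<close> of the Poisson kernel, hence the kernel that
  produces derivatives of Poisson extensions.\<close>

lemma sums_deriv_sin:
  assumes "0 \<le> r" "r < 1"
  shows "(\<lambda>j. real j * r ^ j * sin (real j * t)) sums (r * (1 - r\<^sup>2) * sin t / (pdenom r t)\<^sup>2)"
proof -
  define z where "z = of_real r * cis t"
  note z = cis_geometric[OF assms, of t, folded z_def]
  have "(\<lambda>j. of_nat (Suc j) * z ^ j) sums (1 / (1 - z)\<^sup>2)" using z(1) by (rule geometric_deriv_sums)
  then have "(\<lambda>j. z * (of_nat (Suc j) * z ^ j)) sums (z * (1 / (1 - z)\<^sup>2))" by (rule sums_mult)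
  then have "(\<lambda>j. of_nat (Suc j) * z ^ Suc j) sums (z / (1 - z)\<^sup>2)"
    by (simp add: mult_ac)
  then have "(\<lambda>j. of_nat j * z ^ j) sums (z / (1 - z)\<^sup>2)"
    by (subst (asm) sums_Suc_iff) simp
  then have "(\<lambda>j. Im (of_nat j * z ^ j)) sums Im (z / (1 - z)\<^sup>2)" by (rule sums_Im)
  moreover have "Im (of_nat j * z ^ j) = real j * r ^ j * sin (real j * t)" for j
  proof -
    have "of_nat j * z ^ j = of_real (real j * r ^ j) * cis (real j * t)"
      by (simp add: z_def power_mult_distrib Complex.DeMoivre)
    then show ?thesis by (simp only: Im_complex_of_real) simp
  qed
  moreover have "z / (1 - z)\<^sup>2 = z * (cnj (1 - z))\<^sup>2 / of_real ((pdenom r t)\<^sup>2)"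
  proof -
    have "of_real ((pdenom r t)\<^sup>2) = (1 - z)\<^sup>2 * (cnj (1 - z))\<^sup>2"
      using z(2) by (metis of_real_power power_mult_distrib)
    then show ?thesis using z(3) by simp
  qed
  moreover have "Im (z * (cnj (1 - z))\<^sup>2) = r * (1 - r\<^sup>2) * sin t"
  proof -
    have "Im (z * (cnj (1 - z))\<^sup>2) = r * sin t * ((1 - r * cos t)\<^sup>2 - (r * sin t)\<^sup>2) +
       r * cos t * (2 * (1 - r * cos t) * (r * sin t))"
      by (simp add: z_def power2_eq_square algebra_simps)
    also have "\<dots> = r * (1 - r\<^sup>2) * sin t"
      using sin_cos_squared_add[of t] by algebra
    finally show ?thesis .
  qed
  ultimately show ?thesis by (simp only: Im_divide_of_real)
qed

section \<open>Sine coefficients on the half period\<close>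

text \<open>The series of absolute values is controlled by \<open>|\<phi>|\<close> times the sum of
  the \<open>|c j|\<close>, so sum and integral may be exchanged.\<close>

lemma integral_mult_series:
  fixes \<phi> k :: "'a \<Rightarrow> real"
  assumes \<phi>: "integrable M \<phi>" and e: "\<And>j. e j \<in> borel_measurable M"
    and bound: "\<And>j x. x \<in> space M \<Longrightarrow> \<bar>e j x\<bar> \<le> 1" and c: "summable (\<lambda>j. \<bar>c j\<bar>)"
    and k: "\<And>x. x \<in> space M \<Longrightarrow> (\<lambda>j. c j * e j x) sums k x"
  shows "integrable M (\<lambda>x. \<phi> x * k x)"
    and "(\<lambda>j. c j * (LINT x|M. \<phi> x * e j x)) sums (LINT x|M. \<phi> x * k x)"
proof -
  note [measurable] = e borel_measurable_integrable[OF \<phi>]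
  have int: "integrable M (\<lambda>x. \<phi> x * e j x)" for j
    by (rule Bochner_Integration.integrable_bound[OF \<phi>])
       (auto simp: abs_mult intro!: AE_I2 mult_left_le bound)
  define f where "f j x = c j * (\<phi> x * e j x)" for j x
  have fint: "integrable M (f j)" for j
    unfolding f_def by (intro integrable_mult_right int)
  have norm_f: "norm (f j x) \<le> \<bar>c j\<bar> * \<bar>\<phi> x\<bar>" if "x \<in> space M" for j x
    using bound[OF that, of j] unfolding f_def
    by (auto simp: abs_mult intro!: mult_left_mono mult_left_le)
  have ae: "AE x in M. summable (\<lambda>j. norm (f j x))"
  proof (rule AE_I2)
    fix x assume x: "x \<in> space M"
    show "summable (\<lambda>j. norm (f j x))"
      by (rule summable_comparison_test'[OF summable_mult2[OF c, of "\<bar>\<phi> x\<bar>"]])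
         (use norm_f[OF x] in auto)
  qed
  have sn: "summable (\<lambda>j. LINT x|M. norm (f j x))"
  proof (rule summable_comparison_test'[OF summable_mult2[OF c, of "LINT x|M. \<bar>\<phi> x\<bar>"]])
    fix j
    have "(LINT x|M. norm (f j x)) \<le> (LINT x|M. \<bar>c j\<bar> * \<bar>\<phi> x\<bar>)"
      using norm_f fint \<phi> by (intro integral_mono) auto
    then show "norm (LINT x|M. norm (f j x)) \<le> \<bar>c j\<bar> * (LINT x|M. \<bar>\<phi> x\<bar>)" by simp
  qed
  have eq: "(\<Sum>j. f j x) = \<phi> x * k x" if "x \<in> space M" for x
  proof -
    have "(\<lambda>j. \<phi> x * (c j * e j x)) sums (\<phi> x * k x)"
      by (intro sums_mult k that)
    then show ?thesis unfolding f_def by (simp add: sums_iff mult_ac)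
  qed
  have "integrable M (\<lambda>x. \<Sum>j. f j x)" by (rule integrable_suminf[OF fint ae sn])
  then show "integrable M (\<lambda>x. \<phi> x * k x)"
    by (rule Bochner_Integration.integrable_cong[THEN iffD1, rotated -1]) (auto simp: eq)
  have "(\<lambda>j. integral\<^sup>L M (f j)) sums (LINT x|M. (\<Sum>j. f j x))" by (rule sums_integral[OF fint ae sn])
  moreover have "(LINT x|M. (\<Sum>j. f j x)) = (LINT x|M. \<phi> x * k x)"
    by (rule Bochner_Integration.integral_cong) (auto simp: eq)
  moreover have "integral\<^sup>L M (f j) = c j * (LINT x|M. \<phi> x * e j x)" for j
    unfolding f_def by simp
  ultimately show "(\<lambda>j. c j * (LINT x|M. \<phi> x * e j x)) sums (LINT x|M. \<phi> x * k x)" by simp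
qed

section \<open>Square integrable functions on the half period and Bessel's inequality\<close>

definition L2_half :: "(real \<Rightarrow> real) \<Rightarrow> bool" where
  "L2_half \<phi> \<longleftrightarrow> \<phi> \<in> borel_measurable (ivl 0 pi) \<and> integrable (ivl 0 pi) (\<lambda>y. (\<phi> y)\<^sup>2)"

text \<open>Without the factor \<open>2 / pi\<close> of a sine series; that factor is part of the
  eigenvalues \<open>mu\<close>.\<close>

definition sine_coeff :: "(real \<Rightarrow> real) \<Rightarrow> nat \<Rightarrow> real" where
  "sine_coeff \<phi> j = (LINT y|ivl 0 pi. \<phi> y * sin (real j * y))"

lemma L2_half_measurable [measurable_dest]: "L2_half \<phi> \<Longrightarrow> \<phi> \<in> borel_measurable (ivl 0 pi)"
  by (simp add: L2_half_def)

lemma integrable_mult_L2: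
  fixes f g :: "'a \<Rightarrow> real"
  assumes "f \<in> borel_measurable M" "g \<in> borel_measurable M"
    "integrable M (\<lambda>x. (f x)\<^sup>2)" "integrable M (\<lambda>x. (g x)\<^sup>2)"
  shows "integrable M (\<lambda>x. f x * g x)"
proof (rule Bochner_Integration.integrable_bound)
  show "integrable M (\<lambda>x. (f x)\<^sup>2 + (g x)\<^sup>2)" using assms by simp
  show "(\<lambda>x. f x * g x) \<in> borel_measurable M" using assms by measurable
  have "\<bar>f x * g x\<bar> \<le> (f x)\<^sup>2 + (g x)\<^sup>2" for x
  proof -
    have "2 * \<bar>f x\<bar> * \<bar>g x\<bar> \<le> \<bar>f x\<bar>\<^sup>2 + \<bar>g x\<bar>\<^sup>2" by (rule sum_squares_bound)
    moreover have "0 \<le> \<bar>f x\<bar> * \<bar>g x\<bar>" by simp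
    ultimately show ?thesis unfolding abs_mult power2_abs by linarith
  qed
  then show "AE x in M. norm (f x * g x) \<le> norm ((f x)\<^sup>2 + (g x)\<^sup>2)" by simp
qed

lemma L2_half_mult: "L2_half \<phi> \<Longrightarrow> L2_half \<eta> \<Longrightarrow> integrable (ivl 0 pi) (\<lambda>y. \<phi> y * \<eta> y)"
  unfolding L2_half_def by (intro integrable_mult_L2) auto

lemma L2_half_dominated:
  assumes "L2_half p" "\<phi> \<in> borel_measurable (ivl 0 pi)"
    "\<And>y. 0 < y \<Longrightarrow> y < pi \<Longrightarrow> \<bar>\<phi> y\<bar> \<le> \<bar>p y\<bar>"
  shows "L2_half \<phi>"
proof -
  note [measurable] = assms(2)
  have "integrable (ivl 0 pi) (\<lambda>y. (\<phi> y)\<^sup>2)"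
  proof (rule Bochner_Integration.integrable_bound)
    show "integrable (ivl 0 pi) (\<lambda>y. (p y)\<^sup>2)" using assms by (auto simp: L2_half_def)
    show "AE x in ivl 0 pi. norm ((\<phi> x)\<^sup>2) \<le> norm ((p x)\<^sup>2)"
      using assms(3) by (intro AE_ivlI) (auto simp: abs_le_square_iff)
  qed measurable
  then show ?thesis using assms by (auto simp: L2_half_def)
qed

lemma L2_half_bounded:
  assumes "\<phi> \<in> borel_measurable (ivl 0 pi)" "\<And>y. 0 < y \<Longrightarrow> y < pi \<Longrightarrow> \<bar>\<phi> y\<bar> \<le> B"
  shows "L2_half \<phi>"
proof (rule L2_half_dominated)
  show "L2_half (\<lambda>_. B)"
    unfolding L2_half_def by (intro conjI integrable_ivl_continuous continuous_intros) simp
  show "\<bar>\<phi> y\<bar> \<le> \<bar>B\<bar>" if "0 < y" "y < pi" for y using assms(2)[OF that] by linarith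
qed fact

lemma L2_half_integrable: "L2_half \<phi> \<Longrightarrow> integrable (ivl 0 pi) \<phi>"
  using L2_half_mult[of \<phi> "\<lambda>_. 1", OF _ L2_half_bounded[of _ 1]] by simp

lemma L2_half_scale: "L2_half \<phi> \<Longrightarrow> L2_half (\<lambda>y. c * \<phi> y)"
  by (auto simp: L2_half_def power_mult_distrib)

lemma L2_half_add:
  assumes "L2_half \<phi>" "L2_half \<eta>"
  shows "L2_half (\<lambda>y. \<phi> y + \<eta> y)"
proof -
  have "integrable (ivl 0 pi) (\<lambda>y. (\<phi> y)\<^sup>2 + (\<eta> y)\<^sup>2 + 2 * (\<phi> y * \<eta> y))"
    using assms L2_half_mult[OF assms] by (auto simp: L2_half_def)
  then show ?thesis using assms
    by (auto simp: L2_half_def power2_sum mult.assoc)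
qed

lemma L2_half_diff: "L2_half \<phi> \<Longrightarrow> L2_half \<eta> \<Longrightarrow> L2_half (\<lambda>y. \<phi> y - \<eta> y)"
  using L2_half_add[of \<phi> "\<lambda>y. (-1) * \<eta> y"] L2_half_scale[of \<eta> "-1"] by simp

lemma integrable_mult_sin: "L2_half \<phi> \<Longrightarrow> integrable (ivl 0 pi) (\<lambda>y. \<phi> y * sin (real j * y))"
  by (rule L2_half_mult) (auto intro!: L2_half_bounded[of _ 1])

lemma sine_coeff_0 [simp]: "sine_coeff \<phi> 0 = 0"
  by (simp add: sine_coeff_def)

lemma sine_coeff_diff:
  "L2_half \<phi> \<Longrightarrow> L2_half \<eta> \<Longrightarrow> sine_coeff (\<lambda>y. \<phi> y - \<eta> y) j = sine_coeff \<phi> j - sine_coeff \<eta> j"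
  unfolding sine_coeff_def by (simp add: left_diff_distrib integrable_mult_sin)

lemma sine_coeff_scale: "sine_coeff (\<lambda>y. c * \<phi> y) j = c * sine_coeff \<phi> j"
  unfolding sine_coeff_def by (simp add: mult.assoc)

lemma sine_coeff_cong_AE:
  assumes "\<phi> \<in> borel_measurable (ivl 0 pi)" "\<eta> \<in> borel_measurable (ivl 0 pi)"
    "AE y in ivl 0 pi. \<phi> y = \<eta> y"
  shows "sine_coeff \<phi> j = sine_coeff \<eta> j"
  unfolding sine_coeff_def using assms by (intro integral_cong_AE) auto

lemma integral_cos_ivl: "k \<noteq> 0 \<Longrightarrow> (LINT y|ivl 0 pi. cos (of_int k * y)) = 0"
  by (subst FTC_ivl[where F = "\<lambda>y. sin (of_int k * y) / of_int k"])
     (auto intro!: derivative_eq_intros continuous_intros simp: sin_int_times_real mult.commute)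

lemma sine_orthogonal:
  assumes "j > 0" "k > 0"
  shows "(LINT y|ivl 0 pi. sin (real j * y) * sin (real k * y)) = (if j = k then pi / 2 else 0)"
proof -
  have "(LINT y|ivl 0 pi. sin (real j * y) * sin (real k * y)) =
     (LINT y|ivl 0 pi. (cos (of_int (int j - int k) * y) - cos (of_int (int j + int k) * y)) / 2)"
    by (intro Bochner_Integration.integral_cong refl) (simp add: sin_times_sin algebra_simps)
  also have "\<dots> = ((LINT y|ivl 0 pi. cos (of_int (int j - int k) * y)) -
      (LINT y|ivl 0 pi. cos (of_int (int j + int k) * y))) / 2"
    by (subst integral_divide_zero, subst Bochner_Integration.integral_diff)
       (auto intro!: integrable_ivl_continuous continuous_intros)
  also have "\<dots> = (if j = k then pi / 2 else 0)"
  proof (cases "j = k")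
    case True
    have "(LINT y|ivl 0 pi. (1::real)) = pi"
      by (subst FTC_ivl[where F = "\<lambda>y. y"]) auto
    then show ?thesis using True assms integral_cos_ivl[of "int j + int k"] by simp
  next
    case False
    then show ?thesis using assms by (simp only: integral_cos_ivl) simp
  qed
  finally show ?thesis .
qed

text \<open>Expands the nonnegative integral of \<open>(\<phi> - 2 / pi * S)^2\<close>. Since
  \<open>sin (j y)\<close> has squared norm \<open>pi / 2\<close>, the factor \<open>2 / pi\<close>
  makes \<open>2 / pi * S\<close> the orthogonal projection of \<phi>.\<close>

lemma bessel_sum:
  assumes "L2_half \<phi>"
  shows "(\<Sum>j<N. (sine_coeff \<phi> j)\<^sup>2) \<le> pi / 2 * (LINT y|ivl 0 pi. (\<phi> y)\<^sup>2)"
proof -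
  let ?b = "sine_coeff \<phi>"
  define S where "S y = (\<Sum>j<N. ?b j * sin (real j * y))" for y
  let ?B = "\<Sum>j<N. (?b j)\<^sup>2"
  have [measurable]: "S \<in> borel_measurable (ivl 0 pi)" unfolding S_def[abs_def] by measurable
  have SL: "L2_half S"
    by (rule L2_half_bounded[of _ "\<Sum>j<N. \<bar>?b j\<bar>"])
       (auto simp: S_def abs_mult intro!: order_trans[OF sum_abs] sum_mono mult_left_le)
  have 1: "(LINT y|ivl 0 pi. \<phi> y * S y) = ?B"
  proof -
    have "(LINT y|ivl 0 pi. \<phi> y * S y) = (LINT y|ivl 0 pi. (\<Sum>j<N. ?b j * (\<phi> y * sin (real j * y))))"
      by (simp add: S_def sum_distrib_left mult_ac)
    also have "\<dots> = (\<Sum>j<N. ?b j * ?b j)"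
      using integrable_mult_sin[OF assms] by (subst Bochner_Integration.integral_sum) (auto simp: sine_coeff_def)
    finally show ?thesis by (simp add: power2_eq_square)
  qed
  have 2: "(LINT y|ivl 0 pi. S y * S y) = pi / 2 * ?B"
  proof -
    have i: "integrable (ivl 0 pi) (\<lambda>y. sin (real j * y) * sin (real k * y))" for j k
      by (intro integrable_ivl_continuous continuous_intros)
    have "(LINT y|ivl 0 pi. S y * S y) =
        (LINT y|ivl 0 pi. (\<Sum>j<N. \<Sum>k<N. ?b j * ?b k * (sin (real j * y) * sin (real k * y))))"
      unfolding S_def by (simp add: sum_product mult_ac)
    also have "\<dots> = (\<Sum>j<N. \<Sum>k<N. ?b j * ?b k * (LINT y|ivl 0 pi. sin (real j * y) * sin (real k * y)))"
      by (simp add: Bochner_Integration.integral_sum Bochner_Integration.integrable_sum integrable_mult_right i)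
    also have "\<dots> = (\<Sum>j<N. \<Sum>k<N. if k = j then pi / 2 * (?b j)\<^sup>2 else 0)"
    proof (intro sum.cong refl)
      fix j k
      show "?b j * ?b k * (LINT y|ivl 0 pi. sin (real j * y) * sin (real k * y)) =
          (if k = j then pi / 2 * (?b j)\<^sup>2 else 0)"
        using sine_orthogonal[of j k]
        by (cases "j = 0 \<or> k = 0") (auto simp: power2_eq_square)
    qed
    also have "\<dots> = pi / 2 * ?B" by (simp add: sum_distrib_left)
    finally show ?thesis .
  qed
  have i1: "integrable (ivl 0 pi) (\<lambda>y. \<phi> y * S y)" and i2: "integrable (ivl 0 pi) (\<lambda>y. S y * S y)"
    by (intro L2_half_mult assms SL)+
  have "0 \<le> (LINT y|ivl 0 pi. (\<phi> y - 2 / pi * S y)\<^sup>2)" by simp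
  also have "\<dots> = (LINT y|ivl 0 pi. (\<phi> y)\<^sup>2 - 4 / pi * (\<phi> y * S y) + 4 / pi\<^sup>2 * (S y * S y))"
    by (intro Bochner_Integration.integral_cong refl) (simp add: power2_eq_square field_simps)
  also have "\<dots> = (LINT y|ivl 0 pi. (\<phi> y)\<^sup>2) - 4 / pi * ?B + 4 / pi\<^sup>2 * (pi / 2 * ?B)"
    using assms i1 i2 by (simp add: L2_half_def 1 2)
  also have "\<dots> = (LINT y|ivl 0 pi. (\<phi> y)\<^sup>2) - 2 / pi * ?B"
    by (simp add: power2_eq_square field_simps)
  finally have "2 / pi * ?B \<le> (LINT y|ivl 0 pi. (\<phi> y)\<^sup>2)" by simp
  then show ?thesis by (simp add: field_simps)
qed

lemma bessel:
  assumes "L2_half \<phi>"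
  shows "summable (\<lambda>j. (sine_coeff \<phi> j)\<^sup>2)"
    and "(\<Sum>j. (sine_coeff \<phi> j)\<^sup>2) \<le> pi / 2 * (LINT y|ivl 0 pi. (\<phi> y)\<^sup>2)"
proof -
  show "summable (\<lambda>j. (sine_coeff \<phi> j)\<^sup>2)"
    by (rule summableI_nonneg_bounded[OF _ bessel_sum[OF assms]]) simp
  then show "(\<Sum>j. (sine_coeff \<phi> j)\<^sup>2) \<le> pi / 2 * (LINT y|ivl 0 pi. (\<phi> y)\<^sup>2)"
    by (rule suminf_le_const) (rule bessel_sum[OF assms])
qed

lemma cauchy_schwarz_summable:
  fixes a b :: "nat \<Rightarrow> real"
  assumes a: "summable (\<lambda>j. (a j)\<^sup>2)" and b: "summable (\<lambda>j. (b j)\<^sup>2)"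
  shows "summable (\<lambda>j. \<bar>a j\<bar> * \<bar>b j\<bar>)"
    and "(\<Sum>j. \<bar>a j\<bar> * \<bar>b j\<bar>) \<le> sqrt (\<Sum>j. (a j)\<^sup>2) * sqrt (\<Sum>j. (b j)\<^sup>2)"
proof -
  have bd: "(\<Sum>j<N. \<bar>a j\<bar> * \<bar>b j\<bar>) \<le> sqrt (\<Sum>j. (a j)\<^sup>2) * sqrt (\<Sum>j. (b j)\<^sup>2)" for N
  proof -
    have "(\<Sum>j<N. \<bar>a j\<bar> * \<bar>b j\<bar>) \<le> L2_set a {..<N} * L2_set b {..<N}" by (rule L2_set_mult_ineq)
    also have "\<dots> \<le> sqrt (\<Sum>j. (a j)\<^sup>2) * sqrt (\<Sum>j. (b j)\<^sup>2)"
      unfolding L2_set_def using a b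
      by (intro mult_mono real_sqrt_le_mono sum_le_suminf) (auto intro!: suminf_nonneg sum_nonneg)
    finally show ?thesis .
  qed
  show "summable (\<lambda>j. \<bar>a j\<bar> * \<bar>b j\<bar>)"
    by (rule summableI_nonneg_bounded[OF _ bd]) simp
  then show "(\<Sum>j. \<bar>a j\<bar> * \<bar>b j\<bar>) \<le> sqrt (\<Sum>j. (a j)\<^sup>2) * sqrt (\<Sum>j. (b j)\<^sup>2)"
    by (rule suminf_le_const) (rule bd)
qed

text \<open>Up to the factor \<open>pi / 2\<close>, the harmonic extension to the disc of the odd
  continuation of \<phi>, at radius \<open>r\<close> and angle \<open>a\<close>, with the kernel in
  the closed form of \<open>sums_sin_sin\<close>.\<close>

definition poisson_sine :: "(real \<Rightarrow> real) \<Rightarrow> real \<Rightarrow> real \<Rightarrow> real" where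
  "poisson_sine \<phi> r a = (LINT y|ivl 0 pi. \<phi> y *
     (r * (1 - r\<^sup>2) * sin a * sin y / (pdenom r (a - y) * pdenom r (a + y))))"

lemma poisson_sine:
  assumes "L2_half \<phi>" "0 \<le> r" "r < 1"
  shows "integrable (ivl 0 pi) (\<lambda>y. \<phi> y *
           (r * (1 - r\<^sup>2) * sin a * sin y / (pdenom r (a - y) * pdenom r (a + y))))"
    and "(\<lambda>j. r ^ j * sine_coeff \<phi> j * sin (real j * a)) sums poisson_sine \<phi> r a"
proof -
  let ?k = "\<lambda>y. r * (1 - r\<^sup>2) * sin a * sin y / (pdenom r (a - y) * pdenom r (a + y))"
  have k: "(\<lambda>j. r ^ j * sin (real j * a) * sin (real j * y)) sums ?k y" for y
    using sums_sin_sin[OF assms(2,3), of a y] by (simp add: mult.assoc)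
  have s: "summable (\<lambda>j. \<bar>r ^ j * sin (real j * a)\<bar>)"
    by (rule summable_comparison_test'[OF summable_geometric[of r]])
       (use assms in \<open>auto simp: abs_mult intro!: mult_left_le\<close>)
  note * = integral_mult_series[OF L2_half_integrable[OF assms(1)],
      of "\<lambda>j y. sin (real j * y)" "\<lambda>j. r ^ j * sin (real j * a)" ?k, OF _ _ s k]
  show "integrable (ivl 0 pi) (\<lambda>y. \<phi> y * ?k y)" by (rule *(1)) auto
  have "(\<lambda>j. r ^ j * sin (real j * a) * sine_coeff \<phi> j) sums poisson_sine \<phi> r a"
    unfolding sine_coeff_def poisson_sine_def by (rule *(2)) auto
  then show "(\<lambda>j. r ^ j * sine_coeff \<phi> j * sin (real j * a)) sums poisson_sine \<phi> r a"
    by (simp add: mult_ac)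
qed

text \<open>Both denominators are at most 4, so the kernel is at least
  \<open>r (1 - r^2) sin a sin y / 16\<close>. This gives away the peak of the kernel but keeps its
  exact rate of vanishing, \<open>sin a\<close>, at the ends of the interval.\<close>

lemma poisson_sine_lower:
  assumes "L2_half \<phi>" "0 \<le> r" "r < 1" "0 < a" "a < pi"
    and nonneg: "\<And>y. 0 < y \<Longrightarrow> y < pi \<Longrightarrow> 0 \<le> \<phi> y"
  shows "r * (1 - r\<^sup>2) / 16 * sin a * sine_coeff \<phi> 1 \<le> poisson_sine \<phi> r a"
proof -
  have "r * (1 - r\<^sup>2) / 16 * sin a * sine_coeff \<phi> 1 =
      (LINT y|ivl 0 pi. r * (1 - r\<^sup>2) / 16 * sin a * (\<phi> y * sin (real 1 * y)))"
    unfolding sine_coeff_def by simp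
  also have "\<dots> \<le> poisson_sine \<phi> r a"
    unfolding poisson_sine_def
  proof (rule integral_mono[OF _ poisson_sine(1)[OF assms(1-3)]])
    show "integrable (ivl 0 pi) (\<lambda>y. r * (1 - r\<^sup>2) / 16 * sin a * (\<phi> y * sin (real 1 * y)))"
      by (intro integrable_mult_right integrable_mult_sin assms)
    fix y assume "y \<in> space (ivl 0 pi)"
    then have y: "0 < y" "y < pi" by auto
    let ?d = "pdenom r (a - y)" and ?e = "pdenom r (a + y)"
    have d: "0 < ?d" "0 < ?e" "?d \<le> 4" "?e \<le> 4"
      using assms by (auto intro!: pdenom_pos pdenom_le)
    then have "?d * ?e \<le> 4 * 4" by (intro mult_mono) auto
    then have "1 / 16 \<le> 1 / (?d * ?e)" using d by (intro divide_left_mono) auto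
    moreover have "0 \<le> r * (1 - r\<^sup>2) * sin a * (\<phi> y * sin y)"
      using assms y nonneg[OF y] by (intro mult_nonneg_nonneg) (auto simp: sin_gt_zero less_imp_le power_le_one)
    ultimately have "(r * (1 - r\<^sup>2) * sin a * (\<phi> y * sin y)) * (1 / 16) \<le>
        (r * (1 - r\<^sup>2) * sin a * (\<phi> y * sin y)) * (1 / (?d * ?e))"
      by (rule mult_left_mono)
    then show "r * (1 - r\<^sup>2) / 16 * sin a * (\<phi> y * sin (real 1 * y)) \<le>
       \<phi> y * (r * (1 - r\<^sup>2) * sin a * sin y / (?d * ?e))"
      by (simp add: mult_ac)
  qed
  finally show ?thesis .
qed

section \<open>The operator on odd functions\<close>

locale n_fold =
  fixes n :: nat
  assumes n_ge_3: "3 \<le> n"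
begin

text \<open>The \<open>j\<close>-th harmonic of a \<open>2 pi / n\<close>-periodic function has
  frequency \<open>n * j\<close>. The sign turns \<open>S\<close> into a positive operator, and
  \<open>2 / pi\<close> normalises \<open>sine_coeff\<close>.\<close>

definition mu :: "nat \<Rightarrow> real" where
  "mu j = - (2 / pi) * S_symbol (int (n * j))"

text \<open>With \<open>k = n j\<close>, the quantity \<open>2/\<pi>\<close> times the multiplier \<open>1/k (k\<^sup>2 - 1)/(k\<^sup>2 - 4) = 1/(4k) + 3/8 (1/(k - 2) + 1/(k + 2))\<close> is the
  moment \<open>\<integral> s\<^bsup>k\<^esup> w(s) ds\<close> over \<open>(0, 1)\<close> of a positive weight \<open>w\<close>, so that \<open>- S\<close> is a superposition of Poisson kernels.\<close>

definition weight :: "real \<Rightarrow> real" where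
  "weight s = 2 / pi * (1 / 4 + 3 / 8 * (s\<^sup>2 + 1 / s\<^sup>2)) / s"

definition K :: "(real \<Rightarrow> real) \<Rightarrow> real \<Rightarrow> real" where
  "K \<phi> a = (\<Sum>j. mu j * sine_coeff \<phi> j * sin (real j * a))"

lemma mu_0 [simp]: "mu 0 = 0"
  by (simp add: mu_def S_symbol_def)

lemma mu_partial_fractions:
  assumes "j > 0"
  shows "mu j = 2 / pi * (1 / (4 * real (n * j)) + 3 / 8 * (1 / (real (n * j) - 2) + 1 / (real (n * j) + 2)))"
proof -
  define k where "k = real (n * j)"
  have nj: "n * 1 \<le> n * j" using assms by (intro mult_left_mono) auto
  then have "3 \<le> n * j" using n_ge_3 by linarith
  then have k: "3 \<le> k" unfolding k_def by linarith
  then have "k\<^sup>2 - 4 = (k - 2) * (k + 2)" "k - 2 \<noteq> 0" "k + 2 \<noteq> 0" "k \<noteq> 0"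
    by (auto simp: power2_eq_square algebra_simps)
  then have "1 / k * ((k\<^sup>2 - 1) / (k\<^sup>2 - 4)) = 1 / (4 * k) + 3 / 8 * (1 / (k - 2) + 1 / (k + 2))"
    by (simp add: divide_simps) (simp add: power2_eq_square algebra_simps)
  moreover have "S_symbol (int (n * j)) = - (1 / k * ((k\<^sup>2 - 1) / (k\<^sup>2 - 4)))"
  proof -
    have "\<not> \<bar>int (n * j)\<bar> \<le> 2" using \<open>3 \<le> n * j\<close> by linarith
    then show ?thesis unfolding S_symbol_def k_def by simp
  qed
  ultimately have "S_symbol (int (n * j)) = - (1 / (4 * k) + 3 / 8 * (1 / (k - 2) + 1 / (k + 2)))"
    by simp
  then show ?thesis unfolding mu_def k_def by (simp only: mult_minus_left mult_minus_right minus_minus)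
qed

text \<open>With \<open>k = n j >= 3 j\<close> each of \<open>k\<close>, \<open>k - 2\<close>,
  \<open>k + 2\<close> is at least \<open>j\<close>, and the partial fraction coefficients 1/4, 3/8,
  3/8 add up to 1. At \<open>j = 0\<close> the upper bound reads 0 <= 0, as division by zero yields
  0.\<close>

lemma mu_pos: "j > 0 \<Longrightarrow> 0 < mu j"
  and mu_le: "mu j \<le> 1 / real j"
proof -
  have *: "0 < mu j \<and> mu j \<le> 1 / real j" if "j > 0"
  proof -
    define k where "k = real (n * j)"
    have "3 * j \<le> n * j" using n_ge_3 by (intro mult_right_mono) auto
    then have k: "3 * real j \<le> k" unfolding k_def by (metis of_nat_le_iff of_nat_mult of_nat_numeral)
    have j: "1 \<le> real j" using that by simp
    have "2 / pi \<le> 1" using pi_ge_two by simp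
    have "1 / (4 * k) + 3 / 8 * (1 / (k - 2) + 1 / (k + 2)) \<le>
        1 / (4 * real j) + 3 / 8 * (1 / real j + 1 / real j)"
      using k j by (intro add_mono mult_left_mono divide_left_mono mult_pos_pos) auto
    also have "\<dots> = 1 / real j" using j by (simp add: field_simps)
    finally have 1: "1 / (4 * k) + 3 / 8 * (1 / (k - 2) + 1 / (k + 2)) \<le> 1 / real j" .
    have 2: "0 < 1 / (4 * k) + 3 / 8 * (1 / (k - 2) + 1 / (k + 2))"
      using k j by (intro add_pos_pos mult_pos_pos) auto
    have mu: "mu j = 2 / pi * (1 / (4 * k) + 3 / 8 * (1 / (k - 2) + 1 / (k + 2)))"
      unfolding k_def by (rule mu_partial_fractions[OF that])
    have "mu j \<le> 1 * (1 / real j)"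
      unfolding mu using 1 2 \<open>2 / pi \<le> 1\<close> by (intro mult_mono) auto
    moreover have "0 < mu j" unfolding mu using 2 by (intro mult_pos_pos) auto
    ultimately show ?thesis by simp
  qed
  show "j > 0 \<Longrightarrow> 0 < mu j" using * by blast
  show "mu j \<le> 1 / real j" using * by (cases "j > 0") auto
qed

lemma mu_nonneg: "0 \<le> mu j"
  using mu_pos[of j] by (cases "j = 0") auto

lemma summable_mu_square: "summable (\<lambda>j. (mu j)\<^sup>2)"
proof (rule summable_comparison_test'[OF inverse_power_summable[of 2, where 'a = real]])
  fix j
  have "(mu j)\<^sup>2 \<le> (1 / real j)\<^sup>2" by (intro power_mono mu_le mu_nonneg)
  then show "norm ((mu j)\<^sup>2) \<le> inverse (real j ^ 2)" by (simp add: field_simps)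
qed simp

lemma weight_measurable [measurable]: "weight \<in> borel_measurable borel"
  unfolding weight_def[abs_def] by measurable

lemma weight_nonneg: "0 < s \<Longrightarrow> 0 \<le> weight s"
  unfolding weight_def by (intro divide_nonneg_nonneg mult_nonneg_nonneg add_nonneg_nonneg) auto

text \<open>Three powers of \<open>s\<close> clear the denominators of \<open>weight\<close>. They
  are available because \<open>n * j >= 3\<close>, which also keeps the natural number subtractions
  in the exponents from truncating.\<close>

lemma power_weight:
  assumes "s \<noteq> 0" "j > 0"
  shows "(s ^ n) ^ j * weight s =
    2 / pi * (1 / 4 * s ^ (n * j - 1) + 3 / 8 * (s ^ (n * j + 1) + s ^ (n * j - 3)))"
proof -
  have "3 \<le> n * j" using n_ge_3 assms(2) by (metis Suc_leI dual_order.trans mult_le_mono2 mult.right_neutral One_nat_def)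
  then obtain m where m: "n * j = m + 3" by (metis add.commute le_Suc_ex)
  have s3: "s ^ 3 * weight s = 2 / pi * (1 / 4 * s ^ 2 + 3 / 8 * (s ^ 4 + 1))"
    unfolding weight_def using assms(1) by (simp add: field_simps power2_eq_square eval_nat_numeral)
  have "(s ^ n) ^ j * weight s = s ^ m * (s ^ 3 * weight s)"
    by (simp add: power_mult[symmetric] m power_add)
  also have "\<dots> = 2 / pi * (1 / 4 * s ^ (m + 2) + 3 / 8 * (s ^ (m + 4) + s ^ m))"
    unfolding s3 power_add by algebra
  finally show ?thesis by (simp add: m add.commute[of 4])
qed

text \<open>The coefficients add up to 1 and \<open>2 / pi <= 1\<close>. One factor
  \<open>s ^ n\<close> thus makes \<open>weight\<close> bounded; it is the factor \<open>r\<close>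
  that the Poisson estimates carry along.\<close>

lemma power_weight_le:
  assumes "0 < s" "s < 1"
  shows "s ^ n * weight s \<le> 1"
proof -
  have "s ^ n * weight s = 2 / pi * (1 / 4 * s ^ (n - 1) + 3 / 8 * (s ^ (n + 1) + s ^ (n - 3)))"
    using power_weight[of s 1] assms by simp
  also have "\<dots> \<le> 1 * (1 / 4 * 1 + 3 / 8 * (1 + 1))"
    using assms pi_ge_two by (intro mult_mono add_mono power_le_one) (auto intro!: add_nonneg_nonneg)
  finally show ?thesis by simp
qed

lemma weight_power_integral:
  assumes "j > 0"
  shows "integrable (ivl 0 1) (\<lambda>s. (s ^ n) ^ j * weight s)"
    and "(LINT s|ivl 0 1. (s ^ n) ^ j * weight s) = mu j"
proof -
  let ?w = "\<lambda>s::real. 2 / pi * (1 / 4 * s ^ (n * j - 1) + 3 / 8 * (s ^ (n * j + 1) + s ^ (n * j - 3)))"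
  have cont: "continuous_on {0..1} ?w" by (intro continuous_intros)
  have eq: "(s ^ n) ^ j * weight s = ?w s" if "s \<in> space (ivl 0 1)" for s
    using that assms by (intro power_weight) auto
  have "integrable (ivl 0 1) ?w" using cont by (rule integrable_ivl_continuous)
  then show "integrable (ivl 0 1) (\<lambda>s. (s ^ n) ^ j * weight s)"
    by (rule Bochner_Integration.integrable_cong[THEN iffD2, rotated -1]) (auto simp: eq)
  have "3 \<le> n * j" using n_ge_3 assms by (metis Suc_leI dual_order.trans mult_le_mono2 mult.right_neutral One_nat_def)
  then obtain m where m: "n * j = m + 3" by (metis add.commute le_Suc_ex)
  define F where "F s = 2 / pi * (1 / 4 * (s ^ (m + 3) / real (m + 3)) +
      3 / 8 * (s ^ (m + 5) / real (m + 5) + s ^ (m + 1) / real (m + 1)))" for s :: real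
  have dF: "(F has_real_derivative ?w s) (at s)" for s
  proof -
    have p: "((\<lambda>s. s ^ Suc k / real (Suc k)) has_real_derivative s ^ k) (at s)" for k
      by (rule derivative_eq_intros refl | simp)+
    have "(F has_real_derivative 2 / pi * (1 / 4 * s ^ (m + 2) + 3 / 8 * (s ^ (m + 4) + s ^ m))) (at s)"
      unfolding F_def using p[of "m + 2"] p[of "m + 4"] p[of m]
      by (intro DERIV_cmult DERIV_add) (simp_all add: eval_nat_numeral)
    then show ?thesis by (simp add: m add.commute[of 4])
  qed
  have "(LINT s|ivl 0 1. (s ^ n) ^ j * weight s) = (LINT s|ivl 0 1. ?w s)"
    by (intro Bochner_Integration.integral_cong) (auto simp: eq)
  also have "\<dots> = F 1 - F 0" using cont dF by (intro FTC_ivl) auto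
  also have "\<dots> = mu j"
  proof -
    have "F 0 = 0" by (simp add: F_def zero_power)
    moreover have "real (m + 3) - 2 = real (m + 1)" "real (m + 3) + 2 = real (m + 5)" by simp_all
    ultimately show ?thesis
      unfolding mu_partial_fractions[OF assms] m by (simp add: F_def add.commute)
  qed
  finally show "(LINT s|ivl 0 1. (s ^ n) ^ j * weight s) = mu j" .
qed

section \<open>Boundedness, linearity and symmetry of \<open>K\<close>\<close>

definition K_bound :: real where
  "K_bound = sqrt (\<Sum>j. (mu j)\<^sup>2) * sqrt (pi / 2)"

lemma summable_K:
  assumes "L2_half \<phi>"
  shows "summable (\<lambda>j. \<bar>mu j * sine_coeff \<phi> j\<bar>)"
  using cauchy_schwarz_summable(1)[OF summable_mu_square bessel(1)[OF assms]] by (simp add: abs_mult)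

lemma summable_K_sin:
  assumes "L2_half \<phi>"
  shows "summable (\<lambda>j. \<bar>mu j * sine_coeff \<phi> j * sin (real j * a)\<bar>)"
  by (rule summable_comparison_test'[OF summable_K[OF assms]])
     (auto simp: abs_mult intro!: mult_left_le)

lemma sums_K:
  assumes "L2_half \<phi>"
  shows "(\<lambda>j. mu j * sine_coeff \<phi> j * sin (real j * a)) sums K \<phi> a"
  unfolding K_def by (rule summable_sums[OF summable_rabs_cancel[OF summable_K_sin[OF assms]]])

lemma K_bounded:
  assumes "L2_half \<phi>"
  shows "\<bar>K \<phi> a\<bar> \<le> K_bound * sqrt (LINT y|ivl 0 pi. (\<phi> y)\<^sup>2)"
proof -
  have s: "summable (\<lambda>j. \<bar>mu j\<bar> * \<bar>sine_coeff \<phi> j\<bar>)"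
    using summable_K[OF assms] by (simp add: abs_mult)
  have "\<bar>K \<phi> a\<bar> \<le> (\<Sum>j. \<bar>mu j * sine_coeff \<phi> j * sin (real j * a)\<bar>)"
    unfolding K_def by (rule summable_rabs[OF summable_K_sin[OF assms]])
  also have "\<dots> \<le> (\<Sum>j. \<bar>mu j\<bar> * \<bar>sine_coeff \<phi> j\<bar>)"
    by (rule suminf_le[OF _ summable_K_sin[OF assms] s])
       (auto simp: abs_mult intro!: mult_left_le)
  also have "\<dots> \<le> sqrt (\<Sum>j. (mu j)\<^sup>2) * sqrt (\<Sum>j. (sine_coeff \<phi> j)\<^sup>2)"
    by (rule cauchy_schwarz_summable(2)[OF summable_mu_square bessel(1)[OF assms]])
  also have "\<dots> \<le> sqrt (\<Sum>j. (mu j)\<^sup>2) * sqrt (pi / 2 * (LINT y|ivl 0 pi. (\<phi> y)\<^sup>2))"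
    using bessel(2)[OF assms] summable_mu_square
    by (intro mult_left_mono real_sqrt_le_mono) (auto intro!: suminf_nonneg)
  finally show ?thesis unfolding K_bound_def real_sqrt_mult by (simp only: mult.assoc)
qed

lemma K_cong_AE:
  assumes "\<phi> \<in> borel_measurable (ivl 0 pi)" "\<eta> \<in> borel_measurable (ivl 0 pi)"
    "AE y in ivl 0 pi. \<phi> y = \<eta> y"
  shows "K \<phi> a = K \<eta> a"
  unfolding K_def sine_coeff_cong_AE[OF assms] ..

lemma K_cong:
  assumes "\<And>y. 0 < y \<Longrightarrow> y < pi \<Longrightarrow> \<phi> y = \<eta> y"
  shows "K \<phi> a = K \<eta> a"
proof -
  have "sine_coeff \<phi> j = sine_coeff \<eta> j" for j
    unfolding sine_coeff_def by (rule Bochner_Integration.integral_cong) (auto simp: assms)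
  then show ?thesis unfolding K_def by simp
qed

lemma K_scale: "L2_half \<phi> \<Longrightarrow> K (\<lambda>y. c * \<phi> y) a = c * K \<phi> a"
  using sums_mult[OF sums_K[of \<phi> a], of c] unfolding K_def[of "\<lambda>y. c * \<phi> y"] sine_coeff_scale
  by (simp add: sums_iff mult_ac)

lemma K_diff:
  assumes "L2_half \<phi>" "L2_half \<eta>"
  shows "K (\<lambda>y. \<phi> y - \<eta> y) a = K \<phi> a - K \<eta> a"
  using sums_diff[OF sums_K[OF assms(1), of a] sums_K[OF assms(2), of a]]
  unfolding K_def[of "\<lambda>y. \<phi> y - \<eta> y"] sine_coeff_diff[OF assms]
  by (simp add: sums_iff algebra_simps)

lemma K_odd:
  assumes "L2_half \<phi>"
  shows "K \<phi> (- a) = - K \<phi> a"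
  using sums_minus[OF sums_K[OF assms, of a]] sums_K[OF assms, of "- a"]
  by (simp add: sums_iff)

lemma K_periodic: "K \<phi> (a + 2 * pi) = K \<phi> a"
proof -
  have "sin (real j * (a + 2 * pi)) = sin (real j * a)" for j
    using sin.plus_of_nat[of "real j * a" j] by (simp add: algebra_simps)
  then show ?thesis unfolding K_def by simp
qed

lemma K_measurable [measurable]: "K \<phi> \<in> borel_measurable borel"
  unfolding K_def[abs_def] by measurable

text \<open>Both sides equal the sum of \<open>mu j\<close> times the product of the two sine
  coefficients.\<close>

lemma K_symmetric:
  assumes "L2_half \<phi>" "L2_half \<eta>"
  shows "(LINT y|ivl 0 pi. \<eta> y * K \<phi> y) = (LINT y|ivl 0 pi. \<phi> y * K \<eta> y)"
proof -
  have *: "(\<lambda>j. mu j * sine_coeff \<phi> j * sine_coeff \<eta> j) sums (LINT y|ivl 0 pi. \<eta> y * K \<phi> y)"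
    if "L2_half \<phi>" "L2_half \<eta>" for \<phi> \<eta>
    unfolding sine_coeff_def[of \<eta>]
    by (rule integral_mult_series(2)[OF L2_half_integrable[OF that(2)] _ _ summable_K[OF that(1)] sums_K[OF that(1)]])
       auto
  have "(\<lambda>j. mu j * sine_coeff \<phi> j * sine_coeff \<eta> j) sums (LINT y|ivl 0 pi. \<phi> y * K \<eta> y)"
    using *[OF assms(2,1)] by (simp add: mult_ac)
  with *[OF assms] show ?thesis by (rule sums_unique2)
qed

text \<open>The moments of the nonnegative \<open>weight\<close> are the \<open>mu j\<close>, so the
  integrals of the absolute values are \<open>|mu j * c j|\<close>. These are summable, and the sum
  over \<open>j\<close> may be exchanged with the integral over \<open>s\<close>.\<close>

lemma K_poisson:
  assumes "L2_half \<phi>"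
  shows "integrable (ivl 0 1) (\<lambda>s. weight s * poisson_sine \<phi> (s ^ n) a)"
    and "K \<phi> a = (LINT s|ivl 0 1. weight s * poisson_sine \<phi> (s ^ n) a)"
proof -
  define c where "c j = sine_coeff \<phi> j * sin (real j * a)" for j
  \<comment> \<open>The term \<open>j = 0\<close> is made 0 explicitly: \<open>weight\<close> alone
    is not integrable at 0, while its coefficient \<open>sine_coeff \<phi> 0\<close>
    vanishes.\<close>
  define f where "f j s = (if j = 0 then 0 else (s ^ n) ^ j * weight s * c j)" for j s
  have fint: "integrable (ivl 0 1) (f j)" for j
    using weight_power_integral(1)[of j] unfolding f_def by (cases "j = 0") auto
  have fI: "integral\<^sup>L (ivl 0 1) (f j) = mu j * c j" for j
    using weight_power_integral(2)[of j] unfolding f_def by (cases "j = 0") auto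
  have nI: "(LINT s|ivl 0 1. norm (f j s)) = \<bar>mu j * c j\<bar>" for j
  proof -
    have "(LINT s|ivl 0 1. norm (f j s)) = (LINT s|ivl 0 1. (if j = 0 then 0 else (s ^ n) ^ j * weight s * \<bar>c j\<bar>))"
      by (intro Bochner_Integration.integral_cong refl) (auto simp: f_def abs_mult weight_nonneg)
    also have "\<dots> = \<bar>mu j * c j\<bar>"
      using weight_power_integral(2)[of j] mu_nonneg[of j] by (cases "j = 0") (auto simp: abs_mult)
    finally show ?thesis .
  qed
  have sums: "(\<lambda>j. f j s) sums (weight s * poisson_sine \<phi> (s ^ n) a)" and
    summ: "summable (\<lambda>j. norm (f j s))" if s: "s \<in> space (ivl 0 1)" for s
  proof -
    have r: "0 \<le> s ^ n" "s ^ n < 1" using s n_ge_3 by (auto simp: power_less_one_iff)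
    have eq: "f j s = weight s * ((s ^ n) ^ j * sine_coeff \<phi> j * sin (real j * a))" for j
      unfolding f_def c_def by auto
    show "(\<lambda>j. f j s) sums (weight s * poisson_sine \<phi> (s ^ n) a)"
      unfolding eq by (intro sums_mult poisson_sine assms r)
    have 1: "summable (\<lambda>j. (s ^ n) ^ j * (\<bar>weight s\<bar> * (LINT y|ivl 0 pi. \<bar>\<phi> y\<bar>)))"
      by (intro summable_mult2 summable_geometric) (use r in auto)
    show "summable (\<lambda>j. norm (f j s))"
    proof (rule summable_comparison_test'[OF 1])
      fix j
      have "\<bar>sine_coeff \<phi> j\<bar> \<le> (LINT y|ivl 0 pi. \<bar>\<phi> y\<bar>)"
        unfolding sine_coeff_def
        by (rule integral_abs_bound[THEN order_trans],
            rule integral_mono[OF integrable_abs[OF integrable_mult_sin[OF assms]]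
              integrable_abs[OF L2_half_integrable[OF assms]]])
           (simp add: abs_mult mult_left_le)
      then have "\<bar>sine_coeff \<phi> j\<bar> * \<bar>sin (real j * a)\<bar> \<le> (LINT y|ivl 0 pi. \<bar>\<phi> y\<bar>) * 1"
        by (intro mult_mono) auto
      then show "norm (norm (f j s)) \<le> (s ^ n) ^ j * (\<bar>weight s\<bar> * (LINT y|ivl 0 pi. \<bar>\<phi> y\<bar>))"
        using mult_left_mono[of "\<bar>sine_coeff \<phi> j\<bar> * \<bar>sin (real j * a)\<bar>" "(LINT y|ivl 0 pi. \<bar>\<phi> y\<bar>) * 1"
            "(s ^ n) ^ j * \<bar>weight s\<bar>"] r unfolding eq
        by (simp add: abs_mult mult_ac)
    qed
  qed
  have sn: "summable (\<lambda>j. LINT s|ivl 0 1. norm (f j s))"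
    unfolding nI c_def using summable_K_sin[OF assms, of a] by (simp add: mult.assoc)
  have ae: "AE s in ivl 0 1. summable (\<lambda>j. norm (f j s))" by (rule AE_I2) (rule summ)
  have sum_eq: "(\<Sum>j. f j s) = weight s * poisson_sine \<phi> (s ^ n) a" if "s \<in> space (ivl 0 1)" for s
    using sums[OF that] by (simp add: sums_iff)
  have "integrable (ivl 0 1) (\<lambda>s. \<Sum>j. f j s)" by (rule integrable_suminf[OF fint ae sn])
  then show "integrable (ivl 0 1) (\<lambda>s. weight s * poisson_sine \<phi> (s ^ n) a)"
    by (rule Bochner_Integration.integrable_cong[THEN iffD1, rotated -1]) (auto simp: sum_eq)
  have "(\<lambda>j. integral\<^sup>L (ivl 0 1) (f j)) sums (LINT s|ivl 0 1. (\<Sum>j. f j s))"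
    by (rule sums_integral[OF fint ae sn])
  moreover have "(LINT s|ivl 0 1. (\<Sum>j. f j s)) = (LINT s|ivl 0 1. weight s * poisson_sine \<phi> (s ^ n) a)"
    by (rule Bochner_Integration.integral_cong) (auto simp: sum_eq)
  moreover have "(\<lambda>j. integral\<^sup>L (ivl 0 1) (f j)) sums K \<phi> a"
    unfolding fI c_def using sums_K[OF assms, of a] by (simp add: mult.assoc)
  ultimately show "K \<phi> a = (LINT s|ivl 0 1. weight s * poisson_sine \<phi> (s ^ n) a)"
    by (metis sums_unique2)
qed

text \<open>The constant of \<open>poisson_sine_lower\<close> at \<open>r = s ^ n\<close>, averaged
  against \<open>weight\<close>.\<close>

definition K_lower :: real where
  "K_lower = (LINT s|ivl 0 1. weight s * (s ^ n * (1 - (s ^ n)\<^sup>2) / 16))"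

lemma K_lower_integrable: "integrable (ivl 0 1) (\<lambda>s. weight s * (s ^ n * (1 - (s ^ n)\<^sup>2) / 16))"
proof (rule integrable_ivl_bounded[where B = 1])
  show "(\<lambda>s. weight s * (s ^ n * (1 - (s ^ n)\<^sup>2) / 16)) \<in> borel_measurable (ivl 0 1)"
    by (rule borel_measurable_ivlI) measurable
  fix s :: real assume s: "0 < s" "s < 1"
  then have "s ^ n < 1" "0 < s ^ n" using n_ge_3 by (auto simp: power_less_one_iff)
  then have "(s ^ n)\<^sup>2 \<le> 1" using power_le_one[of "s ^ n" 2] by simp
  then have "0 \<le> (1 - (s ^ n)\<^sup>2) / 16" by simp
  moreover have "(1 - (s ^ n)\<^sup>2) / 16 \<le> 1"
  proof -
    have *: "(1 - t) / 16 \<le> 1" if "0 \<le> t" for t :: real using that by simp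
    show ?thesis by (rule *) simp
  qed
  moreover have "0 \<le> s ^ n * weight s" using s weight_nonneg by simp
  ultimately have "\<bar>(s ^ n * weight s) * ((1 - (s ^ n)\<^sup>2) / 16)\<bar> \<le> 1 * 1"
    unfolding abs_mult using power_weight_le[OF s] by (intro mult_mono) auto
  then show "norm (weight s * (s ^ n * (1 - (s ^ n)\<^sup>2) / 16)) \<le> 1" by (simp add: mult_ac)
qed

lemma K_lower_pos: "0 < K_lower"
  unfolding K_lower_def
proof (rule integral_ivl_pos[OF _ K_lower_integrable])
  fix s :: real assume s: "0 < s" "s < 1"
  then have "s ^ n < 1" "0 < s ^ n" using n_ge_3 by (auto simp: power_less_one_iff)
  moreover from this have "(s ^ n)\<^sup>2 < 1" by (simp add: power_less_one_iff)
  moreover have "0 < weight s" using s unfolding weight_def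
    by (intro divide_pos_pos mult_pos_pos add_pos_pos) auto
  ultimately show "0 < weight s * (s ^ n * (1 - (s ^ n)\<^sup>2) / 16)" by simp
qed simp

lemma K_ge:
  assumes "L2_half \<phi>" "0 < a" "a < pi" "\<And>y. 0 < y \<Longrightarrow> y < pi \<Longrightarrow> 0 \<le> \<phi> y"
  shows "K_lower * sin a * sine_coeff \<phi> 1 \<le> K \<phi> a"
proof -
  have "K_lower * sin a * sine_coeff \<phi> 1 =
      (LINT s|ivl 0 1. weight s * (s ^ n * (1 - (s ^ n)\<^sup>2) / 16) * (sin a * sine_coeff \<phi> 1))"
    unfolding K_lower_def by simp
  also have "\<dots> \<le> (LINT s|ivl 0 1. weight s * poisson_sine \<phi> (s ^ n) a)"
  proof (rule integral_mono[OF _ K_poisson(1)[OF assms(1)]])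
    show "integrable (ivl 0 1) (\<lambda>s. weight s * (s ^ n * (1 - (s ^ n)\<^sup>2) / 16) * (sin a * sine_coeff \<phi> 1))"
      by (intro integrable_mult_left K_lower_integrable)
    fix s assume "s \<in> space (ivl 0 1)"
    then have s: "0 < s" "s < 1" by auto
    then have "s ^ n < 1" "0 < s ^ n" using n_ge_3 by (auto simp: power_less_one_iff)
    then have "s ^ n * (1 - (s ^ n)\<^sup>2) / 16 * sin a * sine_coeff \<phi> 1 \<le> poisson_sine \<phi> (s ^ n) a"
      using assms by (intro poisson_sine_lower) auto
    then have "weight s * (s ^ n * (1 - (s ^ n)\<^sup>2) / 16 * sin a * sine_coeff \<phi> 1) \<le>
        weight s * poisson_sine \<phi> (s ^ n) a"
      using weight_nonneg[of s] s by (intro mult_left_mono) auto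
    then show "weight s * (s ^ n * (1 - (s ^ n)\<^sup>2) / 16) * (sin a * sine_coeff \<phi> 1)
        \<le> weight s * poisson_sine \<phi> (s ^ n) a" by (simp add: mult_ac)
  qed
  finally show ?thesis using K_poisson(2)[OF assms(1), of a] by simp
qed

lemma sine_coeff_1_nonneg: "(\<And>y. 0 < y \<Longrightarrow> y < pi \<Longrightarrow> 0 \<le> \<phi> y) \<Longrightarrow> 0 \<le> sine_coeff \<phi> 1"
  unfolding sine_coeff_def by (intro integral_nonneg_AE AE_ivlI) (auto simp: sin_gt_zero less_imp_le)

lemma K_nonneg:
  assumes "L2_half \<phi>" "0 < a" "a < pi" "\<And>y. 0 < y \<Longrightarrow> y < pi \<Longrightarrow> 0 \<le> \<phi> y"
  shows "0 \<le> K \<phi> a"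
proof -
  have "0 \<le> sine_coeff \<phi> 1" using assms(4) by (rule sine_coeff_1_nonneg)
  then have "0 \<le> K_lower * sin a * sine_coeff \<phi> 1"
    using K_lower_pos sin_gt_zero[OF assms(2,3)] by simp
  with K_ge[OF assms] show ?thesis by linarith
qed

text \<open>Linearity turns positivity of \<open>K\<close> into monotonicity.\<close>

lemma K_mono:
  assumes "L2_half \<phi>" "L2_half \<eta>" "0 < a" "a < pi" "\<And>y. 0 < y \<Longrightarrow> y < pi \<Longrightarrow> \<phi> y \<le> \<eta> y"
  shows "K \<phi> a \<le> K \<eta> a"
  using K_nonneg[OF L2_half_diff[OF assms(2,1)] assms(3,4)] assms(5)
  by (simp add: K_diff[OF assms(2,1)])

end

section \<open>The positive fixed point\<close>

context n_fold
begin

text \<open>The integral of \<open>sin y powr (3 / 2)\<close> over (0, pi), which measures the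
  response of \<open>K\<close> to the barrier \<open>sqrt (sin y)\<close>.\<close>

definition sqrt_sin_coeff :: real where
  "sqrt_sin_coeff = sine_coeff (\<lambda>y. sqrt (sin y)) 1"

lemma L2_half_sqrt_sin: "L2_half (\<lambda>y. sqrt (sin y))"
proof (rule L2_half_bounded[where B = 1])
  fix y :: real assume "0 < y" "y < pi"
  then have "0 < sin y" by (rule sin_gt_zero)
  then show "\<bar>sqrt (sin y)\<bar> \<le> 1" by simp
qed measurable

lemma sine_coeff_1_pos:
  assumes "L2_half \<phi>" "\<And>y. 0 < y \<Longrightarrow> y < pi \<Longrightarrow> 0 < \<phi> y"
  shows "0 < sine_coeff \<phi> 1"
  unfolding sine_coeff_def using assms(2)
  by (intro integral_ivl_pos integrable_mult_sin assms(1)) (auto intro!: mult_pos_pos sin_gt_zero)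

lemma sqrt_sin_coeff_pos: "0 < sqrt_sin_coeff"
  unfolding sqrt_sin_coeff_def
  by (rule sine_coeff_1_pos[OF L2_half_sqrt_sin]) (simp add: sin_gt_zero)

lemma sqrt_K_measurable: "(\<lambda>a. sqrt (K \<phi> a)) \<in> borel_measurable (ivl 0 pi)"
  by (rule borel_measurable_ivlI) measurable

text \<open>Kept general in the supersolution \<open>p\<close> because it serves twice: a constant
  \<open>p\<close> yields existence, the minimum of two fixed points yields uniqueness. Domination
  by \<open>p\<close> bounds the increasing iterates pointwise and supplies the majorant for their
  \<open>L^2\<close> convergence.\<close>

lemma monotone_iteration:
  assumes p: "L2_half p" and c: "0 < c" "c \<le> K_lower * sqrt_sin_coeff"
    and lower: "\<And>y. 0 < y \<Longrightarrow> y < pi \<Longrightarrow> c * sqrt (sin y) \<le> p y"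
    and super: "\<And>y. 0 < y \<Longrightarrow> y < pi \<Longrightarrow> K p y \<le> (p y)\<^sup>2"
  obtains \<phi> where "L2_half \<phi>"
    "\<And>y. 0 < y \<Longrightarrow> y < pi \<Longrightarrow> c * sqrt (sin y) \<le> \<phi> y \<and> \<phi> y \<le> p y \<and> (\<phi> y)\<^sup>2 = K \<phi> y"
proof -
  define it where "it k = ((\<lambda>\<phi> a. sqrt (K \<phi> a)) ^^ k) (\<lambda>a. c * sqrt (sin a))" for k
  have it_0: "it 0 = (\<lambda>a. c * sqrt (sin a))" and it_Suc: "it (Suc k) = (\<lambda>a. sqrt (K (it k) a))" for k
    unfolding it_def by simp_all
  have sin_pos: "0 < c * sqrt (sin y)" if "0 < y" "y < pi" for y
    using c(1) sin_gt_zero[OF that] by simp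
  have p_nonneg: "0 \<le> p y" if "0 < y" "y < pi" for y
    using lower[OF that] sin_pos[OF that] by linarith
  have meas [measurable]: "it k \<in> borel_measurable (ivl 0 pi)" for k
  proof (cases k)
    case 0
    show ?thesis unfolding 0 it_0
      by (rule L2_half_measurable[OF L2_half_scale[OF L2_half_sqrt_sin]])
  next
    case (Suc m)
    show ?thesis unfolding Suc it_Suc by (rule sqrt_K_measurable)
  qed
  have L0: "L2_half (it 0)" unfolding it_0 by (intro L2_half_scale L2_half_sqrt_sin)
  \<comment> \<open>\<open>K\<close> of the barrier is at least
    \<open>K_lower * sin y * c * sqrt_sin_coeff\<close>, and this is at least
    \<open>c^2 * sin y\<close> by the upper bound on \<open>c\<close>.\<close>
  have sub: "it 0 y \<le> it (Suc 0) y" if y: "0 < y" "y < pi" for y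
  proof -
    have "c * (c * sin y) \<le> (K_lower * sqrt_sin_coeff) * (c * sin y)"
      using c sin_gt_zero[OF y] by (intro mult_right_mono) auto
    also have "\<dots> = K_lower * sin y * sine_coeff (it 0) 1"
      unfolding it_0 sine_coeff_scale sqrt_sin_coeff_def by simp
    also have "\<dots> \<le> K (it 0) y"
      using y sin_pos by (intro K_ge L0) (auto simp: it_0 less_imp_le)
    finally have "sqrt (c\<^sup>2 * sin y) \<le> sqrt (K (it 0) y)" by (simp add: power2_eq_square mult.assoc)
    then show ?thesis unfolding it_Suc using c(1) by (simp add: it_0 real_sqrt_mult)
  qed
  have bnd: "L2_half (it k) \<and> (\<forall>y. 0 < y \<longrightarrow> y < pi \<longrightarrow> it 0 y \<le> it k y \<and> it k y \<le> p y \<and> it k y \<le> it (Suc k) y)" for k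
  proof (induction k)
    case 0
    show ?case using L0 lower sub by (auto simp: it_0)
  next
    case (Suc k)
    then have Lk: "L2_half (it k)" and
      le: "\<And>y. 0 < y \<Longrightarrow> y < pi \<Longrightarrow> it 0 y \<le> it k y \<and> it k y \<le> p y \<and> it k y \<le> it (Suc k) y" by auto
    have up: "it (Suc k) y \<le> p y" if y: "0 < y" "y < pi" for y
    proof -
      have "K (it k) y \<le> K p y" using le by (intro K_mono Lk p y) auto
      also have "\<dots> \<le> (p y)\<^sup>2" by (rule super[OF y])
      finally show ?thesis unfolding it_Suc using p_nonneg[OF y] by (intro real_le_lsqrt) auto
    qed
    have lo: "it 0 y \<le> it (Suc k) y" if "0 < y" "y < pi" for y
      using le[OF that] by linarith
    have LS: "L2_half (it (Suc k))"
    proof (rule L2_half_dominated[OF p meas])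
      fix y assume y: "0 < y" "y < pi"
      have "0 \<le> it (Suc k) y" using lo[OF y] sin_pos[OF y] by (simp add: it_0)
      then show "\<bar>it (Suc k) y\<bar> \<le> \<bar>p y\<bar>" using up[OF y] by simp
    qed
    have "it (Suc k) y \<le> it (Suc (Suc k)) y" if y: "0 < y" "y < pi" for y
    proof -
      have "K (it k) y \<le> K (it (Suc k)) y" using le by (intro K_mono Lk LS y) auto
      then show ?thesis unfolding it_Suc[of "Suc k"] by (subst it_Suc) simp
    qed
    with LS lo up show ?case by blast
  qed
  define \<phi> where "\<phi> y = lim (\<lambda>k. it k y)" for y
  have \<phi>_meas [measurable]: "\<phi> \<in> borel_measurable (ivl 0 pi)"
    unfolding \<phi>_def[abs_def] by measurable
  have conv: "(\<lambda>k. it k y) \<longlonglongrightarrow> \<phi> y" and mono: "it k y \<le> \<phi> y" and up: "\<phi> y \<le> p y"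
    if y: "0 < y" "y < pi" for y k
  proof -
    have inc: "incseq (\<lambda>k. it k y)" using bnd y by (auto intro!: incseq_SucI)
    obtain L where L: "(\<lambda>k. it k y) \<longlonglongrightarrow> L"
      using incseq_convergent[OF inc, of "p y"] bnd y by blast
    then have L': "L = \<phi> y" unfolding \<phi>_def by (simp add: limI)
    show "(\<lambda>k. it k y) \<longlonglongrightarrow> \<phi> y" using L L' by simp
    then show "it k y \<le> \<phi> y" by (rule incseq_le[OF inc])
    show "\<phi> y \<le> p y" using L L' bnd y by (intro LIMSEQ_le_const2[of "\<lambda>k. it k y"]) auto
  qed
  have lo: "c * sqrt (sin y) \<le> \<phi> y" if "0 < y" "y < pi" for y
    using mono[OF that, of 0] by (simp add: it_0)
  have L\<phi>: "L2_half \<phi>"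
  proof (rule L2_half_dominated[OF p \<phi>_meas])
    fix y assume y: "0 < y" "y < pi"
    show "\<bar>\<phi> y\<bar> \<le> \<bar>p y\<bar>" using lo[OF y] sin_pos[OF y] up[OF y] by linarith
  qed
  \<comment> \<open>From \<open>0 <= it k y <= \<phi> y <= p y\<close> the integrable majorant
    \<open>(p y)^2\<close> results.\<close>
  have L2conv: "(\<lambda>k. LINT y|ivl 0 pi. (it k y - \<phi> y)\<^sup>2) \<longlonglongrightarrow> (LINT y|ivl 0 pi. 0)"
  proof (rule integral_dominated_convergence[where w = "\<lambda>y. (p y)\<^sup>2"])
    show "integrable (ivl 0 pi) (\<lambda>y. (p y)\<^sup>2)" using p by (simp add: L2_half_def)
    show "AE y in ivl 0 pi. (\<lambda>k. (it k y - \<phi> y)\<^sup>2) \<longlonglongrightarrow> 0"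
    proof (rule AE_ivlI)
      fix y assume y: "0 < y" "y < pi"
      have "(\<lambda>k. (it k y - \<phi> y)\<^sup>2) \<longlonglongrightarrow> (\<phi> y - \<phi> y)\<^sup>2" by (intro tendsto_intros conv y)
      then show "(\<lambda>k. (it k y - \<phi> y)\<^sup>2) \<longlonglongrightarrow> 0" by simp
    qed
    show "AE y in ivl 0 pi. norm ((it k y - \<phi> y)\<^sup>2) \<le> (p y)\<^sup>2" for k
    proof (rule AE_ivlI)
      fix y assume y: "0 < y" "y < pi"
      have "0 \<le> it k y" using bnd[of k] y sin_pos[OF y] by (auto simp: it_0 intro: order_trans[OF less_imp_le])
      then have "\<bar>it k y - \<phi> y\<bar> \<le> p y" using mono[OF y, of k] up[OF y] by linarith
      then have "\<bar>it k y - \<phi> y\<bar>\<^sup>2 \<le> (p y)\<^sup>2" by (intro power_mono) auto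
      then show "norm ((it k y - \<phi> y)\<^sup>2) \<le> (p y)\<^sup>2" by simp
    qed
  qed measurable
  \<comment> \<open>\<open>K\<close> maps \<open>L^2\<close> convergence to uniform convergence by
    \<open>K_bounded\<close>, so the limit satisfies the fixed point equation at every point and not
    just almost everywhere.\<close>
  have Kconv: "(\<lambda>k. K (it k) a) \<longlonglongrightarrow> K \<phi> a" for a
  proof (rule Lim_null[THEN iffD2], rule Lim_null_comparison)
    show "\<forall>\<^sub>F k in sequentially. norm (K (it k) a - K \<phi> a) \<le>
        K_bound * sqrt (LINT y|ivl 0 pi. (it k y - \<phi> y)\<^sup>2)"
    proof (rule always_eventually, rule allI)
      fix k
      have Lk: "L2_half (it k)" using bnd by blast
      show "norm (K (it k) a - K \<phi> a) \<le> K_bound * sqrt (LINT y|ivl 0 pi. (it k y - \<phi> y)\<^sup>2)"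
        using K_bounded[OF L2_half_diff[OF Lk L\<phi>], of a] by (simp add: K_diff[OF Lk L\<phi>])
    qed
    have "(\<lambda>k. K_bound * sqrt (LINT y|ivl 0 pi. (it k y - \<phi> y)\<^sup>2)) \<longlonglongrightarrow> K_bound * sqrt (LINT y|ivl 0 pi. 0)"
      by (intro tendsto_intros L2conv)
    then show "(\<lambda>k. K_bound * sqrt (LINT y|ivl 0 pi. (it k y - \<phi> y)\<^sup>2)) \<longlonglongrightarrow> 0" by simp
  qed
  have fixed: "(\<phi> y)\<^sup>2 = K \<phi> y" if y: "0 < y" "y < pi" for y
  proof -
    have "(\<lambda>k. it (Suc k) y) \<longlonglongrightarrow> sqrt (K \<phi> y)" unfolding it_Suc by (intro tendsto_intros Kconv)
    moreover have "(\<lambda>k. it (Suc k) y) \<longlonglongrightarrow> \<phi> y" using conv[OF y] by (rule LIMSEQ_Suc)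
    ultimately have *: "\<phi> y = sqrt (K \<phi> y)" using LIMSEQ_unique by blast
    moreover have "0 \<le> \<phi> y" using lo[OF y] sin_pos[OF y] by linarith
    ultimately have "0 \<le> K \<phi> y" by simp
    then show ?thesis using * by (metis real_sqrt_pow2)
  qed
  show thesis using L\<phi> lo up fixed by (intro that[of \<phi>]) auto
qed

text \<open>Required at every point of the open interval; values elsewhere are left free since
  \<open>K\<close> only sees (0, pi).\<close>

definition fixed_point :: "(real \<Rightarrow> real) \<Rightarrow> bool" where
  "fixed_point \<phi> \<longleftrightarrow> L2_half \<phi> \<and> (\<forall>y. 0 < y \<longrightarrow> y < pi \<longrightarrow> 0 < \<phi> y \<and> (\<phi> y)\<^sup>2 = K \<phi> y)"

lemma fixed_point_exists: "\<exists>\<phi>. fixed_point \<phi>"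
proof -
  define c where "c = K_lower * sqrt_sin_coeff"
  \<comment> \<open>\<open>K\<close> of the constant \<open>M\<close> is at most
    \<open>M * K_bound * sqrt pi\<close>, so \<open>M >= K_bound * sqrt pi\<close> makes it a
    supersolution; \<open>M >= c\<close> keeps it above the barrier.\<close>
  define M where "M = max c (K_bound * sqrt pi)"
  have c: "0 < c" unfolding c_def using K_lower_pos sqrt_sin_coeff_pos by simp
  then have M: "0 < M" unfolding M_def by linarith
  have LM: "L2_half (\<lambda>_. M)" by (rule L2_half_bounded[where B = M]) (use M in auto)
  have "K (\<lambda>_. M) y \<le> M\<^sup>2" for y
  proof -
    have "(LINT y|ivl 0 pi. M\<^sup>2) = M\<^sup>2 * pi"
      by (subst FTC_ivl[where F = "\<lambda>y. M\<^sup>2 * y"]) (auto intro!: derivative_eq_intros)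
    then have "K (\<lambda>_. M) y \<le> K_bound * sqrt (M\<^sup>2 * pi)"
      using K_bounded[OF LM, of y] by (simp only: abs_le_iff)
    also have "\<dots> = M * (K_bound * sqrt pi)" using M by (simp add: real_sqrt_mult)
    also have "\<dots> \<le> M * M" using M by (intro mult_left_mono) (auto simp: M_def)
    finally show ?thesis by (simp add: power2_eq_square)
  qed
  moreover have "c * sqrt (sin y) \<le> M" if "0 < y" "y < pi" for y
  proof -
    have "c * sqrt (sin y) \<le> c * 1" using c sin_gt_zero[OF that] by (intro mult_left_mono) auto
    then show ?thesis by (simp add: M_def)
  qed
  ultimately obtain \<phi> where \<phi>: "L2_half \<phi>"
    "\<And>y. 0 < y \<Longrightarrow> y < pi \<Longrightarrow> c * sqrt (sin y) \<le> \<phi> y \<and> \<phi> y \<le> M \<and> (\<phi> y)\<^sup>2 = K \<phi> y"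
    using monotone_iteration[OF LM c] unfolding c_def by blast
  have "0 < \<phi> y" if y: "0 < y" "y < pi" for y
  proof -
    have "0 < c * sqrt (sin y)" using c sin_gt_zero[OF y] by simp
    then show ?thesis using \<phi>(2)[OF y] by linarith
  qed
  then show ?thesis using \<phi> unfolding fixed_point_def by blast
qed

section \<open>Uniqueness of the positive fixed point\<close>

lemma integrable_mult_K:
  assumes "L2_half \<phi>" "L2_half \<eta>"
  shows "integrable (ivl 0 pi) (\<lambda>y. \<eta> y * K \<phi> y)"
  by (rule integral_mult_series(1)[OF L2_half_integrable[OF assms(2)] _ _ summable_K[OF assms(1)] sums_K[OF assms(1)]])
     auto

text \<open>Two ordered fixed points agree because \<open>\<integral> \<phi> f (f - \<phi>) = 0\<close> by the symmetry of \<open>K\<close>.\<close>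

lemma ordered_fixed_points_eq:
  assumes f: "fixed_point f" and \<phi>: "fixed_point \<phi>"
    and le: "\<And>y. 0 < y \<Longrightarrow> y < pi \<Longrightarrow> \<phi> y \<le> f y"
  shows "AE y in ivl 0 pi. f y = \<phi> y"
proof -
  have L: "L2_half f" "L2_half \<phi>" using f \<phi> by (auto simp: fixed_point_def)
  let ?h = "\<lambda>y. \<phi> y * K f y - f y * K \<phi> y"
  have int: "integrable (ivl 0 pi) ?h" by (intro Bochner_Integration.integrable_diff integrable_mult_K L)
  have h: "?h y = \<phi> y * f y * (f y - \<phi> y)" if "0 < y" "y < pi" for y
  proof -
    have "K f y = (f y)\<^sup>2" "K \<phi> y = (\<phi> y)\<^sup>2" using f \<phi> that by (auto simp: fixed_point_def)
    then show ?thesis by (simp add: power2_eq_square algebra_simps)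
  qed
  have "integral\<^sup>L (ivl 0 pi) ?h = 0"
    using K_symmetric[OF L] by (simp add: integrable_mult_K L)
  moreover have "AE y in ivl 0 pi. 0 \<le> ?h y"
  proof (rule AE_ivlI)
    fix y assume y: "0 < y" "y < pi"
    then have "0 < f y" "0 < \<phi> y" using f \<phi> unfolding fixed_point_def by auto
    then show "0 \<le> ?h y" using le[OF y] unfolding h[OF y] by simp
  qed
  ultimately have "AE y in ivl 0 pi. ?h y = 0"
    using integral_nonneg_eq_0_iff_AE[OF int] by blast
  moreover have "?h y = 0 \<longrightarrow> f y = \<phi> y" if y: "0 < y" "y < pi" for y
  proof -
    have "0 < f y" "0 < \<phi> y" using f \<phi> y unfolding fixed_point_def by auto
    then show ?thesis unfolding h[OF y] by simp
  qed
  then have "AE y in ivl 0 pi. ?h y = 0 \<longrightarrow> f y = \<phi> y" by (rule AE_ivlI)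
  ultimately show ?thesis by (rule eventually_elim2) blast
qed

text \<open>Inserting the lower bound of \<open>K\<close> into \<open>f^2 = K f\<close> forces
  growth at least like \<open>sqrt (sin y)\<close> at the endpoints. This leaves room for a common
  barrier below two different fixed points.\<close>

lemma fixed_point_lower:
  assumes "fixed_point f" "0 < y" "y < pi"
  shows "sqrt (K_lower * sine_coeff f 1) * sqrt (sin y) \<le> f y"
proof -
  have f: "L2_half f" "\<And>y. 0 < y \<Longrightarrow> y < pi \<Longrightarrow> 0 < f y" "\<And>y. 0 < y \<Longrightarrow> y < pi \<Longrightarrow> (f y)\<^sup>2 = K f y"
    using assms by (auto simp: fixed_point_def)
  have "K_lower * sin y * sine_coeff f 1 \<le> (f y)\<^sup>2"
    unfolding f(3)[OF assms(2,3)] using f(2) by (intro K_ge f assms less_imp_le)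
  then have "sqrt (K_lower * sine_coeff f 1 * sin y) \<le> f y"
    using f(2)[OF assms(2,3)] by (intro real_le_lsqrt) (auto simp: mult_ac)
  then show ?thesis by (simp add: real_sqrt_mult)
qed

lemma fixed_point_unique:
  assumes f: "fixed_point f" and q: "fixed_point q" and y: "0 < y" "y < pi"
  shows "f y = q y"
proof -
  \<comment> \<open>The first entry makes the barrier a subsolution; the other two place it below
    \<open>f\<close> and below \<open>q\<close>.\<close>
  define c where "c = min (K_lower * sqrt_sin_coeff)
     (min (sqrt (K_lower * sine_coeff f 1)) (sqrt (K_lower * sine_coeff q 1)))"
  define p where "p y = min (f y) (q y)" for y
  have fq: "L2_half f" "L2_half q" "0 < f y" "0 < q y" "(f y)\<^sup>2 = K f y" "(q y)\<^sup>2 = K q y"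
    if "0 < y" "y < pi" for y using f q that by (auto simp: fixed_point_def)
  note L = fq(1,2)[OF y]
  note [measurable] = L2_half_measurable[OF L(1)] L2_half_measurable[OF L(2)]
  have Lp: "L2_half p"
  proof (rule L2_half_dominated[OF L(1)])
    show "p \<in> borel_measurable (ivl 0 pi)" unfolding p_def[abs_def] by measurable
    fix y assume "0 < y" "y < pi"
    from fq(3,4)[OF this] show "\<bar>p y\<bar> \<le> \<bar>f y\<bar>" by (simp add: p_def)
  qed
  have "0 < sine_coeff f 1" "0 < sine_coeff q 1"
    by (intro sine_coeff_1_pos L fq; assumption)+
  then have c: "0 < c" "c \<le> K_lower * sqrt_sin_coeff"
    unfolding c_def using K_lower_pos sqrt_sin_coeff_pos by auto
  have lower: "c * sqrt (sin y) \<le> p y" if y: "0 < y" "y < pi" for y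
  proof -
    have s: "0 \<le> sqrt (sin y)" using sin_gt_zero[OF y] by simp
    have "c * sqrt (sin y) \<le> sqrt (K_lower * sine_coeff f 1) * sqrt (sin y)"
      "c * sqrt (sin y) \<le> sqrt (K_lower * sine_coeff q 1) * sqrt (sin y)"
      using s by (auto intro!: mult_right_mono simp: c_def)
    then show ?thesis using fixed_point_lower[OF f y] fixed_point_lower[OF q y] by (simp add: p_def)
  qed
  have super: "K p y \<le> (p y)\<^sup>2" if y: "0 < y" "y < pi" for y
  proof -
    have "K p y \<le> (f y)\<^sup>2" "K p y \<le> (q y)\<^sup>2"
      unfolding fq(5,6)[OF y] by (intro K_mono Lp L y; simp add: p_def)+
    then show ?thesis unfolding p_def min_def by simp
  qed
  obtain \<phi> where \<phi>: "L2_half \<phi>"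
    "\<And>y. 0 < y \<Longrightarrow> y < pi \<Longrightarrow> c * sqrt (sin y) \<le> \<phi> y \<and> \<phi> y \<le> p y \<and> (\<phi> y)\<^sup>2 = K \<phi> y"
    using monotone_iteration[OF Lp c lower super] by blast
  have "fixed_point \<phi>"
    unfolding fixed_point_def
  proof (intro conjI allI impI \<phi>(1))
    fix y assume y: "0 < y" "y < pi"
    have "0 < c * sqrt (sin y)" using c sin_gt_zero[OF y] by simp
    then show "0 < \<phi> y" using \<phi>(2)[OF y] by linarith
    show "(\<phi> y)\<^sup>2 = K \<phi> y" using \<phi>(2)[OF y] by blast
  qed
  then have "AE y in ivl 0 pi. f y = \<phi> y" "AE y in ivl 0 pi. q y = \<phi> y"
    using \<phi>(2) by (intro ordered_fixed_points_eq f q; fastforce simp: p_def)+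
  then have "AE y in ivl 0 pi. f y = q y" by (rule eventually_elim2) simp
  \<comment> \<open>\<open>K\<close> does not see null sets, and both functions are determined at
    each point by their images under \<open>K\<close>: equality almost everywhere becomes equality
    everywhere.\<close>
  then have "K f y = K q y" by (intro K_cong_AE) auto
  then have "(f y)\<^sup>2 = (q y)\<^sup>2" using fq(5,6)[OF y] by simp
  then show ?thesis using fq(3,4)[OF y] by (simp add: power2_eq_iff_nonneg)
qed

end

section \<open>Integrals of odd and even functions\<close>

lemma integral_ivl_split:
  fixes f :: "real \<Rightarrow> 'b::{banach, second_countable_topology}"
  assumes "integrable (ivl a c) f" "a \<le> b" "b \<le> c"
  shows "integrable (ivl a b) f" "integrable (ivl b c) f"
    "integral\<^sup>L (ivl a c) f = integral\<^sup>L (ivl a b) f + integral\<^sup>L (ivl b c) f"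
proof -
  have *: "set_integrable lborel {a<..c} f" using assms(1) by (simp add: integrable_ivl_Ioc)
  have 1: "set_integrable lborel {a<..b} f" and 2: "set_integrable lborel {b<..c} f"
    using assms by (auto intro: set_integrable_subset[OF *])
  then show "integrable (ivl a b) f" "integrable (ivl b c) f" by (simp_all add: integrable_ivl_Ioc)
  have "{a<..c} = {a<..b} \<union> {b<..c}" using assms by auto
  then show "integral\<^sup>L (ivl a c) f = integral\<^sup>L (ivl a b) f + integral\<^sup>L (ivl b c) f"
    unfolding integral_ivl_Ioc using 1 2 by (simp add: set_integral_Un)
qed

lemma integral_ivl_affine:
  fixes f :: "real \<Rightarrow> 'b::{banach, second_countable_topology}"
  assumes "0 < c"
  shows "integral\<^sup>L (ivl (t + c * a) (t + c * b)) f = c *\<^sub>R (LINT x|ivl a b. f (t + c * x))"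
    "integrable (ivl (t + c * a) (t + c * b)) f \<longleftrightarrow> integrable (ivl a b) (\<lambda>x. f (t + c * x))"
proof -
  have ind: "indicator {t + c * a<..<t + c * b} (t + c * x) = (indicator {a<..<b} x :: real)" for x
    using assms by (auto simp: indicator_def)
  show "integral\<^sup>L (ivl (t + c * a) (t + c * b)) f = c *\<^sub>R (LINT x|ivl a b. f (t + c * x))"
    unfolding integral_ivl set_lebesgue_integral_def
    by (subst lborel_integral_real_affine[where c = c and t = t]) (use assms in \<open>auto simp: ind\<close>)
  show "integrable (ivl (t + c * a) (t + c * b)) f \<longleftrightarrow> integrable (ivl a b) (\<lambda>x. f (t + c * x))"
    unfolding integrable_ivl_iff set_integrable_def
    by (subst lborel_integrable_real_affine_iff[where c = c and t = t, symmetric])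
       (use assms in \<open>auto simp: ind\<close>)
qed

lemma integral_ivl_reflect:
  fixes f :: "real \<Rightarrow> 'b::{banach, second_countable_topology}"
  shows "integral\<^sup>L (ivl (t - b) (t - a)) f = (LINT x|ivl a b. f (t - x))"
    "integrable (ivl (t - b) (t - a)) f \<longleftrightarrow> integrable (ivl a b) (\<lambda>x. f (t - x))"
proof -
  have ind: "indicator {t - b<..<t - a} (t - x) = (indicator {a<..<b} x :: real)" for x
    by (auto simp: indicator_def)
  show "integral\<^sup>L (ivl (t - b) (t - a)) f = (LINT x|ivl a b. f (t - x))"
    unfolding integral_ivl set_lebesgue_integral_def
    by (subst lborel_integral_real_affine[where c = "-1" and t = t]) (auto simp: ind)
  show "integrable (ivl (t - b) (t - a)) f \<longleftrightarrow> integrable (ivl a b) (\<lambda>x. f (t - x))"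
    unfolding integrable_ivl_iff set_integrable_def
    by (subst lborel_integrable_real_affine_iff[where c = "-1" and t = t, symmetric]) (auto simp: ind)
qed

lemma integral_ivl_even:
  fixes f :: "real \<Rightarrow> real"
  assumes "integrable (ivl (- b) b) f" "0 \<le> b" "\<And>x. f (- x) = f x"
  shows "integral\<^sup>L (ivl (- b) b) f = 2 * integral\<^sup>L (ivl 0 b) f"
  using integral_ivl_split(3)[OF assms(1), of 0] integral_ivl_reflect(1)[of 0 b 0 f] assms by simp

lemma integral_ivl_odd:
  fixes f :: "real \<Rightarrow> real"
  assumes "integrable (ivl (- b) b) f" "0 \<le> b" "\<And>x. f (- x) = - f x"
  shows "integral\<^sup>L (ivl (- b) b) f = 0"
  using integral_ivl_split(3)[OF assms(1), of 0] integral_ivl_reflect(1)[of 0 b 0 f] assms by simp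

section \<open>Regularity\<close>

lemma poisson_kernel_series:
  assumes f: "integrable (ivl (- pi) pi) f" and r: "0 \<le> r" "r < 1"
  shows "integrable (ivl (- pi) pi) (\<lambda>y. f y * ((1 - r\<^sup>2) / pdenom r (y - a)))"
    "(\<lambda>j. (if j = 0 then 1 else 2 * r ^ j) * (LINT y|ivl (- pi) pi. f y * cos (real j * (y - a)))) sums
      (LINT y|ivl (- pi) pi. f y * ((1 - r\<^sup>2) / pdenom r (y - a)))"
proof -
  let ?c = "\<lambda>j. if j = 0 then 1 else 2 * r ^ j"
  have s: "summable (\<lambda>j. \<bar>?c j\<bar>)"
    by (rule summable_comparison_test'[OF summable_mult[OF summable_geometric[of r], of 2]])
       (use r in auto)
  have k: "(\<lambda>j. ?c j * cos (real j * (y - a))) sums ((1 - r\<^sup>2) / pdenom r (y - a))" for y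
    using sums_poisson[OF r, of "y - a"] by (simp add: if_distrib[of "\<lambda>x. x * _"] cong: if_cong)
  have meas: "(\<lambda>y. cos (real j * (y - a))) \<in> borel_measurable (ivl (- pi) pi)" for j by measurable
  note * = integral_mult_series[OF f meas _ s k]
  show "integrable (ivl (- pi) pi) (\<lambda>y. f y * ((1 - r\<^sup>2) / pdenom r (y - a)))" by (rule *(1)) auto
  show "(\<lambda>j. ?c j * (LINT y|ivl (- pi) pi. f y * cos (real j * (y - a)))) sums
      (LINT y|ivl (- pi) pi. f y * ((1 - r\<^sup>2) / pdenom r (y - a)))" by (rule *(2)) auto
qed

text \<open>Only the constant term of the cosine series survives integration over a full
  period.\<close>

lemma integral_poisson_kernel:
  assumes "0 \<le> r" "r < 1"
  shows "integrable (ivl (- pi) pi) (\<lambda>y. (1 - r\<^sup>2) / pdenom r (y - a))"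
    "(LINT y|ivl (- pi) pi. (1 - r\<^sup>2) / pdenom r (y - a)) = 2 * pi"
proof -
  let ?c = "\<lambda>j. if j = 0 then 1 else 2 * r ^ j"
  have one: "integrable (ivl (- pi) pi) (\<lambda>y. 1 :: real)" by (intro integrable_ivl_continuous continuous_intros)
  note * = poisson_kernel_series[OF one assms, of a]
  show "integrable (ivl (- pi) pi) (\<lambda>y. (1 - r\<^sup>2) / pdenom r (y - a))" using *(1) by simp
  have "(\<lambda>j. ?c j * (LINT y|ivl (- pi) pi. cos (real j * (y - a)))) sums
      (LINT y|ivl (- pi) pi. (1 - r\<^sup>2) / pdenom r (y - a))" using *(2) by simp
  moreover have "?c j * (LINT y|ivl (- pi) pi. cos (real j * (y - a))) = (if j = 0 then 2 * pi else 0)" for j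
  proof (cases "j = 0")
    case True
    have "(LINT y|ivl (- pi) pi. (1::real)) = 2 * pi" by (subst FTC_ivl[where F = "\<lambda>y. y"]) auto
    then show ?thesis using True by simp
  next
    case False
    have "(LINT y|ivl (- pi) pi. cos (real j * (y - a))) =
        sin (real j * (pi - a)) / real j - sin (real j * (- pi - a)) / real j"
      using False by (intro FTC_ivl) (auto intro!: derivative_eq_intros continuous_intros)
    also have "sin (real j * (pi - a)) = sin (real j * (- pi - a))"
      using sin.plus_of_nat[of "real j * (- pi - a)" j] by (simp add: algebra_simps)
    finally show ?thesis using False by simp
  qed
  ultimately have "(\<lambda>j. if j = 0 then 2 * pi else 0) sums (LINT y|ivl (- pi) pi. (1 - r\<^sup>2) / pdenom r (y - a))"
    by simp
  then show "(LINT y|ivl (- pi) pi. (1 - r\<^sup>2) / pdenom r (y - a)) = 2 * pi"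
    using sums_single[of 0 "\<lambda>_. 2 * pi"] by (metis (no_types, lifting) sums_cong sums_unique2)
qed

section \<open>Derivative bounds for Poisson extensions of Hoelder functions\<close>

lemma abs_sin_half_le: "(sin (z / 2))\<^sup>2 \<le> 2 * pdenom r z" if "0 \<le> r" "r < 1"
proof -
  have "1 - cos z = 2 * (sin (z / 2))\<^sup>2" using cos_double_sin[of "z / 2"] by simp
  then show ?thesis using one_minus_cos_le_pdenom[OF that, of z] by linarith
qed

text \<open>With \<open>D = pdenom r z\<close> and \<open>t = |sin (z / 2)|\<close>, the facts
  \<open>|sin z| <= 2 t\<close>, \<open>t^2 <= 2 D\<close> and \<open>(1 - r)^2 <= D\<close> trade
  the Hoelder weight \<open>t powr \<alpha>\<close> for one factor of the pole. What remains is a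
  multiple of the Poisson kernel, whose integral is known, times
  \<open>(1 - r) powr (\<alpha> - 1)\<close>.\<close>

lemma conjugate_kernel_bound:
  assumes r: "0 \<le> r" "r < 1" and \<alpha>: "0 < \<alpha>" "\<alpha> \<le> 1"
  shows "\<bar>sin (z / 2)\<bar> powr \<alpha> * \<bar>r * (1 - r\<^sup>2) * sin z / (pdenom r z)\<^sup>2\<bar> \<le>
    4 * r * (1 - r) powr (\<alpha> - 1) * ((1 - r\<^sup>2) / pdenom r z)"
proof -
  define D where "D = pdenom r z"
  define t where "t = \<bar>sin (z / 2)\<bar>"
  have D: "0 < D" "(1 - r)\<^sup>2 \<le> D" unfolding D_def using r by (auto intro: pdenom_pos pdenom_ge)
  have t: "0 \<le> t" "t\<^sup>2 \<le> 2 * D" unfolding t_def D_def using abs_sin_half_le[OF r] by auto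
  have "sin z = 2 * sin (z / 2) * cos (z / 2)" using sin_double[of "z / 2"] by simp
  then have "\<bar>sin z\<bar> = 2 * t * \<bar>cos (z / 2)\<bar>" by (simp add: t_def abs_mult)
  also have "\<dots> \<le> 2 * t * 1" using t by (intro mult_left_mono) auto
  finally have sin_le: "\<bar>sin z\<bar> \<le> 2 * t" by simp
  have "(t powr 2) powr ((1 + \<alpha>) / 2) = t powr (2 * ((1 + \<alpha>) / 2))" by (rule powr_powr)
  also have "2 * ((1 + \<alpha>) / 2) = 1 + \<alpha>" by simp
  finally have "t powr (1 + \<alpha>) = (t\<^sup>2) powr ((1 + \<alpha>) / 2)"
    using t(1) by (cases "t = 0") auto
  also have "\<dots> \<le> (2 * D) powr ((1 + \<alpha>) / 2)" using t \<alpha> by (intro powr_mono2) auto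
  also have "\<dots> = 2 powr ((1 + \<alpha>) / 2) * D powr ((1 + \<alpha>) / 2)" using D by (simp add: powr_mult)
  also have "\<dots> \<le> 2 * D powr ((1 + \<alpha>) / 2)"
    using \<alpha> powr_mono[of "(1 + \<alpha>) / 2" 1 "2::real"] by (intro mult_right_mono) auto
  also have "D powr ((1 + \<alpha>) / 2) = D * D powr ((\<alpha> - 1) / 2)"
    using D(1) by (simp add: powr_mult_base add_divide_distrib diff_divide_distrib)
  finally have tp: "t powr (1 + \<alpha>) \<le> 2 * (D * D powr ((\<alpha> - 1) / 2))" .
  \<comment> \<open>By \<open>\<alpha> <= 1\<close> the exponent is nonpositive, so the lower bound
    of \<open>D\<close> becomes an upper bound of the power.\<close>
  have Dp: "D powr ((\<alpha> - 1) / 2) \<le> (1 - r) powr (\<alpha> - 1)"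
  proof -
    have "D powr ((\<alpha> - 1) / 2) \<le> ((1 - r)\<^sup>2) powr ((\<alpha> - 1) / 2)"
      using D r \<alpha> by (intro powr_mono2') auto
    also have "(1 - r)\<^sup>2 = (1 - r) powr 2" using r by simp
    also have "((1 - r) powr 2) powr ((\<alpha> - 1) / 2) = (1 - r) powr (2 * ((\<alpha> - 1) / 2))" by (rule powr_powr)
    also have "2 * ((\<alpha> - 1) / 2) = \<alpha> - 1" by simp
    finally show ?thesis .
  qed
  have r2: "0 \<le> 1 - r\<^sup>2" using r by (simp add: power_le_one)
  have "t powr \<alpha> * \<bar>sin z\<bar> \<le> t powr \<alpha> * (2 * t)" using sin_le by (intro mult_left_mono) auto
  also have "\<dots> = 2 * t powr (1 + \<alpha>)" using t(1) by (cases "t = 0") (auto simp: powr_add)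
  also have "\<dots> \<le> 4 * (D * D powr ((\<alpha> - 1) / 2))" using tp by simp
  also have "\<dots> \<le> 4 * (D * (1 - r) powr (\<alpha> - 1))" using Dp D by (intro mult_left_mono) auto
  finally have main: "t powr \<alpha> * \<bar>sin z\<bar> \<le> 4 * (D * (1 - r) powr (\<alpha> - 1))" .
  have "t powr \<alpha> * \<bar>r * (1 - r\<^sup>2) * sin z / D\<^sup>2\<bar> = (t powr \<alpha> * \<bar>sin z\<bar>) * (r * (1 - r\<^sup>2) / D\<^sup>2)"
    using r r2 by (simp add: abs_mult)
  also have "\<dots> \<le> 4 * (D * (1 - r) powr (\<alpha> - 1)) * (r * (1 - r\<^sup>2) / D\<^sup>2)"
    using main r r2 by (intro mult_right_mono) auto
  also have "\<dots> = 4 * r * (1 - r) powr (\<alpha> - 1) * ((1 - r\<^sup>2) / D)"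
    using D(1) by (simp add: power2_eq_square)
  finally show ?thesis unfolding t_def D_def .
qed

lemma summable_deriv_power:
  assumes "0 \<le> r" "r < 1"
  shows "summable (\<lambda>j. real j * r ^ j :: real)"
proof -
  have "(\<lambda>j. of_nat (Suc j) * r ^ j) sums (1 / (1 - r)\<^sup>2)" using assms by (intro geometric_deriv_sums) auto
  then have "summable (\<lambda>j. r * (of_nat (Suc j) * r ^ j))" by (intro summable_mult) (auto simp: sums_iff)
  then have "summable (\<lambda>j. real (Suc j) * r ^ Suc j)" by (simp add: mult_ac)
  then show ?thesis by (subst (asm) summable_Suc_iff)
qed

text \<open>The derivative kernel has mean zero, so \<open>F a\<close> may be subtracted under the
  integral, where the Hoelder bound then applies. Distances are measured by
  \<open>|sin ((x - y) / 2)|\<close>, half the chord, because it is periodic and matches the pole of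
  the kernel. The factor \<open>r\<close> on the right is kept to cancel the singularity of
  \<open>weight\<close>.\<close>

lemma poisson_deriv_bound:
  assumes F: "F \<in> borel_measurable borel" "\<And>x. F (- x) = - F x"
    and holder: "\<And>x y. \<bar>F x - F y\<bar> \<le> L * \<bar>sin ((x - y) / 2)\<bar> powr \<alpha>" and L: "0 \<le> L"
    and \<alpha>: "0 < \<alpha>" "\<alpha> \<le> 1" and r: "0 \<le> r" "r < 1"
  shows "\<bar>\<Sum>j. real j * r ^ j * sine_coeff F j * cos (real j * a)\<bar> \<le> 4 * pi * L * r * (1 - r) powr (\<alpha> - 1)"
proof -
  let ?M = "ivl (- pi) pi"
  note [measurable] = borel_measurable_ivlI[OF F(1)]
  have bd: "\<bar>F x - F y\<bar> \<le> L" for x y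
  proof -
    have "\<bar>sin ((x - y) / 2)\<bar> powr \<alpha> \<le> 1 powr \<alpha>" using \<alpha> by (intro powr_mono2) auto
    then have "L * \<bar>sin ((x - y) / 2)\<bar> powr \<alpha> \<le> L * 1" using L by (intro mult_left_mono) auto
    with holder[of x y] show ?thesis by linarith
  qed
  have "F 0 = 0" using F(2)[of 0] by simp
  then have bF: "\<bar>F x\<bar> \<le> L" for x using bd[of x 0] by simp
  have intF: "integrable ?M (\<lambda>y. F y * g y)" if "g \<in> borel_measurable ?M" "\<And>y. \<bar>g y\<bar> \<le> 1" for g
  proof (rule integrable_ivl_bounded[where B = "L * 1"])
    show "(\<lambda>y. F y * g y) \<in> borel_measurable ?M" using that by measurable
    show "norm (F y * g y) \<le> L * 1" for y
      unfolding real_norm_def abs_mult using bF[of y] that(2)[of y] L by (intro mult_mono) auto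
  qed
  have intFa: "integrable ?M (\<lambda>y. F y - F a)"
    by (rule integrable_ivl_bounded[where B = L]) (use bd in auto)
  let ?k = "\<lambda>y. r * (1 - r\<^sup>2) * sin (y - a) / (pdenom r (y - a))\<^sup>2"
  have ms: "(\<lambda>y. sin (real j * (y - a))) \<in> borel_measurable ?M" for j by measurable
  have s: "summable (\<lambda>j. \<bar>real j * r ^ j\<bar>)"
    using summable_deriv_power[OF r] r by (simp add: abs_mult)
  note * = integral_mult_series[OF intFa ms _ s sums_deriv_sin[OF r]]
  have int_k: "integrable ?M (\<lambda>y. (F y - F a) * ?k y)" by (rule *(1)) auto
  have sum_k: "(\<lambda>j. real j * r ^ j * (LINT y|?M. (F y - F a) * sin (real j * (y - a)))) sums
      (LINT y|?M. (F y - F a) * ?k y)" by (rule *(2)) auto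
  \<comment> \<open>Oddness of \<open>F\<close> kills the cosine part and doubles the sine part; the
    constant \<open>F a\<close> integrates to 0 against the sine.\<close>
  have coeff: "(LINT y|?M. (F y - F a) * sin (real j * (y - a))) = 2 * sine_coeff F j * cos (real j * a)"
    if "j > 0" for j
  proof -
    have i1: "integrable ?M (\<lambda>y. F y * sin (real j * y))" and i2: "integrable ?M (\<lambda>y. F y * cos (real j * y))"
      by (intro intF; simp)+
    have i3: "integrable ?M (\<lambda>y. sin (real j * (y - a)))" by (intro integrable_ivl_continuous continuous_intros)
    have z: "(LINT y|?M. sin (real j * (y - a))) = 0"
    proof -
      have "(LINT y|?M. sin (real j * (y - a))) =
          - cos (real j * (pi - a)) / real j - - cos (real j * (- pi - a)) / real j"
        using that by (intro FTC_ivl) (auto intro!: derivative_eq_intros continuous_intros)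
      also have "cos (real j * (pi - a)) = cos (real j * (- pi - a))"
        using cos.plus_of_nat[of "real j * (- pi - a)" j] by (simp add: algebra_simps)
      finally show ?thesis by simp
    qed
    have "(LINT y|?M. (F y - F a) * sin (real j * (y - a))) =
        (LINT y|?M. cos (real j * a) * (F y * sin (real j * y)) - sin (real j * a) * (F y * cos (real j * y))
           - F a * sin (real j * (y - a)))"
      by (intro Bochner_Integration.integral_cong refl) (simp add: algebra_simps sin_diff)
    also have "\<dots> = cos (real j * a) * (LINT y|?M. F y * sin (real j * y))
        - sin (real j * a) * (LINT y|?M. F y * cos (real j * y)) - F a * (LINT y|?M. sin (real j * (y - a)))"
      using i1 i2 i3 by simp
    also have "(LINT y|?M. F y * cos (real j * y)) = 0"
      using i2 by (rule integral_ivl_odd) (simp_all add: F(2))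
    also have "(LINT y|?M. F y * sin (real j * y)) = 2 * sine_coeff F j"
      unfolding sine_coeff_def using i1 by (rule integral_ivl_even) (simp_all add: F(2))
    finally show ?thesis using z by simp
  qed
  have "(\<lambda>j. 2 * (real j * r ^ j * sine_coeff F j * cos (real j * a))) sums (LINT y|?M. (F y - F a) * ?k y)"
  proof (rule sums_cong[THEN iffD1, OF _ sum_k])
    fix j
    show "real j * r ^ j * (LINT y|?M. (F y - F a) * sin (real j * (y - a))) =
        2 * (real j * r ^ j * sine_coeff F j * cos (real j * a))"
      by (cases "j = 0") (simp_all add: coeff)
  qed
  then have eq: "(\<Sum>j. real j * r ^ j * sine_coeff F j * cos (real j * a)) = (LINT y|?M. (F y - F a) * ?k y) / 2"
    using sums_mult_D[of "2::real"] by (simp add: sums_iff)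
  have "\<bar>LINT y|?M. (F y - F a) * ?k y\<bar> \<le> (LINT y|?M. \<bar>(F y - F a) * ?k y\<bar>)" by (rule integral_abs_bound)
  also have "\<dots> \<le> (LINT y|?M. L * (4 * r * (1 - r) powr (\<alpha> - 1)) * ((1 - r\<^sup>2) / pdenom r (y - a)))"
  proof (rule integral_mono)
    show "integrable ?M (\<lambda>y. \<bar>(F y - F a) * ?k y\<bar>)" using int_k by (rule integrable_abs)
    show "integrable ?M (\<lambda>y. L * (4 * r * (1 - r) powr (\<alpha> - 1)) * ((1 - r\<^sup>2) / pdenom r (y - a)))"
      by (intro integrable_mult_right integral_poisson_kernel r)
    fix y
    have "\<bar>(F y - F a) * ?k y\<bar> \<le> L * \<bar>sin ((y - a) / 2)\<bar> powr \<alpha> * \<bar>?k y\<bar>"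
      unfolding abs_mult[of "F y - F a"] by (intro mult_right_mono holder) auto
    also have "\<dots> \<le> L * (4 * r * (1 - r) powr (\<alpha> - 1) * ((1 - r\<^sup>2) / pdenom r (y - a)))"
      unfolding mult.assoc[of L] by (intro mult_left_mono conjugate_kernel_bound r \<alpha> L)
    finally show "\<bar>(F y - F a) * ?k y\<bar> \<le> L * (4 * r * (1 - r) powr (\<alpha> - 1)) * ((1 - r\<^sup>2) / pdenom r (y - a))"
      by (simp only: mult.assoc)
  qed
  also have "\<dots> = L * (4 * r * (1 - r) powr (\<alpha> - 1)) * (2 * pi)"
    by (simp only: integral_mult_right_zero integral_poisson_kernel(2)[OF r])
  finally show ?thesis unfolding eq by (simp add: mult_ac)
qed

text \<open>The mean value inequality bounds the difference quotients by \<open>w\<close>, and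
  dominated convergence along sequences finishes.\<close>

lemma differentiate_under_integral:
  fixes f f' :: "real \<Rightarrow> 'a \<Rightarrow> real"
  assumes f: "\<And>x. integrable M (f x)" and f': "\<And>x. f' x \<in> borel_measurable M"
    and deriv: "\<And>x s. s \<in> space M \<Longrightarrow> ((\<lambda>x. f x s) has_real_derivative f' x s) (at x)"
    and bound: "\<And>x s. s \<in> space M \<Longrightarrow> \<bar>f' x s\<bar> \<le> w s" and w: "integrable M w"
  shows "((\<lambda>x. LINT s|M. f x s) has_real_derivative (LINT s|M. f' x s)) (at x)"
  unfolding has_field_derivative_iff tendsto_at_iff_sequentially
proof (intro allI impI)
  fix X :: "nat \<Rightarrow> real"
  assume X: "\<forall>i. X i \<in> UNIV - {x}" and lim: "X \<longlonglongrightarrow> x"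
  let ?q = "\<lambda>i s. (f (X i) s - f x s) / (X i - x)"
  have "(\<lambda>i. LINT s|M. ?q i s) \<longlonglongrightarrow> (LINT s|M. f' x s)"
  proof (rule integral_dominated_convergence[OF f' _ w])
    show "?q i \<in> borel_measurable M" for i using f[THEN borel_measurable_integrable] by measurable
    show "AE s in M. (\<lambda>i. ?q i s) \<longlonglongrightarrow> f' x s"
    proof (rule AE_I2)
      fix s assume "s \<in> space M"
      from deriv[OF this, of x] show "(\<lambda>i. ?q i s) \<longlonglongrightarrow> f' x s"
        unfolding has_field_derivative_iff tendsto_at_iff_sequentially comp_def using X lim by blast
    qed
    show "AE s in M. norm (?q i s) \<le> w s" for i
    proof (rule AE_I2)
      fix s assume s: "s \<in> space M"
      have "norm (f (X i) s - f x s) \<le> w s * norm (X i - x)"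
        using deriv[OF s] bound[OF s]
        by (intro field_differentiable_bound[of UNIV "\<lambda>x. f x s" "\<lambda>x. f' x s"]) auto
      moreover have "X i - x \<noteq> 0" using X by simp
      ultimately show "norm (?q i s) \<le> w s" by (simp add: divide_simps)
    qed
  qed
  moreover have "(LINT s|M. ?q i s) = ((LINT s|M. f (X i) s) - (LINT s|M. f x s)) / (X i - x)" for i
    by (simp add: Bochner_Integration.integral_diff[OF f f])
  ultimately show "((\<lambda>y. ((LINT s|M. f y s) - (LINT s|M. f x s)) / (y - x)) \<circ> X) \<longlonglongrightarrow> (LINT s|M. f' x s)"
    by (simp only: comp_def)
qed

lemma continuous_integral:
  fixes f :: "real \<Rightarrow> 'a \<Rightarrow> real"
  assumes f: "\<And>x. f x \<in> borel_measurable M"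
    and cont: "\<And>s. s \<in> space M \<Longrightarrow> continuous_on UNIV (\<lambda>x. f x s)"
    and bound: "\<And>x s. s \<in> space M \<Longrightarrow> \<bar>f x s\<bar> \<le> w s" and w: "integrable M w"
  shows "continuous_on UNIV (\<lambda>x. LINT s|M. f x s)"
  unfolding continuous_on_sequentially comp_def
proof (intro ballI allI impI)
  fix X :: "nat \<Rightarrow> real" and a assume "(\<forall>n. X n \<in> UNIV) \<and> X \<longlonglongrightarrow> a"
  then have lim: "X \<longlonglongrightarrow> a" by simp
  show "(\<lambda>i. LINT s|M. f (X i) s) \<longlonglongrightarrow> (LINT s|M. f a s)"
  proof (rule integral_dominated_convergence[OF f f w])
    show "AE s in M. (\<lambda>i. f (X i) s) \<longlonglongrightarrow> f a s"
      using cont lim by (intro AE_I2 isCont_tendsto_compose[where g = "\<lambda>x. f x _"])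
        (auto simp: continuous_on_eq_continuous_at)
    show "AE s in M. norm (f (X i) s) \<le> w s" for i using bound by (intro AE_I2) auto
  qed
qed

text \<open>Interpolated with the trivial bound 1, this replaces the factor \<open>j\<close> by a
  fractional power of \<open>j\<close>.\<close>

lemma abs_sin_nat_le: "\<bar>sin (real j * x)\<bar> \<le> real j * \<bar>sin x\<bar>"
proof (induction j)
  case (Suc j)
  have "\<bar>sin (real (Suc j) * x)\<bar> = \<bar>sin (real j * x) * cos x + cos (real j * x) * sin x\<bar>"
    by (simp add: algebra_simps sin_add)
  also have "\<dots> \<le> \<bar>sin (real j * x)\<bar> * \<bar>cos x\<bar> + \<bar>cos (real j * x)\<bar> * \<bar>sin x\<bar>"
    by (metis abs_mult abs_triangle_ineq)
  also have "\<dots> \<le> \<bar>sin (real j * x)\<bar> * 1 + 1 * \<bar>sin x\<bar>"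
    by (intro add_mono mult_left_mono mult_right_mono) auto
  finally show ?case using Suc by (simp add: algebra_simps)
qed simp

text \<open>As \<open>sqrt\<close> is odd on the reals, signs matter. For equal signs subadditivity
  suffices; for opposite signs \<open>(a + b)^2 <= 2 (a^2 + b^2)\<close> is used, the origin of the
  factor 2.\<close>

lemma abs_sqrt_diff_le: "\<bar>sqrt x - sqrt y\<bar> \<le> sqrt (2 * \<bar>x - y\<bar>)"
proof -
  have *: "\<bar>sqrt x - sqrt y\<bar> \<le> sqrt (2 * \<bar>x - y\<bar>)" if "y \<le> x" "0 \<le> x" for x y :: real
  proof (cases "0 \<le> y")
    case True
    have "sqrt x \<le> sqrt y + sqrt (x - y)"
      using sqrt_add_le_add_sqrt[of y "x - y"] True that by simp
    moreover have "sqrt (x - y) \<le> sqrt (2 * \<bar>x - y\<bar>)" using that by simp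
    ultimately show ?thesis using real_sqrt_le_mono[OF that(1)] by linarith
  next
    case False
    define a b where "a = sqrt x" and "b = sqrt (- y)"
    have ab: "x = a\<^sup>2" "y = - b\<^sup>2" "0 \<le> a" "0 \<le> b" using that False by (auto simp: a_def b_def)
    have "sqrt y = - b" by (simp add: b_def real_sqrt_minus)
    have "(a + b)\<^sup>2 \<le> 2 * (a\<^sup>2 + b\<^sup>2)" using sum_squares_bound[of a b] by (simp add: power2_sum)
    then have "a + b \<le> sqrt (2 * (a\<^sup>2 + b\<^sup>2))" by (rule real_le_rsqrt)
    moreover have "sqrt x - sqrt y = a + b" using \<open>sqrt y = - b\<close> by (simp add: a_def)
    moreover have "\<bar>x - y\<bar> = a\<^sup>2 + b\<^sup>2" using ab by simp
    ultimately show ?thesis using ab(3,4) by simp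
  qed
  consider "y \<le> x" "0 \<le> x" | "x \<le> y" "0 \<le> y" | "x < 0" "y < 0" by linarith
  then show ?thesis
  proof cases
    case 1
    then show ?thesis by (rule *)
  next
    case 2
    from *[OF this] show ?thesis by (simp add: abs_minus_commute)
  next
    case 3
    have "\<bar>sqrt (- x) - sqrt (- y)\<bar> \<le> sqrt (2 * \<bar>- x - - y\<bar>)"
    proof (cases "x \<le> y")
      case True
      then show ?thesis using 3 by (intro *) auto
    next
      case False
      then have "\<bar>sqrt (- y) - sqrt (- x)\<bar> \<le> sqrt (2 * \<bar>- y - - x\<bar>)" using 3 by (intro *) auto
      then show ?thesis by (simp add: abs_minus_commute)
    qed
    then show ?thesis by (simp add: real_sqrt_minus abs_minus_commute)
  qed
qed

text \<open>The integrand is unbounded at 1 when \<open>\<alpha> < 1\<close>, hence the fundamental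
  theorem for nonnegative integrands with one-sided limits of the antiderivative.\<close>

lemma integrable_powr_at_1:
  assumes "0 < \<alpha>"
  shows "integrable (ivl 0 1) (\<lambda>s. (1 - s) powr (\<alpha> - 1))"
proof -
  have e: "einterval 0 1 = {0<..<1::real}" by (auto simp: einterval_def)
  have "set_integrable lborel (einterval 0 1) (\<lambda>s. (1 - s) powr (\<alpha> - 1))"
  proof (rule interval_integral_FTC_nonneg(1)[where F = "\<lambda>s. - ((1 - s) powr \<alpha>) / \<alpha>"])
    show "DERIV (\<lambda>s. - ((1 - s) powr \<alpha>) / \<alpha>) x :> (1 - x) powr (\<alpha> - 1)" if "0 < ereal x" "ereal x < 1" for x
      using that assms by (auto intro!: derivative_eq_intros simp: zero_ereal_def one_ereal_def)
    show "isCont (\<lambda>s. (1 - s) powr (\<alpha> - 1)) x" if "0 < ereal x" "ereal x < 1" for x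
      using that by (auto intro!: continuous_intros simp: zero_ereal_def one_ereal_def)
    have c: "continuous_on {..1} (\<lambda>s. - ((1 - s) powr \<alpha>) / \<alpha>)"
      using assms by (intro continuous_intros continuous_on_powr') auto
    have "((\<lambda>s. - ((1 - s) powr \<alpha>) / \<alpha>) \<longlongrightarrow> - ((1 - 0) powr \<alpha>) / \<alpha>) (at_right 0)"
      by (intro tendsto_intros) (use assms in auto)
    then show "(((\<lambda>s. - ((1 - s) powr \<alpha>) / \<alpha>) \<circ> real_of_ereal) \<longlongrightarrow> - ((1 - 0) powr \<alpha>) / \<alpha>) (at_right 0)"
      by (simp add: zero_ereal_def ereal_tendsto_simps)
    have "((\<lambda>s. - ((1 - s) powr \<alpha>) / \<alpha>) \<longlongrightarrow> - ((1 - 1) powr \<alpha>) / \<alpha>) (at 1 within {..1})"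
      using c unfolding continuous_on_def by (rule bspec) simp
    then have "((\<lambda>s. - ((1 - s) powr \<alpha>) / \<alpha>) \<longlongrightarrow> - ((1 - 1) powr \<alpha>) / \<alpha>) (at_left 1)"
      by (rule tendsto_within_subset) auto
    then show "(((\<lambda>s. - ((1 - s) powr \<alpha>) / \<alpha>) \<circ> real_of_ereal) \<longlongrightarrow> - ((1 - 1) powr \<alpha>) / \<alpha>) (at_left 1)"
      by (simp add: one_ereal_def ereal_tendsto_simps)
  qed auto
  then show ?thesis by (simp add: integrable_ivl_iff e)
qed

section \<open>Smoothing by \<open>K\<close> and the bootstrap for fixed points\<close>

context n_fold
begin

text \<open>Interpolating between \<open>|sin (j x)| <= 1\<close> and
  \<open>|sin (j x)| <= j |sin x|\<close> costs \<open>j powr (1 / 4)\<close>. With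
  \<open>mu j <= 1 / j\<close> there remains \<open>w j = j powr (- 3 / 4)\<close>, which is square
  summable, so Cauchy-Schwarz against the sine coefficients applies. Exponents below 1/2 all behave
  like this one.\<close>

lemma K_holder:
  assumes "L2_half \<phi>"
  shows "\<exists>C\<ge>0. \<forall>a b. \<bar>K \<phi> a - K \<phi> b\<bar> \<le> C * \<bar>sin ((a - b) / 2)\<bar> powr (1 / 4)"
proof -
  define w where "w j = real j powr (- 3 / 4)" for j
  have w2: "(w j)\<^sup>2 = real j powr (- 3 / 2)" for j
    unfolding w_def by (simp add: power2_eq_square flip: powr_add)
  have sw: "summable (\<lambda>j. (w j)\<^sup>2)" unfolding w2 by (simp add: summable_real_powr_iff)
  have swb: "summable (\<lambda>j. \<bar>w j\<bar> * \<bar>sine_coeff \<phi> j\<bar>)"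
    by (rule cauchy_schwarz_summable(1)[OF sw bessel(1)[OF assms]])
  define C where "C = 2 * (\<Sum>j. \<bar>w j\<bar> * \<bar>sine_coeff \<phi> j\<bar>)"
  show ?thesis
  proof (intro exI[of _ C] conjI allI)
    show "0 \<le> C" unfolding C_def using swb by (intro mult_nonneg_nonneg suminf_nonneg) auto
    fix a b :: real
    define t where "t = \<bar>sin ((a - b) / 2)\<bar> powr (1 / 4)"
    have trm: "\<bar>mu j * sine_coeff \<phi> j * (sin (real j * a) - sin (real j * b))\<bar> \<le>
        2 * t * (\<bar>w j\<bar> * \<bar>sine_coeff \<phi> j\<bar>)" for j
    proof (cases "j = 0")
      case False
      define x where "x = \<bar>sin (real j * ((a - b) / 2))\<bar>"
      have x: "0 \<le> x" "x \<le> 1" "x \<le> real j * \<bar>sin ((a - b) / 2)\<bar>"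
        using abs_sin_nat_le[of j "(a - b) / 2"] by (auto simp: x_def)
      have "x = x powr 1" using x by simp
      also have "\<dots> \<le> x powr (1 / 4)" using x by (cases "x = 0") (auto intro!: powr_mono'[of "1 / 4" 1 x, simplified])
      also have "\<dots> \<le> (real j * \<bar>sin ((a - b) / 2)\<bar>) powr (1 / 4)" using x by (intro powr_mono2) auto
      also have "\<dots> = real j powr (1 / 4) * t" by (simp add: t_def powr_mult)
      finally have xle: "x \<le> real j powr (1 / 4) * t" .
      have "sin (real j * a) - sin (real j * b) =
          2 * sin (real j * ((a - b) / 2)) * cos (real j * ((a + b) / 2))"
        using sin_diff_sin[of "real j * a" "real j * b"] by (simp add: algebra_simps)
      then have "\<bar>sin (real j * a) - sin (real j * b)\<bar> = 2 * x * \<bar>cos (real j * ((a + b) / 2))\<bar>"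
        by (simp add: abs_mult x_def)
      also have "\<dots> \<le> 2 * x * 1" using x by (intro mult_left_mono) auto
      finally have "\<bar>sin (real j * a) - sin (real j * b)\<bar> \<le> 2 * (real j powr (1 / 4) * t)" using xle by simp
      then have "mu j * \<bar>sin (real j * a) - sin (real j * b)\<bar> \<le> 1 / real j * (2 * (real j powr (1 / 4) * t))"
        by (intro mult_mono mu_le mu_nonneg) auto
      also have "\<dots> = 2 * t * w j"
      proof -
        have "real j powr (1 / 4) = real j powr 1 * real j powr (- 3 / 4)" by (subst powr_add[symmetric]) simp
        then show ?thesis using False by (simp add: w_def)
      qed
      finally have "\<bar>sine_coeff \<phi> j\<bar> * (mu j * \<bar>sin (real j * a) - sin (real j * b)\<bar>) \<le> \<bar>sine_coeff \<phi> j\<bar> * (2 * t * w j)"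
        by (intro mult_left_mono) auto
      then show ?thesis using mu_nonneg[of j] by (simp add: abs_mult mult_ac w_def)
    qed simp
    have sums: "(\<lambda>j. mu j * sine_coeff \<phi> j * (sin (real j * a) - sin (real j * b))) sums (K \<phi> a - K \<phi> b)"
      using sums_diff[OF sums_K[OF assms, of a] sums_K[OF assms, of b]] by (simp add: algebra_simps)
    have sabs: "summable (\<lambda>j. \<bar>mu j * sine_coeff \<phi> j * (sin (real j * a) - sin (real j * b))\<bar>)"
      by (rule summable_comparison_test'[OF summable_mult[OF swb, of "2 * t"]]) (use trm in auto)
    have "\<bar>K \<phi> a - K \<phi> b\<bar> \<le> (\<Sum>j. \<bar>mu j * sine_coeff \<phi> j * (sin (real j * a) - sin (real j * b))\<bar>)"
      using summable_rabs[OF sabs] sums by (simp add: sums_iff)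
    also have "\<dots> \<le> (\<Sum>j. 2 * t * (\<bar>w j\<bar> * \<bar>sine_coeff \<phi> j\<bar>))"
      by (rule suminf_le[OF trm sabs summable_mult[OF swb]])
    also have "\<dots> = C * t" using suminf_mult[OF swb, of "2 * t"] by (simp add: C_def)
    finally show "\<bar>K \<phi> a - K \<phi> b\<bar> \<le> C * \<bar>sin ((a - b) / 2)\<bar> powr (1 / 4)" by (simp add: t_def)
  qed
qed

lemma K_continuous:
  assumes "L2_half \<phi>"
  shows "continuous_on UNIV (K \<phi>)"
proof -
  obtain C where C: "\<And>a b. \<bar>K \<phi> a - K \<phi> b\<bar> \<le> C * \<bar>sin ((a - b) / 2)\<bar> powr (1 / 4)"
    using K_holder[OF assms] by blast
  have "(K \<phi> \<longlongrightarrow> K \<phi> a) (at a)" for a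
  proof (rule Lim_null[THEN iffD2], rule Lim_null_comparison)
    show "\<forall>\<^sub>F x in at a. norm (K \<phi> x - K \<phi> a) \<le> C * \<bar>sin ((x - a) / 2)\<bar> powr (1 / 4)"
      using C by (intro always_eventually) simp
    have "((\<lambda>x. C * \<bar>sin ((x - a) / 2)\<bar> powr (1 / 4)) \<longlongrightarrow> C * \<bar>sin ((a - a) / 2)\<bar> powr (1 / 4)) (at a)"
      by (intro tendsto_intros) auto
    then show "((\<lambda>x. C * \<bar>sin ((x - a) / 2)\<bar> powr (1 / 4)) \<longlongrightarrow> 0) (at a)" by simp
  qed
  then show ?thesis by (simp add: continuous_on_def)
qed

lemma poisson_sine_has_derivative:
  assumes "L2_half \<phi>" "0 \<le> r" "r < 1"
  shows "((\<lambda>a. poisson_sine \<phi> r a) has_real_derivative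
      (\<Sum>j. real j * r ^ j * sine_coeff \<phi> j * cos (real j * a))) (at a)"
    and "continuous_on UNIV (\<lambda>a. \<Sum>j. real j * r ^ j * sine_coeff \<phi> j * cos (real j * a))"
proof -
  let ?f' = "\<lambda>j a. real j * r ^ j * sine_coeff \<phi> j * cos (real j * a)"
  define B where "B = sqrt (\<Sum>j. (sine_coeff \<phi> j)\<^sup>2)"
  have B: "\<bar>sine_coeff \<phi> j\<bar> \<le> B" for j
    unfolding B_def using sum_le_suminf[OF bessel(1)[OF assms(1)], of "{j}"]
    by (intro real_le_rsqrt) auto
  have bd: "norm (?f' j a) \<le> B * (real j * r ^ j)" for j a
  proof -
    have "\<bar>sine_coeff \<phi> j\<bar> * \<bar>cos (real j * a)\<bar> \<le> B * 1" using B[of j] by (intro mult_mono) auto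
    from mult_left_mono[OF this, of "real j * r ^ j"] show ?thesis
      using assms by (simp add: abs_mult mult_ac)
  qed
  have sB: "summable (\<lambda>j. B * (real j * r ^ j))" by (intro summable_mult summable_deriv_power assms)
  have unif: "uniform_limit UNIV (\<lambda>n a. \<Sum>j<n. ?f' j a) (\<lambda>a. \<Sum>j. ?f' j a) sequentially"
    by (rule Weierstrass_m_test[OF bd sB])
  show "continuous_on UNIV (\<lambda>a. \<Sum>j. ?f' j a)"
    by (rule uniform_limit_theorem[OF _ unif]) (auto intro!: continuous_intros always_eventually)
  have "((\<lambda>a. \<Sum>j. r ^ j * sine_coeff \<phi> j * sin (real j * a)) has_real_derivative (\<Sum>j. ?f' j a)) (at a)"
  proof (rule has_field_derivative_series'(2)[where S = UNIV and ?x0.0 = 0])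
    show "((\<lambda>a. r ^ j * sine_coeff \<phi> j * sin (real j * a)) has_real_derivative ?f' j a) (at a within UNIV)" for j a
      by (auto intro!: derivative_eq_intros)
    show "uniformly_convergent_on UNIV (\<lambda>n a. \<Sum>j<n. ?f' j a)"
      using unif by (auto simp: uniformly_convergent_on_def)
  qed auto
  moreover have "(\<Sum>j. r ^ j * sine_coeff \<phi> j * sin (real j * a)) = poisson_sine \<phi> r a" for a
    using poisson_sine(2)[OF assms, of a] by (simp add: sums_iff)
  ultimately show "((\<lambda>a. poisson_sine \<phi> r a) has_real_derivative (\<Sum>j. ?f' j a)) (at a)" by simp
qed

text \<open>Differentiates the Poisson representation of \<open>K\<close> under the integral over
  \<open>s\<close>. The derivative of the extension grows like
  \<open>(1 - s) powr (\<alpha> - 1)\<close> at \<open>s = 1\<close>, which is integrable for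
  positive \<open>\<alpha>\<close>, and its factor \<open>s ^ n\<close> absorbs
  \<open>weight\<close> at \<open>s = 0\<close>. \<open>F\<close> is the odd Hoelder continuation of
  \<phi> to the line.\<close>

lemma K_C1:
  assumes \<phi>: "L2_half \<phi>" and eq: "\<And>y. 0 < y \<Longrightarrow> y < pi \<Longrightarrow> \<phi> y = F y"
    and F: "F \<in> borel_measurable borel" "\<And>x. F (- x) = - F x"
    and holder: "\<And>x y. \<bar>F x - F y\<bar> \<le> L * \<bar>sin ((x - y) / 2)\<bar> powr \<alpha>" and L: "0 \<le> L"
    and \<alpha>: "0 < \<alpha>" "\<alpha> \<le> 1"
  shows "\<exists>G' B. continuous_on UNIV G' \<and> (\<forall>a. (K \<phi> has_real_derivative G' a) (at a) \<and> \<bar>G' a\<bar> \<le> B)"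
proof -
  define u' where "u' r a = (\<Sum>j. real j * r ^ j * sine_coeff \<phi> j * cos (real j * a))" for r a
  have sc: "sine_coeff \<phi> j = sine_coeff F j" for j
    unfolding sine_coeff_def by (rule Bochner_Integration.integral_cong) (auto simp: eq)
  let ?w = "\<lambda>s. 4 * pi * L * (1 - s) powr (\<alpha> - 1)"
  have w: "integrable (ivl 0 1) ?w" by (intro integrable_mult_right integrable_powr_at_1 \<alpha>)
  have pow: "0 < s ^ n" "s ^ n < 1" "s ^ n \<le> s" if "s \<in> space (ivl 0 1)" for s
    using that n_ge_3 power_decreasing[of 1 n s] by (auto simp: power_less_one_iff)
  have bound: "\<bar>weight s * u' (s ^ n) a\<bar> \<le> ?w s" if s: "s \<in> space (ivl 0 1)" for s a
  proof -
    have "\<bar>u' (s ^ n) a\<bar> \<le> 4 * pi * L * s ^ n * (1 - s ^ n) powr (\<alpha> - 1)"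
      unfolding u'_def sc using pow[OF s] by (intro poisson_deriv_bound F holder L \<alpha>) auto
    \<comment> \<open>Here \<open>1 - s <= 1 - s ^ n\<close>, and the exponent is
      nonpositive.\<close>
    also have "\<dots> \<le> 4 * pi * L * s ^ n * (1 - s) powr (\<alpha> - 1)"
      using pow[OF s] s \<alpha> L by (intro mult_left_mono powr_mono2') auto
    finally have "\<bar>weight s\<bar> * \<bar>u' (s ^ n) a\<bar> \<le> \<bar>weight s\<bar> * (4 * pi * L * s ^ n * (1 - s) powr (\<alpha> - 1))"
      by (intro mult_left_mono) auto
    also have "\<dots> = (s ^ n * weight s) * ?w s" using s weight_nonneg[of s] by simp
    also have "\<dots> \<le> 1 * ?w s" using s L power_weight_le[of s] by (intro mult_right_mono) auto
    finally show ?thesis by (simp add: abs_mult)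
  qed
  have meas: "(\<lambda>s. weight s * u' (s ^ n) a) \<in> borel_measurable (ivl 0 1)" for a
    unfolding u'_def by (rule borel_measurable_ivlI) measurable
  define G' where "G' a = (LINT s|ivl 0 1. weight s * u' (s ^ n) a)" for a
  have "continuous_on UNIV G'"
    unfolding G'_def
  proof (rule continuous_integral[OF meas _ bound w])
    fix s assume s: "s \<in> space (ivl 0 1)"
    have "continuous_on UNIV (u' (s ^ n))"
      unfolding u'_def[abs_def] using pow[OF s] by (intro poisson_sine_has_derivative(2) \<phi>) auto
    then show "continuous_on UNIV (\<lambda>a. weight s * u' (s ^ n) a)" by (intro continuous_intros)
  qed
  moreover have "\<bar>G' a\<bar> \<le> integral\<^sup>L (ivl 0 1) ?w" for a
  proof -
    have i: "integrable (ivl 0 1) (\<lambda>s. weight s * u' (s ^ n) a)"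
    proof (rule Bochner_Integration.integrable_bound[OF w meas], rule AE_I2)
      fix s assume "s \<in> space (ivl 0 1)"
      from bound[OF this, of a] show "norm (weight s * u' (s ^ n) a) \<le> norm (?w s)"
        unfolding real_norm_def by linarith
    qed
    have "\<bar>G' a\<bar> \<le> (LINT s|ivl 0 1. \<bar>weight s * u' (s ^ n) a\<bar>)" unfolding G'_def by (rule integral_abs_bound)
    also have "\<dots> \<le> integral\<^sup>L (ivl 0 1) ?w" using i by (intro integral_mono bound w integrable_abs)
    finally show ?thesis .
  qed
  moreover have "(K \<phi> has_real_derivative G' a) (at a)" for a
  proof -
    have "((\<lambda>a. LINT s|ivl 0 1. weight s * poisson_sine \<phi> (s ^ n) a) has_real_derivative G' a) (at a)"
      unfolding G'_def
    proof (rule differentiate_under_integral[OF K_poisson(1)[OF \<phi>] meas _ bound w])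
      fix s x assume s: "s \<in> space (ivl 0 1)"
      show "((\<lambda>a. weight s * poisson_sine \<phi> (s ^ n) a) has_real_derivative weight s * u' (s ^ n) x) (at x)"
        unfolding u'_def using pow[OF s] by (intro DERIV_cmult poisson_sine_has_derivative(1) \<phi>) auto
    qed
    then show ?thesis unfolding K_poisson(2)[OF \<phi>, symmetric] .
  qed
  ultimately show ?thesis by blast
qed

text \<open>For \<phi> merely square integrable, \<open>K \<phi>\<close> has Hoelder exponent 1/4
  and its square root 1/8. That root is odd on the line and equals \<phi> on (0, pi), so
  \<open>K\<close> can now gain a full derivative.\<close>

lemma fixed_point_C1:
  assumes "fixed_point \<phi>"
  shows "\<exists>G' B. continuous_on UNIV G' \<and> (\<forall>a. (K \<phi> has_real_derivative G' a) (at a) \<and> \<bar>G' a\<bar> \<le> B)"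
proof -
  have \<phi>: "L2_half \<phi>" "\<And>y. 0 < y \<Longrightarrow> y < pi \<Longrightarrow> 0 < \<phi> y \<and> (\<phi> y)\<^sup>2 = K \<phi> y"
    using assms by (auto simp: fixed_point_def)
  obtain C where C: "C \<ge> 0" "\<And>a b. \<bar>K \<phi> a - K \<phi> b\<bar> \<le> C * \<bar>sin ((a - b) / 2)\<bar> powr (1 / 4)"
    using K_holder[OF \<phi>(1)] by blast
  show ?thesis
  proof (rule K_C1[OF \<phi>(1), where F = "\<lambda>a. sqrt (K \<phi> a)" and L = "sqrt (2 * C)" and \<alpha> = "1 / 8"])
    show "\<phi> y = sqrt (K \<phi> y)" if "0 < y" "y < pi" for y
      using \<phi>(2)[OF that] by (metis less_imp_le real_sqrt_unique)
    show "sqrt (K \<phi> (- x)) = - sqrt (K \<phi> x)" for x by (simp add: K_odd[OF \<phi>(1)] real_sqrt_minus)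
    show "\<bar>sqrt (K \<phi> x) - sqrt (K \<phi> y)\<bar> \<le> sqrt (2 * C) * \<bar>sin ((x - y) / 2)\<bar> powr (1 / 8)" for x y
    proof -
      define t where "t = \<bar>sin ((x - y) / 2)\<bar> powr (1 / 8)"
      have "\<bar>sin ((x - y) / 2)\<bar> powr (1 / 4) = t\<^sup>2"
        by (simp add: t_def power2_eq_square flip: powr_add)
      then have "\<bar>K \<phi> x - K \<phi> y\<bar> \<le> C * t\<^sup>2" using C(2)[of x y] by simp
      then have "sqrt (2 * \<bar>K \<phi> x - K \<phi> y\<bar>) \<le> sqrt (2 * (C * t\<^sup>2))" by simp
      also have "\<dots> = sqrt (2 * C) * t" by (simp add: real_sqrt_mult t_def)
      finally show ?thesis using abs_sqrt_diff_le[of "K \<phi> x" "K \<phi> y"] by (simp add: t_def)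
    qed
  qed (use C in auto)
qed

end

section \<open>Fourier series of symmetric functions\<close>

lemma L2_circle_integrable:
  assumes "L2_circle q"
  shows "integrable (ivl (- pi) pi) q" "integrable (ivl (- pi) pi) (\<lambda>x. (q x)\<^sup>2)"
proof -
  have m: "q \<in> borel_measurable borel" and s: "set_integrable lborel circle (\<lambda>x. (q x)\<^sup>2)"
    using assms by (auto simp: L2_circle_def)
  note [measurable] = borel_measurable_ivlI[OF m]
  show *: "integrable (ivl (- pi) pi) (\<lambda>x. (q x)\<^sup>2)" using s by (simp add: integrable_ivl_Ioc)
  have one: "integrable (ivl (- pi) pi) (\<lambda>y. 1 :: real)" by (intro integrable_ivl_continuous continuous_intros)
  show "integrable (ivl (- pi) pi) q"
  proof (rule Bochner_Integration.integrable_bound[OF Bochner_Integration.integrable_add[OF one *]])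
    have "\<bar>q x\<bar> \<le> 1 + (q x)\<^sup>2" for x
      using sum_squares_bound[of 1 "\<bar>q x\<bar>"] by simp
    then show "AE x in ivl (- pi) pi. norm (q x) \<le> norm (1 + (q x)\<^sup>2)" by (intro AE_I2) simp
  qed measurable
qed

lemma integrable_mult_bounded:
  fixes q g :: "real \<Rightarrow> real"
  assumes "integrable M q" "g \<in> borel_measurable M" "\<And>x. x \<in> space M \<Longrightarrow> \<bar>g x\<bar> \<le> B"
  shows "integrable M (\<lambda>x. q x * g x)"
proof (rule Bochner_Integration.integrable_bound)
  show "integrable M (\<lambda>x. B * q x)" using assms(1) by (rule integrable_mult_right)
  show "(\<lambda>x. q x * g x) \<in> borel_measurable M" using assms by measurable
  show "AE x in M. norm (q x * g x) \<le> norm (B * q x)"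
  proof (rule AE_I2)
    fix x assume "x \<in> space M"
    from assms(3)[OF this] show "norm (q x * g x) \<le> norm (B * q x)"
      using mult_left_mono[of "\<bar>g x\<bar>" "\<bar>B\<bar>" "\<bar>q x\<bar>"] by (simp add: abs_mult mult.commute)
  qed
qed

text \<open>\<open>P\<close> demands \<open>R\<close> along the whole orbit of \<open>x\<close>
  under reflection and translations by \<open>T\<close>. These are countably many conditions of full
  measure, so \<open>P\<close> has full measure and is exactly invariant; the value 0 off
  \<open>P\<close> keeps both symmetries.\<close>

lemma exact_symmetric_representative:
  assumes q: "q \<in> borel_measurable borel" "AE_odd q" "AE_periodic T q"
  obtains p where "p \<in> borel_measurable borel" "AE x in lborel. q x = p x" "odd_fun p" "periodic T p"
proof -
  note [measurable] = q(1)
  define R where "R x \<longleftrightarrow> q (- x) = - q x \<and> q (x + T) = q x" for x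
  define P where "P x \<longleftrightarrow> (\<forall>k::int. R (of_int k * T + x) \<and> R (of_int k * T - x))" for x
  have Rm: "Measurable.pred borel R" unfolding R_def[abs_def] by measurable
  have "AE x in lborel. q (- x) = - q x" "AE x in lborel. q (x + T) = q x"
    using q by (auto simp: AE_odd_def AE_periodic_def)
  then have "AE x in lborel. R x" unfolding R_def by (rule AE_conjI)
  then have R: "AE x in lborel. R (t + c * x)" if "c \<noteq> 0" for t c
    using that by (intro AE_borel_affine Rm)
  have AEP: "AE x in lborel. P x"
    unfolding P_def
  proof (intro AE_all_countable[THEN iffD2] allI AE_conjI)
    show "AE x in lborel. R (of_int k * T + x)" for k :: int using R[of 1 "of_int k * T"] by simp
    show "AE x in lborel. R (of_int k * T - x)" for k :: int using R[of "-1" "of_int k * T"] by simp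
  qed
  have Pm [measurable]: "Measurable.pred borel P" unfolding P_def[abs_def] R_def by measurable
  have P_neg: "P (- x) \<longleftrightarrow> P x" for x unfolding P_def by auto
  have P_shift: "P x \<Longrightarrow> P (x + T)" and P_shift': "P (x + T) \<Longrightarrow> P x" for x
  proof -
    have e: "of_int k * T + (x + T) = of_int (k + 1) * T + x" "of_int k * T - (x + T) = of_int (k - 1) * T - x"
      "of_int k * T + x = of_int (k - 1) * T + (x + T)" "of_int k * T - x = of_int (k + 1) * T - (x + T)" for k :: int
      by (simp_all add: algebra_simps)
    show "P x \<Longrightarrow> P (x + T)" unfolding P_def e(1,2) by blast
    show "P (x + T) \<Longrightarrow> P x" unfolding P_def by (subst e(3), subst e(4)) blast
  qed
  have PR: "R x" if "P x" for x
  proof -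
    from that have "R (of_int 0 * T + x)" unfolding P_def by blast
    then show ?thesis by simp
  qed
  define p where "p x = (if P x then q x else 0)" for x
  show thesis
  proof (rule that[of p])
    show "p \<in> borel_measurable borel" unfolding p_def[abs_def] by measurable
    show "AE x in lborel. q x = p x" using AEP by eventually_elim (simp add: p_def)
    show "odd_fun p" unfolding odd_fun_def p_def using P_neg PR by (auto simp: R_def)
    show "periodic T p" unfolding periodic_def p_def using P_shift P_shift' PR by (auto simp: R_def)
  qed
qed

lemma AE_ivl_of_lborel: "AE x in lborel. P x \<Longrightarrow> AE x in ivl a b. P x"
  unfolding AE_ivl_iff by (erule eventually_mono) simp

lemma fourier_coeff_cong_AE:
  assumes "q \<in> borel_measurable borel" "p \<in> borel_measurable borel" "AE x in lborel. q x = p x"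
  shows "fourier_coeff q k = fourier_coeff p k"
proof -
  note [measurable] = assms(1,2)[THEN borel_measurable_ivlI]
  have c: "cis \<in> borel_measurable borel"
    by (intro borel_measurable_continuous_onI continuous_intros)
  have [measurable]: "(\<lambda>x. cis (- (of_int k * x))) \<in> borel_measurable (ivl (- pi) pi)"
    by (rule measurable_compose[OF _ c]) measurable
  have "(LINT x|ivl (- pi) pi. complex_of_real (q x) * cis (- (of_int k * x))) =
      (LINT x|ivl (- pi) pi. complex_of_real (p x) * cis (- (of_int k * x)))"
    using AE_ivl_of_lborel[OF assms(3)] by (intro integral_cong_AE) auto
  then show ?thesis by (simp add: fourier_coeff_def integral_ivl_Ioc)
qed

lemma fourier_coeff_odd:
  assumes q: "integrable (ivl (- pi) pi) q" "odd_fun q"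
  shows "fourier_coeff q k = - (\<i> / pi) * (LINT x|ivl 0 pi. q x * sin (of_int k * x))"
proof -
  have i1: "integrable (ivl (- pi) pi) (\<lambda>x. q x * cos (of_int k * x))"
    and i2: "integrable (ivl (- pi) pi) (\<lambda>x. q x * sin (of_int k * x))"
    by (rule integrable_mult_bounded[OF q(1), where B = 1]; simp)+
  have "(LINT x|ivl (- pi) pi. complex_of_real (q x) * cis (- (of_int k * x))) =
      (LINT x|ivl (- pi) pi. complex_of_real (q x * cos (of_int k * x)) - \<i> * complex_of_real (q x * sin (of_int k * x)))"
    by (intro Bochner_Integration.integral_cong refl) (simp add: complex_eq_iff)
  also have "\<dots> = complex_of_real (LINT x|ivl (- pi) pi. q x * cos (of_int k * x)) -
      \<i> * complex_of_real (LINT x|ivl (- pi) pi. q x * sin (of_int k * x))"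
    using i1[THEN integrable_of_real, where 'a = complex] i2[THEN integrable_of_real, where 'a = complex]
    by (subst Bochner_Integration.integral_diff)
       (simp_all only: integral_complex_of_real integral_mult_right_zero integrable_mult_right)
  also have "(LINT x|ivl (- pi) pi. q x * cos (of_int k * x)) = 0"
    using i1 by (rule integral_ivl_odd) (use q in \<open>auto simp: odd_fun_def\<close>)
  also have "(LINT x|ivl (- pi) pi. q x * sin (of_int k * x)) = 2 * (LINT x|ivl 0 pi. q x * sin (of_int k * x))"
    using i2 by (rule integral_ivl_even) (use q in \<open>auto simp: odd_fun_def\<close>)
  finally show ?thesis unfolding fourier_coeff_def integral_ivl_Ioc[symmetric] by (simp add: field_simps)
qed

lemma integral_ivl_shift_periodic:
  fixes h :: "real \<Rightarrow> 'b::{banach, second_countable_topology}"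
  assumes h: "integrable (ivl (- pi) pi) h" "periodic (2 * pi) h" and t: "0 \<le> t" "t \<le> 2 * pi"
  shows "(LINT x|ivl (- pi) pi. h (x + t)) = integral\<^sup>L (ivl (- pi) pi) h"
proof -
  have per: "h (2 * pi + x) = h x" for x using h(2) by (simp add: periodic_def add.commute)
  have "integrable (ivl pi (3 * pi)) h"
    using integral_ivl_affine(2)[of 1 "2 * pi" "- pi" pi h] h(1) by (simp add: per)
  then have i: "integrable (ivl pi (pi + t)) h" using t integral_ivl_split(1)[of pi "3 * pi" h "pi + t"] by simp
  have j: "integrable (ivl (- pi + t) pi) h" using t h(1) integral_ivl_split(2)[of "- pi" pi h "- pi + t"] by simp
  have k: "integrable (ivl (- pi + t) (pi + t)) h"
  proof -
    have "set_integrable lborel ({- pi + t<..pi} \<union> {pi<..pi + t}) h"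
      using i j by (intro set_integrable_Un) (auto simp: integrable_ivl_Ioc)
    moreover have "{- pi + t<..pi} \<union> {pi<..pi + t} = {- pi + t<..pi + t}" using t by auto
    ultimately show ?thesis by (simp add: integrable_ivl_Ioc)
  qed
  have "(LINT x|ivl (- pi) pi. h (x + t)) = integral\<^sup>L (ivl (- pi + t) (pi + t)) h"
    using integral_ivl_affine(1)[of 1 t "- pi" pi h] by (simp add: add.commute)
  also have "\<dots> = integral\<^sup>L (ivl (- pi + t) pi) h + integral\<^sup>L (ivl pi (pi + t)) h"
    using t by (intro integral_ivl_split(3)[OF k]) auto
  also have "integral\<^sup>L (ivl pi (pi + t)) h = integral\<^sup>L (ivl (- pi) (- pi + t)) h"
    using integral_ivl_affine(1)[of 1 "2 * pi" "- pi" "- pi + t" h] by (simp add: per)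
  also have "integral\<^sup>L (ivl (- pi + t) pi) h + \<dots> = integral\<^sup>L (ivl (- pi) pi) h"
    using integral_ivl_split(3)[OF h(1), of "- pi + t"] t by simp
  finally show ?thesis .
qed

text \<open>Evenness and period \<open>2 * c\<close> make \<open>h\<close> symmetric about every
  multiple of \<open>c\<close>, so reflection carries each cell of length \<open>c\<close> onto its
  predecessor.\<close>

lemma integral_ivl_fold:
  fixes h :: "real \<Rightarrow> real"
  assumes h: "integrable (ivl 0 (real m * c)) h" "periodic (2 * c) h" "\<And>x. h (- x) = h x" and c: "0 \<le> c"
  shows "integral\<^sup>L (ivl 0 (real m * c)) h = real m * integral\<^sup>L (ivl 0 c) h"
proof -
  have piece: "integral\<^sup>L (ivl (real i * c) (real (Suc i) * c)) h = integral\<^sup>L (ivl 0 c) h" for i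
  proof (induction i)
    case (Suc i)
    have e: "real (Suc i) * (2 * c) - real (Suc i) * c = real (Suc i) * c"
      "real (Suc i) * (2 * c) - real i * c = real (Suc (Suc i)) * c" by (simp_all add: algebra_simps)
    have "h (real (Suc i) * (2 * c) - x) = h x" for x
      using periodic_int[OF h(2), of "- x" "int (Suc i)"] h(3)[of x] by (simp add: algebra_simps)
    then have "integral\<^sup>L (ivl (real (Suc i) * c) (real (Suc (Suc i)) * c)) h =
        integral\<^sup>L (ivl (real i * c) (real (Suc i) * c)) h"
      using integral_ivl_reflect(1)[of "real (Suc i) * (2 * c)" "real (Suc i) * c" "real i * c" h]
      unfolding e by simp
    with Suc show ?case by simp
  qed simp
  have "integral\<^sup>L (ivl 0 (real k * c)) h = real k * integral\<^sup>L (ivl 0 c) h" if "k \<le> m" for k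
    using that
  proof (induction k)
    case 0
    then show ?case by (simp add: integral_ivl set_lebesgue_integral_def)
  next
    case (Suc k)
    have "real (Suc k) * c \<le> real m * c" "0 \<le> real (Suc k) * c" using Suc.prems c by (auto intro: mult_right_mono)
    then have "integrable (ivl 0 (real (Suc k) * c)) h"
      using integral_ivl_split(1)[OF h(1), of "real (Suc k) * c"] by blast
    moreover have "0 \<le> real k * c" "real k * c \<le> real (Suc k) * c" using c by (auto intro: mult_right_mono)
    ultimately have "integral\<^sup>L (ivl 0 (real (Suc k) * c)) h =
       integral\<^sup>L (ivl 0 (real k * c)) h + integral\<^sup>L (ivl (real k * c) (real (Suc k) * c)) h"
      by (rule integral_ivl_split(3))
    then show ?case using Suc piece[of k] by (simp add: algebra_simps)
  qed
  then show ?thesis by blast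
qed

lemma periodic_nat_multiple: "periodic T f \<Longrightarrow> periodic (real m * T) f"
  using periodic_int[of T f _ "int m"] by (simp add: periodic_def)

context n_fold
begin

text \<open>The integrand \<open>q x * sin (n j x)\<close> is even with period
  \<open>2 pi / n\<close>. The half circle therefore folds into \<open>n\<close> copies of (0, pi /
  n), and the rescaling by \<open>n\<close> cancels the factor \<open>n\<close>.\<close>

lemma fourier_coeff_multiple:
  assumes q: "integrable (ivl (- pi) pi) q" "odd_fun q" "periodic (2 * pi / real n) q"
  shows "fourier_coeff q (int (n * j)) = - (\<i> / pi) * sine_coeff (\<lambda>y. q (y / real n)) j"
    and "fourier_coeff q (- int (n * j)) = (\<i> / pi) * sine_coeff (\<lambda>y. q (y / real n)) j"
proof -
  have n: "0 < real n" using n_ge_3 by simp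
  let ?h = "\<lambda>x. q x * sin (real (n * j) * x)"
  have i: "integrable (ivl (- pi) pi) ?h"
    by (rule integrable_mult_bounded[OF q(1), where B = 1]; simp)
  then have i': "integrable (ivl 0 (real n * (pi / real n))) ?h"
    using integral_ivl_split(2)[OF i, of 0] n by simp
  have "(LINT x|ivl 0 pi. ?h x) = real n * (LINT x|ivl 0 (pi / real n). ?h x)"
  proof -
    have "periodic (2 * (pi / real n)) ?h"
      unfolding periodic_def
    proof
      fix x
      have "real (n * j) * (x + 2 * (pi / real n)) = real (n * j) * x + real j * (2 * pi)"
        using n by (simp add: field_simps)
      then have "sin (real (n * j) * (x + 2 * (pi / real n))) = sin (real (n * j) * x)"
        using sin.plus_of_nat[of "real (n * j) * x" j] by (simp only: of_real_eq_id id_apply)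
      then show "?h (x + 2 * (pi / real n)) = ?h x" using q(3) by (simp add: periodic_def)
    qed
    from integral_ivl_fold[OF i' this] q(2) n show ?thesis by (simp add: odd_fun_def)
  qed
  also have "\<dots> = sine_coeff (\<lambda>y. q (y / real n)) j"
    using integral_ivl_affine(1)[of "1 / real n" 0 0 pi ?h] n unfolding sine_coeff_def by simp
  finally have *: "(LINT x|ivl 0 pi. ?h x) = sine_coeff (\<lambda>y. q (y / real n)) j" .
  then show "fourier_coeff q (int (n * j)) = - (\<i> / pi) * sine_coeff (\<lambda>y. q (y / real n)) j"
    by (simp add: fourier_coeff_odd[OF q(1,2)])
  have "(LINT x|ivl 0 pi. q x * sin (of_int (- int (n * j)) * x)) = - (LINT x|ivl 0 pi. ?h x)"
    by simp
  then show "fourier_coeff q (- int (n * j)) = (\<i> / pi) * sine_coeff (\<lambda>y. q (y / real n)) j"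
    unfolding fourier_coeff_odd[OF q(1,2)] * by simp
qed

text \<open>Translation by one period multiplies the integral by
  \<open>cis (- k * 2 pi / n)\<close>, which differs from 1 unless \<open>n\<close> divides
  \<open>k\<close>.\<close>

lemma fourier_coeff_eq_0:
  assumes q: "integrable (ivl (- pi) pi) q" "periodic (2 * pi / real n) q" and k: "\<not> int n dvd k"
  shows "fourier_coeff q k = 0"
proof -
  have n: "0 < real n" using n_ge_3 by simp
  let ?T = "2 * pi / real n"
  let ?h = "\<lambda>x. complex_of_real (q x) * cis (- (of_int k * x))"
  have c: "cis \<in> borel_measurable borel"
    by (intro borel_measurable_continuous_onI continuous_intros)
  have [measurable]: "(\<lambda>x. cis (- (of_int k * x))) \<in> borel_measurable (ivl (- pi) pi)"
    by (rule measurable_compose[OF _ c]) measurable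
  have i: "integrable (ivl (- pi) pi) ?h"
  proof (rule Bochner_Integration.integrable_bound[OF q(1)])
    show "?h \<in> borel_measurable (ivl (- pi) pi)" using q(1)[THEN borel_measurable_integrable] by measurable
  qed (simp add: norm_mult)
  have per: "periodic (2 * pi) ?h"
  proof -
    have "periodic (2 * pi) q" using periodic_nat_multiple[OF q(2), of n] n by simp
    moreover have "cis (- (of_int k * (x + 2 * pi))) = cis (- (of_int k * x))" for x
    proof -
      have "cis (- (of_int k * (x + 2 * pi))) = cis (- (of_int k * x)) * cis (2 * pi * of_int (- k))"
        by (simp add: cis_mult algebra_simps)
      also have "cis (2 * pi * of_int (- k)) = 1" by (rule cis_multiple_2pi) simp
      finally show ?thesis by simp
    qed
    ultimately show ?thesis by (simp add: periodic_def)
  qed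
  have "real n \<ge> 1" using n_ge_3 by simp
  then have "?T \<le> 2 * pi" using n by (simp add: field_simps)
  then have "(LINT x|ivl (- pi) pi. ?h (x + ?T)) = integral\<^sup>L (ivl (- pi) pi) ?h"
    using n by (intro integral_ivl_shift_periodic i per) auto
  moreover have "?h (x + ?T) = cis (- (of_int k * ?T)) * ?h x" for x
    using q(2) by (simp add: periodic_def cis_mult distrib_left add_ac)
  ultimately have "cis (- (of_int k * ?T)) * integral\<^sup>L (ivl (- pi) pi) ?h = integral\<^sup>L (ivl (- pi) pi) ?h"
    by simp
  moreover have "cis (- (of_int k * ?T)) \<noteq> 1"
  proof
    assume "cis (- (of_int k * ?T)) = 1"
    then have "cos (of_int k * ?T) = 1" by (simp add: complex_eq_iff)
    then obtain m :: int where "of_int k * ?T = of_int m * 2 * pi" using cos_one_2pi_int by auto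
    then have "of_int k = (of_int (m * int n) :: real)" using n by (simp add: field_simps)
    then have "k = m * int n" by (simp only: of_int_eq_iff)
    with k show False by simp
  qed
  ultimately have "integral\<^sup>L (ivl (- pi) pi) ?h = 0" by simp
  then show ?thesis by (simp add: fourier_coeff_def integral_ivl_Ioc)
qed

lemma S_symbol_multiple: "S_symbol (int (n * j)) = - (pi / 2) * mu j" "S_symbol (- int (n * j)) = - (pi / 2) * mu j"
  by (simp_all add: mu_def S_symbol_def)

lemma L2_half_rescale:
  assumes q: "q \<in> borel_measurable borel" "integrable (ivl (- pi) pi) (\<lambda>x. (q x)\<^sup>2)"
  shows "L2_half (\<lambda>y. q (y / real n))"
proof -
  have n: "1 \<le> real n" using n_ge_3 by simp
  have "pi / real n \<le> pi" "0 \<le> pi / real n" using n by (simp_all add: field_simps)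
  then have "integrable (ivl 0 (pi / real n)) (\<lambda>x. (q x)\<^sup>2)"
    using integral_ivl_split(2)[OF q(2), of 0] integral_ivl_split(1)[of 0 pi _ "pi / real n"] by simp
  then have "integrable (ivl 0 pi) (\<lambda>y. (q (y / real n))\<^sup>2)"
    using integral_ivl_affine(2)[of "1 / real n" 0 0 pi "\<lambda>x. (q x)\<^sup>2"] n by simp
  moreover have "(\<lambda>y. q (y / real n)) \<in> borel_measurable (ivl 0 pi)"
    by (rule measurable_compose[OF _ q(1)]) measurable
  ultimately show ?thesis by (simp add: L2_half_def)
qed

text \<open>Only the frequencies \<open>n j\<close> and \<open>- n j\<close> contribute. Their terms
  combine to \<open>\<i> / 2 * (cis \<theta> - cis (- \<theta>)) = - sin \<theta>\<close> with
  \<open>\<theta> = j n x\<close>, which is the origin of the minus sign.\<close>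

lemma S_op_exact:
  assumes q: "q \<in> borel_measurable borel" "integrable (ivl (- pi) pi) q" "integrable (ivl (- pi) pi) (\<lambda>x. (q x)\<^sup>2)"
    and sym: "odd_fun q" "periodic (2 * pi / real n) q"
  shows "S_op q x = - K (\<lambda>y. q (y / real n)) (real n * x)"
proof -
  define \<phi> where "\<phi> y = q (y / real n)" for y
  have \<phi>: "L2_half \<phi>" unfolding \<phi>_def[abs_def] by (rule L2_half_rescale[OF q(1,3)])
  define t where "t k = complex_of_real (S_symbol k) * fourier_coeff q k * cis (of_int k * x)" for k
  have n: "0 < n" using n_ge_3 by simp
  have tp: "t (int (n * j)) = (\<i> / 2) * (mu j * sine_coeff \<phi> j) * cis (real j * (real n * x))"
    and tm: "t (- int (n * j)) = - (\<i> / 2) * (mu j * sine_coeff \<phi> j) * cis (- (real j * (real n * x)))" for j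
    unfolding t_def S_symbol_multiple fourier_coeff_multiple[OF q(2) sym, folded \<phi>_def]
    by (simp_all add: mult_ac)
  \<comment> \<open>Both index families start at \<open>j = 1\<close> so that they are disjoint; the
    frequency 0 left out by both is killed by \<open>S_symbol\<close>.\<close>
  have t0: "t k = 0" if "k \<notin> (\<lambda>j. int (n * j)) ` {1..} \<union> (\<lambda>j. - int (n * j)) ` {1..}" for k
  proof (cases "int n dvd k")
    case False
    then show ?thesis unfolding t_def by (simp add: fourier_coeff_eq_0[OF q(2) sym(2)])
  next
    case True
    then obtain m where m: "k = int n * m" by auto
    have "m = 0"
    proof (rule ccontr)
      assume "m \<noteq> 0"
      then consider "m > 0" | "m < 0" by linarith
      then show False
      proof cases
        case 1
        then have "k = int (n * nat m)" "nat m \<in> {1..}" using m by auto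
        then show False using that by blast
      next
        case 2
        then have "k = - int (n * nat (- m))" "nat (- m) \<in> {1..}" using m by auto
        then show False using that by blast
      qed
    qed
    then show ?thesis using m by (simp add: t_def S_symbol_def)
  qed
  have norm_t: "norm (t (int (n * j))) = \<bar>mu j * sine_coeff \<phi> j\<bar> / 2"
    "norm (t (- int (n * j))) = \<bar>mu j * sine_coeff \<phi> j\<bar> / 2" for j
    unfolding tp tm by (simp_all add: norm_mult abs_mult)
  have part: "((\<lambda>j. t (f j)) has_sum (\<Sum>j. t (f j))) {1..}"
    if f: "f = (\<lambda>j. int (n * j)) \<or> f = (\<lambda>j. - int (n * j))" for f
  proof -
    have "norm (t (f j)) = \<bar>mu j * sine_coeff \<phi> j\<bar> / 2" for j using f norm_t by blast
    then have s: "summable (\<lambda>j. norm (t (f j)))" by (simp only: summable_divide summable_K[OF \<phi>])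
    then have "((\<lambda>j. t (f j)) has_sum (\<Sum>j. t (f j))) UNIV"
      by (intro norm_summable_imp_has_sum summable_sums[OF summable_norm_cancel[OF s]])
    moreover have "t (f 0) = 0" using f by (auto simp: t_def S_symbol_def)
    then have "t (f j) = 0" if "j \<notin> {1..}" for j using that by (cases "j = 0") auto
    ultimately show ?thesis by (subst has_sum_cong_neutral[of UNIV "{1..}"]) auto
  qed
  have inj: "inj_on (\<lambda>j. int (n * j)) {1..}" "inj_on (\<lambda>j. - int (n * j)) {1..}"
    using n by (auto simp: inj_on_def)
  have "(t has_sum ((\<Sum>j. t (int (n * j))) + (\<Sum>j. t (- int (n * j)))))
      ((\<lambda>j. int (n * j)) ` {1..} \<union> (\<lambda>j. - int (n * j)) ` {1..})"
  proof (rule has_sum_Un_disjoint)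
    show "(t has_sum (\<Sum>j. t (int (n * j)))) ((\<lambda>j. int (n * j)) ` {1..})"
      using part[of "\<lambda>j. int (n * j)"] by (subst has_sum_reindex[OF inj(1)]) (simp add: comp_def)
    show "(t has_sum (\<Sum>j. t (- int (n * j)))) ((\<lambda>j. - int (n * j)) ` {1..})"
      using part[of "\<lambda>j. - int (n * j)"] by (subst has_sum_reindex[OF inj(2)]) (simp add: comp_def)
    have "int (n * i) \<noteq> - int (n * j)" if "1 \<le> i" for i j
    proof -
      have "0 < int (n * i)" using n that by simp
      moreover have "- int (n * j) \<le> 0" by simp
      ultimately show ?thesis by linarith
    qed
    then show "(\<lambda>j. int (n * j)) ` {1..} \<inter> (\<lambda>j. - int (n * j)) ` {1..} = {}" by auto
  qed
  then have "(t has_sum ((\<Sum>j. t (int (n * j))) + (\<Sum>j. t (- int (n * j))))) UNIV"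
    by (rule has_sum_cong_neutral[THEN iffD1, rotated -1]) (use t0 in auto)
  then have "S_op q x = Re ((\<Sum>j. t (int (n * j))) + (\<Sum>j. t (- int (n * j))))"
    unfolding S_op_def t_def[symmetric] by (simp add: infsumI)
  also have "(\<Sum>j. t (int (n * j))) + (\<Sum>j. t (- int (n * j))) = (\<Sum>j. t (int (n * j)) + t (- int (n * j)))"
  proof (rule suminf_add)
    show "summable (\<lambda>j. t (int (n * j)))" "summable (\<lambda>j. t (- int (n * j)))"
      by (rule summable_norm_cancel, simp only: norm_t summable_divide summable_K[OF \<phi>])+
  qed
  also have "(\<lambda>j. t (int (n * j)) + t (- int (n * j))) =
      (\<lambda>j. complex_of_real (- (mu j * sine_coeff \<phi> j * sin (real j * (real n * x)))))"
    unfolding tp tm by (intro ext) (simp add: complex_eq_iff)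
  also have "(\<Sum>j. complex_of_real (- (mu j * sine_coeff \<phi> j * sin (real j * (real n * x))))) =
      complex_of_real (- K \<phi> (real n * x))"
    using sums_of_real[OF sums_minus[OF sums_K[OF \<phi>, of "real n * x"]], where 'a = complex]
    by (simp add: sums_iff)
  finally show ?thesis by (simp add: \<phi>_def[abs_def])
qed

text \<open>\<open>S_op\<close> depends on the Fourier coefficients alone, hence not on the
  representative, and the exactly symmetric one may be substituted.\<close>

lemma S_op_symmetric:
  assumes "L2_circle q" "AE_odd q" "AE_periodic (2 * pi / real n) q"
  shows "L2_half (\<lambda>y. q (y / real n))" "S_op q x = - K (\<lambda>y. q (y / real n)) (real n * x)"
proof -
  have m: "q \<in> borel_measurable borel" using assms by (simp add: L2_circle_def)
  note i = L2_circle_integrable[OF assms(1)]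
  show L: "L2_half (\<lambda>y. q (y / real n))" by (rule L2_half_rescale[OF m i(2)])
  obtain p where p: "p \<in> borel_measurable borel" "AE x in lborel. q x = p x" "odd_fun p" "periodic (2 * pi / real n) p"
    by (rule exact_symmetric_representative[OF m assms(2,3)])
  note pm = borel_measurable_ivlI[OF p(1)] and qm = borel_measurable_ivlI[OF m]
  note [measurable] = pm qm
  have ae: "AE x in ivl (- pi) pi. q x = p x" by (rule AE_ivl_of_lborel[OF p(2)])
  have pi: "integrable (ivl (- pi) pi) p"
    using i(1) by (rule integrable_cong_AE[THEN iffD1, rotated -1]) (use ae in auto)
  have pi2: "integrable (ivl (- pi) pi) (\<lambda>x. (p x)\<^sup>2)"
    using i(2) by (rule integrable_cong_AE[THEN iffD1, rotated -1]) (use ae in auto)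
  have "S_op q x = S_op p x"
    unfolding S_op_def fourier_coeff_cong_AE[OF m p(1,2)] ..
  also have "\<dots> = - K (\<lambda>y. p (y / real n)) (real n * x)" by (rule S_op_exact[OF p(1) pi pi2 p(3,4)])
  also have "K (\<lambda>y. p (y / real n)) (real n * x) = K (\<lambda>y. q (y / real n)) (real n * x)"
  proof (rule K_cong_AE)
    have "AE y in lborel. q (0 + 1 / real n * y) = p (0 + 1 / real n * y)"
      using n_ge_3 m p(1) by (intro AE_borel_affine p(2)) auto
    then show "AE y in ivl 0 pi. p (y / real n) = q (y / real n)" by (intro AE_ivl_of_lborel) (simp add: eq_commute)
    show "(\<lambda>y. p (y / real n)) \<in> borel_measurable (ivl 0 pi)" using L2_half_rescale[OF p(1) pi2] by (rule L2_half_measurable)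
    show "(\<lambda>y. q (y / real n)) \<in> borel_measurable (ivl 0 pi)" using L by (rule L2_half_measurable)
  qed
  finally show "S_op q x = - K (\<lambda>y. q (y / real n)) (real n * x)" .
qed

end

section \<open>The solution on the circle\<close>

text \<open>The function is \<open>|t| powr (3 / 2)\<close>. Negative arguments reduce to positive
  ones by parity, and at 0 the difference quotient is \<open>sqrt h\<close>, which tends to 0.
  Composed with \<open>g\<close>, it is differentiable also at the zeros of \<open>g\<close>, where
  \<open>sqrt (g x)\<close> itself need not be.\<close>

lemma sqrt_mult_self_has_derivative:
  "((\<lambda>t. sqrt t * t) has_real_derivative (3 / 2 * sqrt t)) (at t)"
proof -
  have pos: "((\<lambda>t. sqrt t * t) has_real_derivative (3 / 2 * sqrt t)) (at t)" if "t > 0" for t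
  proof -
    have "((\<lambda>t. sqrt t * t) has_real_derivative (inverse (sqrt t) / 2 * t + 1 * sqrt t)) (at t)"
      using that by (intro DERIV_mult DERIV_real_sqrt DERIV_ident)
    moreover have "inverse (sqrt t) * t = sqrt t" using that by (simp add: inverse_eq_divide real_div_sqrt)
    ultimately show ?thesis by simp
  qed
  consider "t > 0" | "t < 0" | "t = 0" by linarith
  then show ?thesis
  proof cases
    case 2
    have "((\<lambda>t. sqrt (- t) * (- t)) has_real_derivative (3 / 2 * sqrt (- t)) * (- 1)) (at t)"
      using pos[of "- t"] 2 by (intro DERIV_chain2[where f = "\<lambda>t. sqrt t * t" and g = uminus]) (auto intro!: derivative_eq_intros)
    then show ?thesis by (simp add: real_sqrt_minus)
  next
    case 3
    have "((\<lambda>h. sqrt h) \<longlongrightarrow> sqrt 0) (at 0)" by (intro tendsto_intros)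
    then have "((\<lambda>h. sqrt h) \<longlongrightarrow> 0) (at (0::real))" by simp
    moreover have "\<forall>\<^sub>F h in at (0::real). sqrt h = (sqrt (0 + h) * (0 + h) - sqrt 0 * 0) / h"
      by (auto simp: eventually_at_filter)
    ultimately have "((\<lambda>h. (sqrt (0 + h) * (0 + h) - sqrt 0 * 0) / h) \<longlongrightarrow> 0) (at 0)"
      by (rule Lim_transform_eventually)
    then show ?thesis unfolding DERIV_def 3 by simp
  qed (rule pos)
qed

lemma smooth_real:
  fixes \<psi> :: "real \<Rightarrow> real"
  assumes "smooth \<psi>"
  shows "(\<psi> has_real_derivative deriv \<psi> x) (at x)" "continuous_on UNIV (deriv \<psi>)"
proof -
  have "C_k (Suc 0) \<psi>" using assms unfolding smooth_def by blast
  then have d: "\<psi> differentiable (at x)" and c: "continuous_on UNIV (\<lambda>x. frechet_derivative \<psi> (at x) 1)" for x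
    by auto
  have D: "(\<psi> has_real_derivative deriv \<psi> x) (at x)" for x
    using d[of x] by (metis DERIV_imp_deriv real_differentiableE)
  then show "(\<psi> has_real_derivative deriv \<psi> x) (at x)" .
  have "frechet_derivative \<psi> (at x) = (\<lambda>h. deriv \<psi> x * h)" for x
    using frechet_derivative_at[OF D[of x, unfolded has_field_derivative_def]] by simp
  then show "continuous_on UNIV (deriv \<psi>)" using c by simp
qed

lemma integration_by_parts_periodic:
  fixes p p' \<psi> \<psi>' :: "real \<Rightarrow> real"
  assumes p: "\<And>x. (p has_real_derivative p' x) (at x)" "continuous_on UNIV p'" "periodic (2 * pi) p"
    and \<psi>: "\<And>x. (\<psi> has_real_derivative \<psi>' x) (at x)" "continuous_on UNIV \<psi>'" "periodic (2 * pi) \<psi>"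
  shows "(LINT x:circle|lborel. p x * \<psi>' x) = - (LINT x:circle|lborel. p' x * \<psi> x)"
proof -
  have cp: "continuous_on UNIV p" and c\<psi>: "continuous_on UNIV \<psi>"
    using p(1) \<psi>(1) by (auto simp: continuous_on_eq_continuous_at intro: DERIV_isCont)
  note cont = continuous_on_subset[OF cp] continuous_on_subset[OF c\<psi>] continuous_on_subset[OF p(2)] continuous_on_subset[OF \<psi>(2)]
  have i: "integrable (ivl (- pi) pi) (\<lambda>x. p x * \<psi>' x)" "integrable (ivl (- pi) pi) (\<lambda>x. p' x * \<psi> x)"
    by (intro integrable_ivl_continuous continuous_intros cont subset_UNIV)+
  have "(LINT x|ivl (- pi) pi. p x * \<psi>' x + p' x * \<psi> x) = p pi * \<psi> pi - p (- pi) * \<psi> (- pi)"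
    by (rule FTC_ivl[where F = "\<lambda>x. p x * \<psi> x"])
       (auto intro!: continuous_intros cont derivative_eq_intros p \<psi>)
  also have "\<dots> = 0" using p(3)[unfolded periodic_def, rule_format, of "- pi"]
      \<psi>(3)[unfolded periodic_def, rule_format, of "- pi"] by simp
  finally show ?thesis using i by (simp add: integral_ivl_Ioc[symmetric])
qed

lemma L2_circle_continuous:
  assumes "continuous_on UNIV f" "periodic (2 * pi) f"
  shows "L2_circle f"
proof -
  have "integrable (ivl (- pi) pi) (\<lambda>x. (f x)\<^sup>2)"
    using assms by (intro integrable_ivl_continuous continuous_intros) (auto intro: continuous_on_subset)
  then show ?thesis using assms
    by (simp add: L2_circle_def integrable_ivl_Ioc borel_measurable_continuous_onI)
qed

lemma periodic_derivative:
  assumes "\<And>x. (g has_real_derivative g' x) (at x)" "periodic T g"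
  shows "periodic T g'"
  unfolding periodic_def
proof
  fix x
  have "((\<lambda>y. g (y + T)) has_real_derivative g' (x + T)) (at x)"
    using assms(1)[of "x + T"] by (simp add: DERIV_shift)
  then have "(g has_real_derivative g' (x + T)) (at x)" using assms(2) by (simp add: periodic_def)
  then show "g' (x + T) = g' x" using assms(1) by (rule DERIV_unique)
qed

text \<open>Here and below \<^const>\<open>sqrt\<close> is the odd extension of the square root to the whole line, so that
  \<open>t \<surd>t\<close> is \<open>\<bar>t\<bar>\<^bsup>3/2\<^esup>\<close>. With \<open>S f = - g\<close> and \<open>f = \<surd>g\<close> the equation is the identity
  \<open>(g \<surd>g)' = 3/2 \<surd>g g'\<close>.\<close>

lemma weak_solution_sqrt:
  assumes g: "\<And>x. (g has_real_derivative g' x) (at x)" "continuous_on UNIV g'" "periodic (2 * pi) g"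
    and S: "\<And>x. S_op (\<lambda>x. sqrt (g x)) x = - g x"
  shows "weak_solution 2 (\<lambda>x. sqrt (g x))"
proof -
  have cg: "continuous_on UNIV g" using g(1) by (auto simp: continuous_on_eq_continuous_at intro: DERIV_isCont)
  have cf: "continuous_on UNIV (\<lambda>x. sqrt (g x))" by (intro continuous_intros cg)
  have pf: "periodic (2 * pi) (\<lambda>x. sqrt (g x))" and pg': "periodic (2 * pi) g'"
    using g(3) periodic_derivative[OF g(1,3)] by (auto simp: periodic_def)
  let ?p = "\<lambda>x. sqrt (g x) * g x" and ?p' = "\<lambda>x. 3 / 2 * sqrt (g x) * g' x"
  have p: "(?p has_real_derivative ?p' x) (at x)" for x
    by (rule DERIV_chain2[OF sqrt_mult_self_has_derivative g(1)])
  have cp': "continuous_on UNIV ?p'" by (intro continuous_intros cf g)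
  have pp: "periodic (2 * pi) ?p" using g(3) by (simp add: periodic_def)
  have "weak_deriv_circle (S_op (\<lambda>x. sqrt (g x))) (\<lambda>x. - g' x)"
    unfolding weak_deriv_circle_def
  proof (intro conjI ballI)
    show "L2_circle (\<lambda>x. - g' x)"
      using pg' by (intro L2_circle_continuous continuous_intros g) (simp add: periodic_def)
    fix \<psi> assume "\<psi> \<in> smooth_circle"
    then have \<psi>: "periodic (2 * pi) \<psi>" "smooth \<psi>" by (auto simp: smooth_circle_def)
    have "(LINT x:circle|lborel. - g x * deriv \<psi> x) = - (LINT x:circle|lborel. - g' x * \<psi> x)"
      using g by (intro integration_by_parts_periodic smooth_real \<psi>)
        (auto intro!: derivative_eq_intros continuous_intros simp: periodic_def)
    then show "(LINT x:circle|lborel. S_op (\<lambda>x. sqrt (g x)) x * deriv \<psi> x) = - (LINT x:circle|lborel. - g' x * \<psi> x)"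
      by (simp only: S)
  qed
  moreover have "- 2 * (LINT x:circle|lborel. sqrt (g x) * S_op (\<lambda>x. sqrt (g x)) x * deriv \<psi> x) =
          (2 + 1) * (LINT x:circle|lborel. sqrt (g x) * - g' x * \<psi> x)" if "\<psi> \<in> smooth_circle" for \<psi>
  proof -
    have \<psi>: "periodic (2 * pi) \<psi>" "smooth \<psi>" using that by (auto simp: smooth_circle_def)
    have "(LINT x:circle|lborel. ?p x * deriv \<psi> x) = - (LINT x:circle|lborel. ?p' x * \<psi> x)"
      by (intro integration_by_parts_periodic smooth_real \<psi> p cp' pp)
    also have "(LINT x:circle|lborel. ?p' x * \<psi> x) = 3 / 2 * (LINT x:circle|lborel. sqrt (g x) * g' x * \<psi> x)"
      by (subst set_integral_mult_right[symmetric]) (simp only: mult.assoc)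
    finally have "(LINT x:circle|lborel. ?p x * deriv \<psi> x) = - (3 / 2 * (LINT x:circle|lborel. sqrt (g x) * g' x * \<psi> x))" .
    moreover have "(LINT x:circle|lborel. sqrt (g x) * S_op (\<lambda>x. sqrt (g x)) x * deriv \<psi> x) =
       - (LINT x:circle|lborel. ?p x * deriv \<psi> x)"
      unfolding S set_lebesgue_integral_def by (simp flip: integral_minus)
    moreover have "(LINT x:circle|lborel. sqrt (g x) * - g' x * \<psi> x) = - (LINT x:circle|lborel. sqrt (g x) * g' x * \<psi> x)"
      unfolding set_lebesgue_integral_def by (simp flip: integral_minus)
    ultimately show ?thesis by simp
  qed
  moreover have "L2_circle (\<lambda>x. sqrt (g x))" by (intro L2_circle_continuous cf pf)
  ultimately show ?thesis unfolding weak_solution_def by blast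
qed

lemma holder_sqrt:
  assumes g: "\<And>x. (g has_real_derivative g' x) (at x)" "\<And>x. \<bar>g' x\<bar> \<le> B" "periodic (2 * pi) g"
  shows "holder_circle (1 / 2) (\<lambda>x. sqrt (g x))"
  unfolding holder_circle_def
proof (intro conjI exI allI)
  show "periodic (2 * pi) (\<lambda>x. sqrt (g x))" using g(3) by (simp add: periodic_def)
  fix x y
  have "norm (g x - g y) \<le> B * norm (x - y)"
    using g by (intro field_differentiable_bound[of UNIV g g']) auto
  then have "sqrt (2 * \<bar>g x - g y\<bar>) \<le> sqrt (2 * (B * \<bar>x - y\<bar>))" by simp
  also have "\<dots> = sqrt (2 * B) * \<bar>x - y\<bar> powr (1 / 2)" by (simp add: real_sqrt_mult powr_half_sqrt)
  finally show "\<bar>sqrt (g x) - sqrt (g y)\<bar> \<le> sqrt (2 * B) * \<bar>x - y\<bar> powr (1 / 2)"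
    using abs_sqrt_diff_le[of "g x" "g y"] by linarith
qed

context n_fold
begin

text \<open>\<open>K \<phi>\<close> is odd and \<open>2 pi\<close>-periodic, so the odd
  \<open>sqrt\<close> extends the fixed point to the line with all symmetries. On the rescaled half
  period the extension is \<phi>, and \<open>K\<close> sees nothing else. The coefficient at
  \<open>n\<close> is a nonzero multiple of the integral of \<open>\<phi> y * sin y\<close>, which
  is positive.\<close>

lemma solution_on_circle:
  assumes "fixed_point \<phi>"
  defines "g \<equiv> \<lambda>x. K \<phi> (real n * x)"
  defines "f \<equiv> \<lambda>x. sqrt (g x)"
  shows "odd_fun f" "periodic (2 * pi / real n) f" "holder_circle (1 / 2) f" "fourier_coeff f (int n) \<noteq> 0"
    "\<And>x. S_op f x = - g x" "weak_solution 2 f"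
    "\<exists>g'. continuous_on UNIV g' \<and> (\<forall>x. (g has_real_derivative g' x) (at x))"
proof -
  have n: "0 < real n" using n_ge_3 by simp
  have \<phi>: "L2_half \<phi>" "\<And>y. 0 < y \<Longrightarrow> y < pi \<Longrightarrow> 0 < \<phi> y \<and> (\<phi> y)\<^sup>2 = K \<phi> y"
    using assms by (auto simp: fixed_point_def)
  obtain G' B where G': "continuous_on UNIV G'" "\<And>a. (K \<phi> has_real_derivative G' a) (at a)" "\<And>a. \<bar>G' a\<bar> \<le> B"
    using fixed_point_C1[OF assms(1)] by blast
  define g' where "g' x = real n * G' (real n * x)" for x
  have g': "(g has_real_derivative g' x) (at x)" for x
    unfolding g_def g'_def by (rule DERIV_cmult_Id[THEN DERIV_chain2[OF G'(2)], THEN DERIV_cong]) simp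
  have cg': "continuous_on UNIV g'"
    unfolding g'_def by (intro continuous_intros continuous_on_compose2[OF G'(1)]) auto
  have Bg': "\<bar>g' x\<bar> \<le> real n * B" for x
    unfolding g'_def using G'(3) by (simp add: abs_mult mult_left_mono)
  then show "\<exists>g'. continuous_on UNIV g' \<and> (\<forall>x. (g has_real_derivative g' x) (at x))" using g' cg' by blast
  have pg: "periodic (2 * pi / real n) g"
    unfolding periodic_def g_def using n K_periodic[of \<phi>] by (simp add: distrib_left)
  then have pg2: "periodic (2 * pi) g" using periodic_nat_multiple[of _ g n] n by fastforce
  show odd: "odd_fun f" unfolding odd_fun_def f_def g_def using K_odd[OF \<phi>(1)] by (simp add: real_sqrt_minus)
  show per: "periodic (2 * pi / real n) f" using pg by (simp add: periodic_def f_def)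
  show "holder_circle (1 / 2) f" unfolding f_def by (rule holder_sqrt[OF g' Bg' pg2])
  have cont: "continuous_on UNIV f"
    unfolding f_def using g' by (intro continuous_intros) (auto simp: continuous_on_eq_continuous_at intro: DERIV_isCont)
  have "L2_circle f" using cont pg2 by (intro L2_circle_continuous) (auto simp: periodic_def f_def)
  note i = L2_circle_integrable[OF this]
  have m: "f \<in> borel_measurable borel" using cont by (rule borel_measurable_continuous_onI)
  have eq: "f (y / real n) = \<phi> y" if "0 < y" "y < pi" for y
    using \<phi>(2)[OF that] n unfolding f_def g_def by (simp add: real_sqrt_unique)
  show S: "S_op f x = - g x" for x
    unfolding S_op_exact[OF m i odd per] g_def using K_cong[of "\<lambda>y. f (y / real n)" \<phi>, OF eq] by simp
  show "weak_solution 2 f" using S unfolding f_def by (intro weak_solution_sqrt[OF g' cg' pg2])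
  have "sine_coeff (\<lambda>y. f (y / real n)) 1 = sine_coeff \<phi> 1"
    unfolding sine_coeff_def by (rule Bochner_Integration.integral_cong) (auto simp: eq)
  moreover have "0 < sine_coeff \<phi> 1" using \<phi> by (intro sine_coeff_1_pos) auto
  ultimately show "fourier_coeff f (int n) \<noteq> 0"
    using fourier_coeff_multiple(1)[OF i(1) odd per, of 1] by simp
qed

end

section \<open>Integration by parts in the plane\<close>

lemma smooth_derivative:
  fixes \<psi> :: "'a::euclidean_space \<Rightarrow> real"
  assumes "smooth \<psi>"
  shows "(\<psi> has_derivative frechet_derivative \<psi> (at p)) (at p)"
    "smooth (\<lambda>p. frechet_derivative \<psi> (at p) v)"
    "continuous_on UNIV (\<lambda>p. frechet_derivative \<psi> (at p) v)"
proof -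
  have *: "C_k (Suc k) \<psi>" for k using assms unfolding smooth_def by blast
  then have "\<psi> differentiable (at p)" by simp
  then show "(\<psi> has_derivative frechet_derivative \<psi> (at p)) (at p)" by (simp add: frechet_derivative_works)
  show "smooth (\<lambda>p. frechet_derivative \<psi> (at p) v)" using * unfolding smooth_def by simp
  show "continuous_on UNIV (\<lambda>p. frechet_derivative \<psi> (at p) v)" using *[of 0] by simp
qed

lemma smooth_continuous: "smooth \<psi> \<Longrightarrow> continuous_on UNIV \<psi>"
  unfolding smooth_def by (metis C_k.simps(1))

lemma derivative_vanishes_outside:
  fixes \<psi> :: "'a::euclidean_space \<Rightarrow> real"
  assumes "closed S" "\<And>p. p \<notin> S \<Longrightarrow> \<psi> p = 0" "p \<notin> S"
  shows "frechet_derivative \<psi> (at p) v = 0"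
proof -
  have "(\<psi> has_derivative (\<lambda>_. 0)) (at p)"
    by (rule has_derivative_transform_within_open[of "\<lambda>_. 0" _ _ _ "- S"])
       (use assms in \<open>auto simp: open_Compl\<close>)
  then show ?thesis using frechet_derivative_at by metis
qed

lemma integrable_compact_support:
  fixes F :: "plane \<Rightarrow> 'b::{banach, second_countable_topology}"
  assumes "continuous_on UNIV F" "compact S" "\<And>p. p \<notin> S \<Longrightarrow> F p = 0"
  shows "integrable lborel F"
proof -
  have "integrable lborel (\<lambda>p. indicator S p *\<^sub>R F p)"
    using assms by (intro borel_integrable_compact) (auto intro: continuous_on_subset)
  moreover have "(\<lambda>p. indicator S p *\<^sub>R F p) = F" using assms(3) by (auto simp: indicator_def)
  ultimately show ?thesis by simp
qed

lemma integral_real_derivative_compact_support: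
  fixes F F' :: "real \<Rightarrow> real"
  assumes "\<And>x. (F has_real_derivative F' x) (at x)" "continuous_on UNIV F'"
    "\<And>x. R < \<bar>x\<bar> \<Longrightarrow> F x = 0 \<and> F' x = 0" "0 \<le> R"
  shows "(LINT x|lborel. F' x) = 0"
proof -
  have "(LINT x|lborel. F' x) = (LINT x:{- (R + 1)<..<R + 1}|lborel. F' x)"
    unfolding set_lebesgue_integral_def
  proof (rule Bochner_Integration.integral_cong[OF refl])
    fix x
    show "F' x = indicat_real {- (R + 1)<..<R + 1} x *\<^sub>R F' x"
      using assms(3)[of x] by (cases "R < \<bar>x\<bar>") (auto simp: indicator_def)
  qed
  also have "\<dots> = F (R + 1) - F (- (R + 1))"
    unfolding integral_ivl[symmetric] using assms by (intro FTC_ivl) (auto intro: continuous_on_subset)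
  also have "\<dots> = 0" using assms(3)[of "R + 1"] assms(3)[of "- (R + 1)"] assms(4) by simp
  finally show ?thesis .
qed

lemma partial_derivatives:
  fixes F :: "plane \<Rightarrow> real"
  assumes "(F has_derivative (\<lambda>h. D \<bullet> h)) (at (x, y))"
  shows "((\<lambda>x. F (x, y)) has_real_derivative fst D) (at x)"
    "((\<lambda>y. F (x, y)) has_real_derivative snd D) (at y)"
proof -
  have "((\<lambda>x. F (x, y)) has_derivative (\<lambda>h. D \<bullet> (h, 0))) (at x)"
    by (rule has_derivative_compose[where f = "\<lambda>x. (x, y)" and g = F and g' = "\<lambda>h. D \<bullet> h"])
       (auto intro!: derivative_eq_intros assms)
  then show "((\<lambda>x. F (x, y)) has_real_derivative fst D) (at x)"
    by (simp add: has_field_derivative_def inner_prod_def)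
  have "((\<lambda>y. F (x, y)) has_derivative (\<lambda>h. D \<bullet> (0, h))) (at y)"
    by (rule has_derivative_compose[where f = "\<lambda>y. (x, y)" and g = F and g' = "\<lambda>h. D \<bullet> h"])
       (auto intro!: derivative_eq_intros assms)
  then show "((\<lambda>y. F (x, y)) has_real_derivative snd D) (at y)"
    by (simp add: has_field_derivative_def inner_prod_def)
qed

text \<open>Fubini reduces each integral to one-dimensional integrals of derivatives of compactly
  supported functions.\<close>

lemma integral_partial_derivative_eq_0:
  fixes F :: "plane \<Rightarrow> real"
  assumes F: "\<And>p. (F has_derivative (\<lambda>h. DF p \<bullet> h)) (at p)" and DF: "continuous_on UNIV DF"
    and S: "compact S" "\<And>p. p \<notin> S \<Longrightarrow> F p = 0 \<and> DF p = 0"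
  shows "(LINT p|lborel. fst (DF p)) = 0" "(LINT p|lborel. snd (DF p)) = 0"
proof -
  obtain R where R: "0 < R" "\<And>p. p \<in> S \<Longrightarrow> norm p \<le> R"
    using compact_imp_bounded[OF S(1)] by (auto simp: bounded_pos)
  have out: "F (x, y) = 0 \<and> DF (x, y) = 0" if "R < \<bar>x\<bar> \<or> R < \<bar>y\<bar>" for x y
  proof -
    have "\<bar>x\<bar> \<le> norm (x, y)" "\<bar>y\<bar> \<le> norm (x, y)"
      using norm_fst_le[of x y] norm_snd_le[of y x] by auto
    then have "(x, y) \<notin> S" using that R(2)[of "(x, y)"] by auto
    then show ?thesis by (rule S(2))
  qed
  have c: "continuous_on UNIV (\<lambda>p. fst (DF p))" "continuous_on UNIV (\<lambda>p. snd (DF p))"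
    by (intro continuous_intros DF)+
  have int: "integrable lborel (\<lambda>p. fst (DF p))" "integrable lborel (\<lambda>p. snd (DF p))"
    by (rule integrable_compact_support[OF _ S(1)]; use c S in auto)+
  note d1 = partial_derivatives(1)[OF F] and d2 = partial_derivatives(2)[OF F]
  have "(LINT p|lborel. fst (DF p)) = (LINT y|lborel. (LINT x|lborel. fst (DF (x, y))))"
    using lborel_pair.integral_snd[of "\<lambda>x y. fst (DF (x, y))"] int(1) by (simp add: lborel_prod case_prod_unfold)
  also have "(\<lambda>y. LINT x|lborel. fst (DF (x, y))) = (\<lambda>_. 0)"
  proof
    fix y
    show "(LINT x|lborel. fst (DF (x, y))) = 0"
    proof (rule integral_real_derivative_compact_support[where R = R, OF d1])
      show "continuous_on UNIV (\<lambda>x. fst (DF (x, y)))"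
        by (rule continuous_on_compose2[OF c(1)]) (auto intro!: continuous_intros)
    qed (use out R in auto)
  qed
  finally show "(LINT p|lborel. fst (DF p)) = 0" by simp
  have "(LINT p|lborel. snd (DF p)) = (LINT x|lborel. (LINT y|lborel. snd (DF (x, y))))"
    using lborel_pair.integral_fst'[of "\<lambda>p. snd (DF p)"] int(2) by (simp add: lborel_prod)
  also have "(\<lambda>x. LINT y|lborel. snd (DF (x, y))) = (\<lambda>_. 0)"
  proof
    fix x
    show "(LINT y|lborel. snd (DF (x, y))) = 0"
    proof (rule integral_real_derivative_compact_support[where R = R, OF d2])
      show "continuous_on UNIV (\<lambda>y. snd (DF (x, y)))"
        by (rule continuous_on_compose2[OF c(2)]) (auto intro!: continuous_intros)
    qed (use out R in auto)
  qed
  finally show "(LINT p|lborel. snd (DF p)) = 0" by simp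
qed

lemma grad_derivative:
  assumes "smooth \<psi>"
  shows "frechet_derivative \<psi> (at p) h = grad \<psi> p \<bullet> h" "(\<psi> has_derivative (\<lambda>h. grad \<psi> p \<bullet> h)) (at p)"
    "continuous_on UNIV (grad \<psi>)"
proof -
  have l: "linear (frechet_derivative \<psi> (at p))"
    using smooth_derivative(1)[OF assms] by (rule has_derivative_linear)
  have eq: "frechet_derivative \<psi> (at p) h = grad \<psi> p \<bullet> h" for h
  proof -
    have "h = fst h *\<^sub>R (1, 0) + snd h *\<^sub>R (0, 1)" by (cases h) simp
    then have "frechet_derivative \<psi> (at p) h = frechet_derivative \<psi> (at p) (fst h *\<^sub>R (1, 0) + snd h *\<^sub>R (0, 1))" by simp
    also have "\<dots> = grad \<psi> p \<bullet> h"
      by (simp only: linear_add[OF l] linear_cmul[OF l]) (simp add: grad_def inner_prod_def mult.commute)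
    finally show ?thesis .
  qed
  then show "frechet_derivative \<psi> (at p) h = grad \<psi> p \<bullet> h" .
  have "frechet_derivative \<psi> (at p) = (\<lambda>h. grad \<psi> p \<bullet> h)" using eq by blast
  then show "(\<psi> has_derivative (\<lambda>h. grad \<psi> p \<bullet> h)) (at p)" using smooth_derivative(1)[OF assms, of p] by simp
  show "continuous_on UNIV (grad \<psi>)"
    unfolding grad_def[abs_def] by (intro continuous_on_Pair smooth_derivative(3) assms)
qed

lemma integration_by_parts_plane:
  fixes W :: "plane \<Rightarrow> real"
  assumes W: "\<And>p. (W has_derivative (\<lambda>h. DW p \<bullet> h)) (at p)" and DW: "continuous_on UNIV DW"
    and \<psi>: "smooth \<psi>" and S: "compact S" "\<And>p. p \<notin> S \<Longrightarrow> \<psi> p = 0"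
  shows "integrable lborel (\<lambda>p. W p *\<^sub>R grad \<psi> p)" "integrable lborel (\<lambda>p. \<psi> p *\<^sub>R DW p)"
    "(LINT p|lborel. W p *\<^sub>R grad \<psi> p) = - (LINT p|lborel. \<psi> p *\<^sub>R DW p)"
proof -
  have cW: "continuous_on UNIV W"
    using W by (auto simp: continuous_on_eq_continuous_at intro: has_derivative_continuous)
  have c\<psi>: "continuous_on UNIV \<psi>" by (rule smooth_continuous[OF \<psi>])
  have g0: "grad \<psi> p = 0" if "p \<notin> S" for p
    unfolding grad_def using derivative_vanishes_outside[OF compact_imp_closed[OF S(1)] S(2) that]
    by (simp add: zero_prod_def)
  show i1: "integrable lborel (\<lambda>p. W p *\<^sub>R grad \<psi> p)"
    by (rule integrable_compact_support[OF _ S(1)])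
       (auto intro!: continuous_intros cW grad_derivative(3)[OF \<psi>] simp: g0)
  show i2: "integrable lborel (\<lambda>p. \<psi> p *\<^sub>R DW p)"
    by (rule integrable_compact_support[OF _ S(1)]) (auto intro!: continuous_intros c\<psi> DW simp: S(2))
  have d: "((\<lambda>p. W p * \<psi> p) has_derivative (\<lambda>h. (W p *\<^sub>R grad \<psi> p + \<psi> p *\<^sub>R DW p) \<bullet> h)) (at p)" for p
    using has_derivative_mult[OF W[of p] grad_derivative(2)[OF \<psi>, of p]]
    by (simp add: inner_add_left mult.commute)
  have c: "continuous_on UNIV (\<lambda>p. W p *\<^sub>R grad \<psi> p + \<psi> p *\<^sub>R DW p)"
    by (intro continuous_intros cW c\<psi> DW grad_derivative(3) \<psi>)
  have z: "W p * \<psi> p = 0 \<and> W p *\<^sub>R grad \<psi> p + \<psi> p *\<^sub>R DW p = 0" if "p \<notin> S" for p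
    using S(2)[OF that] g0[OF that] by simp
  note 0 = integral_partial_derivative_eq_0[OF d c S(1) z]
  have i: "integrable lborel (\<lambda>p. W p *\<^sub>R grad \<psi> p + \<psi> p *\<^sub>R DW p)" using i1 i2 by simp
  have "(LINT p|lborel. W p *\<^sub>R grad \<psi> p + \<psi> p *\<^sub>R DW p) = 0"
    using integral_bounded_linear[OF bounded_linear_fst i] integral_bounded_linear[OF bounded_linear_snd i] 0
    by (simp add: prod_eq_iff)
  then show "(LINT p|lborel. W p *\<^sub>R grad \<psi> p) = - (LINT p|lborel. \<psi> p *\<^sub>R DW p)"
    using i1 i2 by (simp add: eq_neg_iff_add_eq_0)
qed

text \<open>The second difference over a square of side \<open>h\<close>, evaluated by the mean
  value theorem in both orders, gives two points near \<open>p\<close> at which the two mixed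
  derivatives agree. Continuity merges them as \<open>h\<close> tends to 0.\<close>

lemma mixed_partials:
  fixes \<psi> :: "plane \<Rightarrow> real"
  assumes "smooth \<psi>"
  shows "snd (grad (\<lambda>p. fst (grad \<psi> p)) p) = fst (grad (\<lambda>p. snd (grad \<psi> p)) p)"
proof -
  let ?X = "\<lambda>p. fst (grad \<psi> p)" and ?Y = "\<lambda>p. snd (grad \<psi> p)"
  have sX: "smooth ?X" and sY: "smooth ?Y"
    unfolding grad_def fst_conv snd_conv by (rule smooth_derivative(2)[OF assms])+
  note dx = partial_derivatives(1)[OF grad_derivative(2)] and dy = partial_derivatives(2)[OF grad_derivative(2)]
  define A where "A q = snd (grad ?X q)" for q
  define B where "B q = fst (grad ?Y q)" for q
  have cA: "continuous_on UNIV A" and cB: "continuous_on UNIV B"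
    unfolding A_def[abs_def] B_def[abs_def] by (intro continuous_intros grad_derivative(3) sX sY)+
  obtain x y where p: "p = (x, y)" by force
  have ex: "\<exists>q q'. dist q p \<le> 2 * h \<and> dist q' p \<le> 2 * h \<and> A q = B q'" if h: "0 < h" for h
  proof -
    have near: "dist (s, t) p \<le> 2 * h" if "x < s" "s < x + h" "y < t" "t < y + h" for s t
    proof -
      have "dist (s, t) (x, y) \<le> \<bar>s - x\<bar> + \<bar>t - y\<bar>"
        unfolding dist_Pair_Pair dist_real_def by (rule order_trans[OF sqrt_sum_squares_le_sum_abs]) auto
      then show ?thesis using that by (simp add: p)
    qed
    define D where "D = \<psi> (x + h, y + h) - \<psi> (x + h, y) - (\<psi> (x, y + h) - \<psi> (x, y))"
    have "\<exists>s>x. s < x + h \<and> (\<psi> (x + h, y + h) - \<psi> (x + h, y)) - (\<psi> (x, y + h) - \<psi> (x, y)) =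
        (x + h - x) * (?X (s, y + h) - ?X (s, y))"
      using h by (intro MVT2) (auto intro!: DERIV_diff dx assms)
    then obtain s where s: "x < s" "s < x + h" "D = h * (?X (s, y + h) - ?X (s, y))" by (auto simp: D_def)
    have "\<exists>t>y. t < y + h \<and> ?X (s, y + h) - ?X (s, y) = (y + h - y) * A (s, t)"
      unfolding A_def using h by (intro MVT2) (auto intro!: dy sX)
    then obtain t where t: "y < t" "t < y + h" "D = h * (h * A (s, t))" using s by auto
    have "\<exists>t>y. t < y + h \<and> (\<psi> (x + h, y + h) - \<psi> (x, y + h)) - (\<psi> (x + h, y) - \<psi> (x, y)) =
        (y + h - y) * (?Y (x + h, t) - ?Y (x, t))"
      using h by (intro MVT2) (auto intro!: DERIV_diff dy assms)
    then obtain t' where t': "y < t'" "t' < y + h" "D = h * (?Y (x + h, t') - ?Y (x, t'))" by (auto simp: D_def)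
    have "\<exists>s>x. s < x + h \<and> ?Y (x + h, t') - ?Y (x, t') = (x + h - x) * B (s, t')"
      unfolding B_def using h by (intro MVT2) (auto intro!: dx sY)
    then obtain s' where s': "x < s'" "s' < x + h" "D = h * (h * B (s', t'))" using t' by auto
    have "A (s, t) = B (s', t')" using t(3) s'(3) h by simp
    then show ?thesis using near[OF s(1,2) t(1,2)] near[OF s'(1,2) t'(1,2)] by blast
  qed
  have "\<exists>q q'. dist q p \<le> 2 * (1 / real (Suc k)) \<and> dist q' p \<le> 2 * (1 / real (Suc k)) \<and> A q = B q'" for k
    by (rule ex) simp
  then obtain q q' where q: "\<And>k. dist (q k) p \<le> 2 * (1 / real (Suc k))" "\<And>k. dist (q' k) p \<le> 2 * (1 / real (Suc k))"
    "\<And>k. A (q k) = B (q' k)" by metis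
  have "(\<lambda>k. 2 * (1 / real (Suc k))) \<longlonglongrightarrow> 2 * 0"
    using LIMSEQ_inverse_real_of_nat by (intro tendsto_mult tendsto_const) (simp only: inverse_eq_divide)
  then have z: "(\<lambda>k. 2 * (1 / real (Suc k))) \<longlonglongrightarrow> 0" by simp
  have "q \<longlonglongrightarrow> p" and "q' \<longlonglongrightarrow> p"
    unfolding tendsto_dist_iff[of q] tendsto_dist_iff[of q']
    by (rule tendsto_sandwich[OF _ _ tendsto_const z]; use q in auto)+
  moreover have "isCont A p" "isCont B p" using cA cB continuous_on_eq_continuous_at[OF open_UNIV] by blast+
  ultimately have "(\<lambda>k. A (q k)) \<longlonglongrightarrow> A p" and "(\<lambda>k. B (q' k)) \<longlonglongrightarrow> B p"
    by (blast intro: isCont_tendsto_compose)+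
  then have "A p = B p" unfolding q(3) by (rule LIMSEQ_unique)
  then show ?thesis by (simp only: A_def B_def)
qed

text \<open>With \<open>\<Theta>\<close> the signed square root of \<open>v = - u\<close>, the flux \<open>\<Theta> \<nabla>\<^sup>\<bottom>u\<close> equals \<open>- \<nabla>\<^sup>\<bottom>(2/3 v \<surd>v)\<close>,
  hence is divergence free.\<close>

lemma sqg_stationary_sqrt:
  fixes v :: "plane \<Rightarrow> real"
  assumes v: "\<And>p. (v has_derivative (\<lambda>h. Dv p \<bullet> h)) (at p)" and Dv: "continuous_on UNIV Dv"
  shows "sqg_stationary (\<lambda>p. sqrt (v p)) (\<lambda>p. - v p)"
proof -
  have cv: "continuous_on UNIV v"
    using v by (auto simp: continuous_on_eq_continuous_at intro: has_derivative_continuous)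
  have loc: "locally_integrable F" if "continuous_on UNIV F" for F :: "plane \<Rightarrow> 'b::{banach, second_countable_topology}"
    unfolding locally_integrable_def set_integrable_def
    using that by (auto intro!: borel_integrable_compact intro: continuous_on_subset)
  have supp: "smooth \<psi>" "compact (closure {p. \<psi> p \<noteq> 0})" "p \<notin> closure {p. \<psi> p \<noteq> 0} \<Longrightarrow> \<psi> p = 0"
    if "\<psi> \<in> test_functions" for \<psi> p
    using that closure_subset[of "{p. \<psi> p \<noteq> 0}"] by (auto simp: test_functions_def)
  have du: "((\<lambda>p. - v p) has_derivative (\<lambda>h. - Dv p \<bullet> h)) (at p)" for p
    using has_derivative_minus[OF v[of p]] by simp
  have cdu: "continuous_on UNIV (\<lambda>p. - Dv p)" by (intro continuous_intros Dv)
  have "weak_grad (\<lambda>p. - v p) (\<lambda>p. - Dv p)"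
    unfolding weak_grad_def
    by (intro conjI ballI loc continuous_intros cv Dv integration_by_parts_plane(3)[OF du cdu supp(1,2,3)])
  moreover have cp: "continuous_on UNIV (\<lambda>p. sqrt (v p) *\<^sub>R perp (- Dv p))"
    unfolding perp_def by (intro continuous_intros cv Dv)
  moreover have "(LINT p|lborel. (sqrt (v p) *\<^sub>R perp (- Dv p)) \<bullet> grad \<psi> p) = 0" if "\<psi> \<in> test_functions" for \<psi>
  proof -
    note s = supp[OF that]
    let ?X = "\<lambda>p. fst (grad \<psi> p)" and ?Y = "\<lambda>p. snd (grad \<psi> p)"
    have sX: "smooth ?X" and sY: "smooth ?Y"
      unfolding grad_def fst_conv snd_conv by (rule smooth_derivative(2)[OF s(1)])+
    have g0: "grad \<psi> p = 0" if "p \<notin> closure {p. \<psi> p \<noteq> 0}" for p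
      unfolding grad_def using derivative_vanishes_outside[OF closed_closure s(3) that]
      by (simp add: zero_prod_def)
    define W where "W p = 2 / 3 * (sqrt (v p) * v p)" for p
    define DW where "DW p = sqrt (v p) *\<^sub>R Dv p" for p
    have W: "(W has_derivative (\<lambda>h. DW p \<bullet> h)) (at p)" for p
    proof -
      have "((\<lambda>p. sqrt (v p) * v p) has_derivative (\<lambda>h. 3 / 2 * sqrt (v p) * (Dv p \<bullet> h))) (at p)"
        using has_derivative_compose[OF v sqrt_mult_self_has_derivative[unfolded has_field_derivative_def]] .
      from has_derivative_mult_right[OF this, of "2 / 3"] show ?thesis unfolding W_def DW_def by simp
    qed
    have cDW: "continuous_on UNIV DW" unfolding DW_def[abs_def] by (intro continuous_intros cv Dv)
    have zX: "?X p = 0" and zY: "?Y p = 0" if "p \<notin> closure {p. \<psi> p \<noteq> 0}" for p using g0[OF that] by simp_all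
    \<comment> \<open>Integration by parts of \<open>W\<close> against the partial derivatives of
      \<psi>: the two resulting integrals carry the two mixed second derivatives of \<psi> with
      opposite signs, so they cancel.\<close>
    note pX = integration_by_parts_plane[OF W cDW sX s(2) zX] and pY = integration_by_parts_plane[OF W cDW sY s(2) zY]
    have "(LINT p|lborel. ?X p * snd (DW p)) = - (LINT p|lborel. W p * snd (grad ?X p))"
      using arg_cong[OF pX(3), of snd] integral_bounded_linear[OF bounded_linear_snd pX(1)]
        integral_bounded_linear[OF bounded_linear_snd pX(2)] by simp
    moreover have "(LINT p|lborel. ?Y p * fst (DW p)) = - (LINT p|lborel. W p * fst (grad ?Y p))"
      using arg_cong[OF pY(3), of fst] integral_bounded_linear[OF bounded_linear_fst pY(1)]
        integral_bounded_linear[OF bounded_linear_fst pY(2)] by simp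
    moreover have "integrable lborel (\<lambda>p. ?X p * snd (DW p))" "integrable lborel (\<lambda>p. ?Y p * fst (DW p))"
      using integrable_bounded_linear[OF bounded_linear_snd pX(2)]
        integrable_bounded_linear[OF bounded_linear_fst pY(2)] by simp_all
    moreover have "(sqrt (v p) *\<^sub>R perp (- Dv p)) \<bullet> grad \<psi> p = ?X p * snd (DW p) - ?Y p * fst (DW p)" for p
      unfolding perp_def DW_def inner_prod_def by (simp add: algebra_simps)
    ultimately show ?thesis using mixed_partials[OF s(1)] by simp
  qed
  ultimately show ?thesis unfolding sqg_stationary_def using loc[OF cp] by blast
qed

section \<open>Polar coordinates\<close>

definition plane_complex :: "plane \<Rightarrow> complex" where
  "plane_complex p = Complex (fst p) (snd p)"

lemma bounded_linear_plane_complex: "bounded_linear plane_complex"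
proof -
  have "plane_complex = (\<lambda>p. of_real (fst p) + \<i> * of_real (snd p))"
    by (auto simp: plane_complex_def complex_eq_iff)
  moreover have "bounded_linear (\<lambda>p::plane. of_real (fst p) + \<i> * of_real (snd p))"
    by (intro bounded_linear_add bounded_linear_compose[OF bounded_linear_mult_right]
        bounded_linear_compose[OF bounded_linear_of_real] bounded_linear_fst bounded_linear_snd)
  ultimately show ?thesis by simp
qed

lemma plane_complex_eq_0_iff: "plane_complex p = 0 \<longleftrightarrow> p = 0"
  by (cases p) (simp add: plane_complex_def complex_eq_iff zero_prod_def)

lemma norm_plane_complex: "norm (plane_complex p) = norm p"
  by (cases p) (simp add: plane_complex_def cmod_def norm_Pair)

lemma periodic_Arg_mult:
  assumes "periodic (2 * pi) k" "w \<noteq> 0" "z \<noteq> 0"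
  shows "k (Arg (w * z)) = k (Arg w + Arg z)"
proof -
  have "cis (Arg (w * z)) = cis (Arg w + Arg z)"
    using assms by (simp add: cis_Arg cis_mult[symmetric] sgn_mult)
  then have "sin (Arg (w * z)) = sin (Arg w + Arg z)" "cos (Arg (w * z)) = cos (Arg w + Arg z)"
    by (metis cis.simps)+
  then obtain m :: int where "Arg (w * z) = Arg w + Arg z + 2 * pi * of_int m"
    using sin_cos_eq_iff[of "Arg (w * z)" "Arg w + Arg z"] by blast
  then show ?thesis using periodic_int[OF assms(1), of "Arg w + Arg z" m] by (simp only: mult.commute)
qed

text \<open>The branch cut of the argument is avoided by rotating the base point to the positive real axis.\<close>

lemma periodic_polar_angle_local:
  assumes "periodic (2 * pi) k" "p0 \<noteq> 0"
  shows "\<forall>\<^sub>F p in nhds p0. k (polar_angle p) = k (polar_angle p0 + Im (Ln (plane_complex p / plane_complex p0)))"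
proof -
  have "k (polar_angle p) = k (polar_angle p0 + Im (Ln (plane_complex p / plane_complex p0)))" if "p \<noteq> 0" for p
  proof -
    have nz: "plane_complex p \<noteq> 0" "plane_complex p0 \<noteq> 0" using that assms by (auto simp: plane_complex_eq_0_iff)
    have "k (Arg (plane_complex p0 * (plane_complex p / plane_complex p0))) =
        k (Arg (plane_complex p0) + Arg (plane_complex p / plane_complex p0))"
      using nz by (intro periodic_Arg_mult assms) auto
    then show ?thesis using nz by (simp add: polar_angle_def plane_complex_def[symmetric] Arg_eq_Im_Ln)
  qed
  moreover have "\<forall>\<^sub>F p in nhds p0. p \<in> - {0}" using assms(2) by (intro eventually_nhds_in_open) auto
  ultimately show ?thesis by (auto elim: eventually_mono)
qed

text \<open>At \<open>p0\<close> the quotient is 1, where \<open>Ln\<close> has derivative 1, and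
  the imaginary part of \<open>h / p0\<close> is the component of \<open>h\<close> along
  \<open>perp p0\<close> divided by \<open>(norm p0)^2\<close>.\<close>

lemma angle_has_derivative:
  assumes "p0 \<noteq> 0"
  shows "((\<lambda>p. polar_angle p0 + Im (Ln (plane_complex p / plane_complex p0))) has_derivative
     (\<lambda>h. perp p0 \<bullet> h / (norm p0)\<^sup>2)) (at p0)"
proof -
  let ?z0 = "plane_complex p0"
  have nz: "?z0 \<noteq> 0" using assms by (simp add: plane_complex_eq_0_iff)
  have 1: "((\<lambda>p. plane_complex p / ?z0) has_derivative (\<lambda>h. plane_complex h / ?z0)) (at p0)"
    using bounded_linear_compose[OF bounded_linear_divide bounded_linear_plane_complex]
    by (rule bounded_linear_imp_has_derivative)
  have "(Ln has_field_derivative inverse 1) (at 1)" by (intro has_field_derivative_Ln) simp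
  then have 2: "(Ln has_derivative (\<lambda>h. inverse 1 * h)) (at (?z0 / ?z0))"
    unfolding has_field_derivative_def divide_self[OF nz] .
  have "((\<lambda>p. polar_angle p0 + Im (Ln (plane_complex p / ?z0))) has_derivative
     (\<lambda>h. 0 + Im (inverse 1 * (plane_complex h / ?z0)))) (at p0)"
    by (intro has_derivative_add has_derivative_const has_derivative_Im has_derivative_compose[OF 1 2])
  moreover have "0 + Im (inverse 1 * (plane_complex h / ?z0)) = perp p0 \<bullet> h / (norm p0)\<^sup>2" for h
  proof -
    have "(norm p0)\<^sup>2 = (fst p0)\<^sup>2 + (snd p0)\<^sup>2" by (cases p0) (simp add: norm_Pair)
    then show ?thesis
      by (simp add: Im_divide plane_complex_def perp_def inner_prod_def algebra_simps)
  qed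
  ultimately show ?thesis by simp
qed

lemma isCont_periodic_polar_angle:
  fixes k :: "real \<Rightarrow> real"
  assumes "periodic (2 * pi) k" "continuous_on UNIV k" "p0 \<noteq> 0"
  shows "isCont (\<lambda>p. k (polar_angle p)) p0"
proof -
  let ?\<theta> = "\<lambda>p. polar_angle p0 + Im (Ln (plane_complex p / plane_complex p0))"
  have "isCont ?\<theta> p0" using angle_has_derivative[OF assms(3)] by (rule has_derivative_continuous)
  then have "isCont (\<lambda>p. k (?\<theta> p)) p0"
    by (rule isCont_o2) (use assms(2) in \<open>simp add: continuous_on_eq_continuous_at\<close>)
  then show ?thesis
    using isCont_cong[OF periodic_polar_angle_local[OF assms(1,3)]] by simp
qed

lemma has_derivative_periodic_polar_angle:
  fixes g :: "real \<Rightarrow> real"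
  assumes "periodic (2 * pi) g" "\<And>x. (g has_real_derivative g' x) (at x)" "p0 \<noteq> 0"
  shows "((\<lambda>p. g (polar_angle p)) has_derivative (\<lambda>h. g' (polar_angle p0) * (perp p0 \<bullet> h / (norm p0)\<^sup>2))) (at p0)"
proof -
  let ?\<theta> = "\<lambda>p. polar_angle p0 + Im (Ln (plane_complex p / plane_complex p0))"
  have "?\<theta> p0 = polar_angle p0" using assms(3) by (simp add: plane_complex_eq_0_iff)
  then have "((\<lambda>p. g (?\<theta> p)) has_derivative (\<lambda>h. g' (polar_angle p0) * (perp p0 \<bullet> h / (norm p0)\<^sup>2))) (at p0)"
    using has_derivative_compose[OF angle_has_derivative[OF assms(3)] assms(2)[of "?\<theta> p0", unfolded has_field_derivative_def]]
    by simp
  then show ?thesis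
  proof (rule has_derivative_transform_eventually)
    from periodic_polar_angle_local[OF assms(1,3)]
    have "\<forall>\<^sub>F p in nhds p0. g (?\<theta> p) = g (polar_angle p)" by (rule eventually_mono) (rule sym)
    then show "\<forall>\<^sub>F p in at p0. g (?\<theta> p) = g (polar_angle p)" "g (?\<theta> p0) = g (polar_angle p0)"
      by (simp_all only: eventually_nhds_conv_at)
  qed simp
qed

lemma polar_angle_bounds: "- pi < polar_angle p" "polar_angle p \<le> pi"
  unfolding polar_angle_def using Arg_bounded by auto

lemma bounded_polar_angle:
  fixes k :: "real \<Rightarrow> real"
  assumes "continuous_on UNIV k"
  shows "\<exists>B>0. \<forall>p. \<bar>k (polar_angle p)\<bar> \<le> B"
proof -
  have "compact (k ` {- pi..pi})"
    using assms by (intro compact_continuous_image) (auto intro: continuous_on_subset)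
  then obtain B where "B > 0" "\<And>x. x \<in> {- pi..pi} \<Longrightarrow> \<bar>k x\<bar> \<le> B"
    using compact_imp_bounded[OF \<open>compact (k ` {- pi..pi})\<close>] unfolding bounded_pos by auto
  then show ?thesis using polar_angle_bounds by (intro exI[of _ B]) (auto simp: less_imp_le)
qed

text \<open>\<open>Dv\<close> is the gradient in polar form: radial part \<open>2 r g\<close>,
  angular part \<open>r g'\<close>. At the origin, where the angle has no limit, growth decides:
  \<open>g\<close> and \<open>g'\<close> are bounded along the angle, so the function is
  \<open>O(|p|^2)\<close> and \<open>Dv\<close> is \<open>O(|p|)\<close>.\<close>

lemma radial_square_C1:
  fixes g g' :: "real \<Rightarrow> real"
  assumes per: "periodic (2 * pi) g" and g: "\<And>x. (g has_real_derivative g' x) (at x)" and cg': "continuous_on UNIV g'"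
  defines "Dv \<equiv> \<lambda>p. (2 * g (polar_angle p)) *\<^sub>R p + g' (polar_angle p) *\<^sub>R perp p"
  shows "((\<lambda>p. (norm p)\<^sup>2 * g (polar_angle p)) has_derivative (\<lambda>h. Dv p \<bullet> h)) (at p)"
    "continuous_on UNIV Dv"
proof -
  have cg: "continuous_on UNIV g" using g by (auto simp: continuous_on_eq_continuous_at intro: DERIV_isCont)
  have per': "periodic (2 * pi) g'" by (rule periodic_derivative[OF g per])
  obtain B where B: "0 < B" "\<And>p. \<bar>g (polar_angle p)\<bar> \<le> B" using bounded_polar_angle[OF cg] by blast
  obtain B' where B': "0 < B'" "\<And>p. \<bar>g' (polar_angle p)\<bar> \<le> B'" using bounded_polar_angle[OF cg'] by blast
  have norm_perp: "norm (perp p) = norm p" for p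
    by (cases p) (simp add: perp_def norm_Pair add.commute)
  have Dv0: "Dv 0 = 0" by (simp add: Dv_def perp_def zero_prod_def)
  show "((\<lambda>p. (norm p)\<^sup>2 * g (polar_angle p)) has_derivative (\<lambda>h. Dv p \<bullet> h)) (at p)"
  proof (cases "p = 0")
    case False
    have "((\<lambda>p. (p \<bullet> p) * g (polar_angle p)) has_derivative
       (\<lambda>h. (p \<bullet> p) * (g' (polar_angle p) * (perp p \<bullet> h / (norm p)\<^sup>2)) + (p \<bullet> h + h \<bullet> p) * g (polar_angle p))) (at p)"
      by (intro has_derivative_mult has_derivative_inner has_derivative_ident
          has_derivative_periodic_polar_angle per g False)
    moreover have "(p \<bullet> p) * (g' (polar_angle p) * (perp p \<bullet> h / (norm p)\<^sup>2)) + (p \<bullet> h + h \<bullet> p) * g (polar_angle p) = Dv p \<bullet> h" for h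
      using False by (simp add: Dv_def inner_add_left inner_commute[of h p] dot_square_norm)
    ultimately show ?thesis by (simp add: dot_square_norm)
  next
    case True
    have "((\<lambda>p. (norm p)\<^sup>2 * g (polar_angle p)) has_derivative (\<lambda>h. 0)) (at 0)"
      unfolding has_derivative_at
    proof (intro conjI)
      have "((\<lambda>h::plane. B * norm h) \<longlongrightarrow> B * norm (0::plane)) (at 0)" by (intro tendsto_intros)
      then have "((\<lambda>h::plane. B * norm h) \<longlongrightarrow> 0) (at 0)" by simp
      then show "((\<lambda>h. norm ((norm (0 + h))\<^sup>2 * g (polar_angle (0 + h)) - (norm 0)\<^sup>2 * g (polar_angle 0) - 0) / norm h) \<longlongrightarrow> 0) (at 0)"
      proof (rule Lim_null_comparison[rotated], intro always_eventually allI)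
        fix h :: plane
        show "norm (norm ((norm (0 + h))\<^sup>2 * g (polar_angle (0 + h)) - (norm 0)\<^sup>2 * g (polar_angle 0) - 0) / norm h) \<le> B * norm h"
          using mult_right_mono[OF B(2)[of h], of "norm h"] by (simp add: abs_mult power2_eq_square mult_ac)
      qed
    qed simp
    then show ?thesis using True Dv0 by simp
  qed
  have "isCont Dv p0" for p0
  proof (cases "p0 = 0")
    case False
    have "isCont (\<lambda>p. g (polar_angle p)) p0" "isCont (\<lambda>p. g' (polar_angle p)) p0"
      by (intro isCont_periodic_polar_angle per per' cg cg' False)+
    then show ?thesis unfolding Dv_def perp_def by (intro continuous_intros)
  next
    case True
    have "((\<lambda>p::plane. (2 * B + B') * norm p) \<longlongrightarrow> (2 * B + B') * norm (0::plane)) (at 0)" by (intro tendsto_intros)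
    then have "((\<lambda>p::plane. (2 * B + B') * norm p) \<longlongrightarrow> 0) (at 0)" by simp
    then have "(Dv \<longlongrightarrow> 0) (at 0)"
    proof (rule Lim_null_comparison[rotated], intro always_eventually allI)
      fix p
      have "norm (Dv p) \<le> norm ((2 * g (polar_angle p)) *\<^sub>R p) + norm (g' (polar_angle p) *\<^sub>R perp p)"
        unfolding Dv_def by (rule norm_triangle_ineq)
      also have "\<dots> = 2 * \<bar>g (polar_angle p)\<bar> * norm p + \<bar>g' (polar_angle p)\<bar> * norm p"
        by (simp add: norm_perp abs_mult)
      also have "\<dots> \<le> 2 * B * norm p + B' * norm p"
        using B(2)[of p] B'(2)[of p] by (intro add_mono mult_right_mono) auto
      finally show "norm (Dv p) \<le> (2 * B + B') * norm p" by (simp add: distrib_right)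
    qed
    then show ?thesis using True Dv0 by (simp add: isCont_def)
  qed
  then show "continuous_on UNIV Dv" by (simp add: continuous_on_eq_continuous_at)
qed

text \<open>The degrees match, \<open>sqrt (r^2 * g) = r * sqrt g\<close>, so \<open>Theta\<close>
  is the signed square root of a function that is continuously differentiable on the whole
  plane.\<close>

lemma sqg_stationary_Theta:
  assumes per: "periodic (2 * pi) g" and g: "\<And>x. (g has_real_derivative g' x) (at x)" and cg': "continuous_on UNIV g'"
    and S: "\<And>x. S_op (\<lambda>x. sqrt (g x)) x = - g x"
  shows "sqg_stationary (Theta (\<lambda>x. sqrt (g x))) (neg_inv_Lambda_Theta (\<lambda>x. sqrt (g x)))"
proof -
  have "Theta (\<lambda>x. sqrt (g x)) = (\<lambda>p. sqrt ((norm p)\<^sup>2 * g (polar_angle p)))"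
    by (auto simp: Theta_def real_sqrt_mult)
  moreover have "neg_inv_Lambda_Theta (\<lambda>x. sqrt (g x)) = (\<lambda>p. - ((norm p)\<^sup>2 * g (polar_angle p)))"
    by (auto simp: neg_inv_Lambda_Theta_def S)
  ultimately show ?thesis
    using sqg_stationary_sqrt[OF radial_square_C1[OF per g cg']] by simp
qed

lemma n_fold_symmetric_Theta:
  assumes n: "n > 0" and f: "periodic (2 * pi / real n) f"
  shows "n_fold_symmetric n (Theta f)"
  unfolding n_fold_symmetric_def
proof
  fix p
  let ?a = "2 * pi / real n"
  have f2: "periodic (2 * pi) f" using periodic_nat_multiple[OF f, of n] n by simp
  show "Theta f (rot ?a p) = Theta f p"
  proof (cases "p = 0")
    case True
    then show ?thesis by (simp add: rot_def zero_prod_def)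
  next
    case False
    define r where "r = norm p"
    define x where "x = polar_angle p"
    have r: "0 < r" using False by (simp add: r_def)
    have "plane_complex p = of_real r * cis x"
      using rcis_cmod_Arg[of "plane_complex p"]
      by (simp add: rcis_def r_def x_def norm_plane_complex[symmetric] polar_angle_def plane_complex_def)
    then have p: "p = (r * cos x, r * sin x)"
      by (cases p) (simp add: plane_complex_def complex_eq_iff)
    have "rot ?a p = (r * cos (x + ?a), r * sin (x + ?a))"
      unfolding rot_def p by (simp add: cos_add sin_add algebra_simps)
    then have "Theta f (rot ?a p) = r * f (x + ?a)" using Theta_polar[OF f2 r] by metis
    also have "f (x + ?a) = f x" using f by (simp add: periodic_def)
    also have "r * f x = Theta f p" unfolding p by (rule Theta_polar[OF f2 r, symmetric])
    finally show ?thesis .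
  qed
qed

section \<open>Primitives and weak derivatives\<close>

text \<open>The indicator keeps the domain of integration fixed, so that dominated convergence and
  Fubini apply directly; outside \<open>[- pi, pi]\<close> the function is constant.\<close>

definition primitive :: "(real \<Rightarrow> real) \<Rightarrow> real \<Rightarrow> real" where
  "primitive h x = (LINT t|ivl (- pi) pi. indicator {..x} t * h t)"

lemma integral_ivl_restrict:
  fixes f :: "real \<Rightarrow> real"
  assumes "\<And>x. x \<noteq> a \<Longrightarrow> x \<noteq> b \<Longrightarrow> (c < x \<and> x < d \<and> x \<in> A) \<longleftrightarrow> (a < x \<and> x < b)"
  shows "(LINT x|ivl c d. indicator A x * f x) = (LINT x|ivl a b. f x)"
  unfolding integral_ivl set_lebesgue_integral_def
  by (rule integral_discrete_difference[of "{a, b}"]) (use assms in \<open>auto simp: indicator_def\<close>)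

lemma integrable_indicator_mult:
  fixes h :: "real \<Rightarrow> real"
  assumes "integrable (ivl a b) h" "A \<in> sets borel"
  shows "integrable (ivl a b) (\<lambda>t. indicator A t * h t)"
proof -
  have [measurable]: "indicat_real A \<in> borel_measurable (ivl a b)"
    by (rule borel_measurable_ivlI) (use assms in auto)
  show ?thesis
    using integrable_mult_bounded[OF assms(1), of "indicat_real A" 1] by (simp add: mult.commute)
qed

lemma primitive_diff:
  assumes h: "integrable (ivl (- pi) pi) h" and xy: "- pi \<le> x" "x \<le> y" "y \<le> pi"
  shows "primitive h y - primitive h x = integral\<^sup>L (ivl x y) h"
proof -
  have "primitive h y - primitive h x = (LINT t|ivl (- pi) pi. indicator {..y} t * h t - indicator {..x} t * h t)"
    unfolding primitive_def
    by (rule Bochner_Integration.integral_diff[symmetric]; rule integrable_indicator_mult[OF h]) auto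
  also have "\<dots> = (LINT t|ivl (- pi) pi. indicator {x<..y} t * h t)"
    by (rule Bochner_Integration.integral_cong) (use xy in \<open>auto simp: indicator_def\<close>)
  also have "\<dots> = integral\<^sup>L (ivl x y) h" by (rule integral_ivl_restrict) (use xy in auto)
  finally show ?thesis .
qed

lemma primitive_minus_pi: "primitive h (- pi) = 0"
proof -
  have "primitive h (- pi) = (LINT t|ivl (- pi) pi. 0)"
    unfolding primitive_def by (rule Bochner_Integration.integral_cong) auto
  then show ?thesis by simp
qed

lemma primitive_pi: "primitive h pi = integral\<^sup>L (ivl (- pi) pi) h"
  unfolding primitive_def by (rule Bochner_Integration.integral_cong) auto

text \<open>The indicators converge at every \<open>t\<close> except \<open>t = a\<close>, and
  \<open>|h|\<close> dominates.\<close>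

lemma primitive_continuous:
  assumes h: "integrable (ivl (- pi) pi) h"
  shows "continuous_on UNIV (primitive h)"
  unfolding continuous_on_sequentially comp_def
proof (intro ballI allI impI)
  fix X :: "nat \<Rightarrow> real" and a assume "(\<forall>n. X n \<in> UNIV) \<and> X \<longlonglongrightarrow> a"
  then have lim: "X \<longlonglongrightarrow> a" by simp
  have m: "(\<lambda>t. indicator {..y} t * h t) \<in> borel_measurable (ivl (- pi) pi)" for y :: real
    by (rule borel_measurable_integrable[OF integrable_indicator_mult[OF h]]) auto
  show "(\<lambda>i. primitive h (X i)) \<longlonglongrightarrow> primitive h a"
    unfolding primitive_def
  proof (rule integral_dominated_convergence[where w = "\<lambda>t. \<bar>h t\<bar>", OF m m])
    show "integrable (ivl (- pi) pi) (\<lambda>t. \<bar>h t\<bar>)" using h by simp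
    have "AE t in lborel. t \<noteq> a" by (rule AE_lborel_singleton)
    then have "AE t in ivl (- pi) pi. t \<noteq> a" by (rule AE_ivl_of_lborel)
    then show "AE t in ivl (- pi) pi. (\<lambda>i. indicator {..X i} t * h t) \<longlonglongrightarrow> indicator {..a} t * h t"
    proof eventually_elim
      fix t assume "t \<noteq> a"
      then consider "t < a" | "a < t" by linarith
      then have "\<forall>\<^sub>F i in sequentially. indicat_real {..X i} t = indicator {..a} t"
      proof cases
        case 1
        from order_tendstoD(1)[OF lim this] show ?thesis by eventually_elim (use 1 in auto)
      next
        case 2
        from order_tendstoD(2)[OF lim this] show ?thesis by eventually_elim (use 2 in auto)
      qed
      then have "(\<lambda>i. indicat_real {..X i} t) \<longlonglongrightarrow> indicator {..a} t" by (rule tendsto_eventually)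
      then show "(\<lambda>i. indicator {..X i} t * h t) \<longlonglongrightarrow> indicator {..a} t * h t" by (intro tendsto_mult tendsto_const)
    qed
    show "AE t in ivl (- pi) pi. norm (indicator {..X i} t * h t) \<le> \<bar>h t\<bar>" for i
      by (rule AE_I2) (auto simp: indicator_def)
  qed
qed

text \<open>Fubini on the triangle \<open>t <= x\<close>: integrating \<open>\<psi>'\<close> over
  \<open>[t, pi]\<close> first leaves \<open>\<psi> pi - \<psi> t\<close>. This way \<open>h\<close>
  may be merely integrable and its primitive need not be differentiable everywhere.\<close>

lemma primitive_integration_by_parts:
  fixes h \<psi> \<psi>' :: "real \<Rightarrow> real"
  assumes h: "integrable (ivl (- pi) pi) h"
    and \<psi>: "\<And>x. (\<psi> has_real_derivative \<psi>' x) (at x)" "continuous_on UNIV \<psi>'"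
  shows "(LINT x|ivl (- pi) pi. primitive h x * \<psi>' x) =
    \<psi> pi * integral\<^sup>L (ivl (- pi) pi) h - (LINT x|ivl (- pi) pi. h x * \<psi> x)"
proof -
  let ?M = "ivl (- pi) pi"
  interpret finite_measure ?M by (rule finite_measure_ivl)
  interpret pair_sigma_finite ?M ?M ..
  note [measurable] = borel_measurable_integrable[OF h] borel_measurable_ivlI[OF borel_measurable_continuous_onI[OF \<psi>(2)]]
  have c\<psi>: "continuous_on UNIV \<psi>" using \<psi>(1) by (auto simp: continuous_on_eq_continuous_at intro: DERIV_isCont)
  have "compact (\<psi>' ` {- pi..pi})"
    using \<psi>(2) by (intro compact_continuous_image) (auto intro: continuous_on_subset)
  from compact_imp_bounded[OF this] obtain B where "0 < B" "\<forall>x\<in>{- pi..pi}. \<bar>\<psi>' x\<bar> \<le> B"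
    unfolding bounded_pos by auto
  then have B: "\<And>x. - pi < x \<Longrightarrow> x < pi \<Longrightarrow> \<bar>\<psi>' x\<bar> \<le> B" "0 < B" by simp_all
  define f where "f x t = (if t \<le> x then h t * \<psi>' x else 0)" for x t
  have fm: "case_prod f \<in> borel_measurable (?M \<Otimes>\<^sub>M ?M)" unfolding f_def[abs_def] by measurable
  have fb: "\<bar>f x t\<bar> \<le> B * \<bar>h t\<bar>" if "- pi < x" "x < pi" for x t
    using B(1)[OF that] B(2) by (simp add: f_def abs_mult mult.commute[of "\<bar>h t\<bar>"] mult_right_mono)
  have int2: "integrable ?M (f x)" if "x \<in> space ?M" for x
  proof (rule Bochner_Integration.integrable_bound)
    show "integrable ?M (\<lambda>t. B * \<bar>h t\<bar>)" using h by simp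
    show "f x \<in> borel_measurable ?M" unfolding f_def[abs_def] by measurable
    show "AE t in ?M. norm (f x t) \<le> norm (B * \<bar>h t\<bar>)"
      using fb[of x] that B(2) by (intro AE_I2) (auto simp: abs_mult)
  qed
  have int: "integrable (?M \<Otimes>\<^sub>M ?M) (case_prod f)"
  proof (rule Fubini_integrable[OF fm])
    show "AE x in ?M. integrable ?M (\<lambda>t. case_prod f (x, t))" using int2 by (intro AE_I2) simp
    show "integrable ?M (\<lambda>x. LINT t|?M. norm (case_prod f (x, t)))"
    proof (rule integrable_ivl_bounded[where B = "LINT t|?M. B * \<bar>h t\<bar>"])
      show "(\<lambda>x. LINT t|?M. norm (case_prod f (x, t))) \<in> borel_measurable ?M"
      proof -
        have "(\<lambda>(x, t). norm (f x t)) \<in> borel_measurable (?M \<Otimes>\<^sub>M ?M)"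
          unfolding f_def[abs_def] by measurable
        from sigma_finite_measure.borel_measurable_lebesgue_integral[OF finite_measure.axioms(1)[OF finite_measure_ivl] this]
        show ?thesis by simp
      qed
      fix x :: real assume x: "- pi < x" "x < pi"
      have "(LINT t|?M. norm (case_prod f (x, t))) \<le> (LINT t|?M. B * \<bar>h t\<bar>)"
        using fb[OF x] h x int2[of x] by (intro integral_mono) (auto intro!: integrable_norm)
      then show "norm (LINT t|?M. norm (case_prod f (x, t))) \<le> (LINT t|?M. B * \<bar>h t\<bar>)" by simp
    qed
  qed
  have "(LINT x|?M. primitive h x * \<psi>' x) = (LINT x|?M. (LINT t|?M. f x t))"
  proof (rule Bochner_Integration.integral_cong[OF refl])
    fix x
    have "(LINT t|?M. f x t) = (LINT t|?M. indicator {..x} t * h t * \<psi>' x)"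
      by (rule Bochner_Integration.integral_cong) (auto simp: f_def)
    then show "primitive h x * \<psi>' x = (LINT t|?M. f x t)" by (simp add: primitive_def)
  qed
  also have "\<dots> = (LINT t|?M. (LINT x|?M. f x t))" by (rule Fubini_integral[OF int, symmetric])
  also have "\<dots> = (LINT t|?M. h t * \<psi> pi - h t * \<psi> t)"
  proof (rule Bochner_Integration.integral_cong[OF refl])
    fix t assume t: "t \<in> space ?M"
    have "(LINT x|?M. f x t) = (LINT x|?M. h t * (indicator {t..} x * \<psi>' x))"
      by (rule Bochner_Integration.integral_cong) (auto simp: f_def)
    also have "\<dots> = h t * (LINT x|?M. indicator {t..} x * \<psi>' x)" by simp
    also have "(LINT x|?M. indicator {t..} x * \<psi>' x) = integral\<^sup>L (ivl t pi) \<psi>'"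
      by (rule integral_ivl_restrict) (use t in auto)
    also have "\<dots> = \<psi> pi - \<psi> t"
      using t \<psi> by (intro FTC_ivl) (auto intro: continuous_on_subset)
    finally show "(LINT x|?M. f x t) = h t * \<psi> pi - h t * \<psi> t" by (simp add: algebra_simps)
  qed
  also have "\<dots> = \<psi> pi * integral\<^sup>L ?M h - (LINT x|?M. h x * \<psi> x)"
  proof -
    have "compact (\<psi> ` {- pi..pi})"
      using c\<psi> by (intro compact_continuous_image) (auto intro: continuous_on_subset)
    from compact_imp_bounded[OF this] obtain C where "\<forall>x\<in>{- pi..pi}. \<bar>\<psi> x\<bar> \<le> C"
      unfolding bounded_pos by auto
    then have "integrable ?M (\<lambda>x. h x * \<psi> x)"
      by (intro integrable_mult_bounded[OF h, where B = C] borel_measurable_ivlI borel_measurable_continuous_onI c\<psi>) auto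
    then show ?thesis using h by simp
  qed
  finally show ?thesis .
qed

text \<open>Integrals over half lines vanish. Half lines are stable under intersection and generate
  the Borel sets, so a Dynkin argument extends this to every Borel set.\<close>

lemma AE_eq_0_of_primitive:
  assumes d: "integrable (ivl (- pi) pi) d" and 0: "\<And>x. - pi \<le> x \<Longrightarrow> x \<le> pi \<Longrightarrow> primitive d x = 0"
  shows "AE x in ivl (- pi) pi. d x = 0"
proof -
  let ?M = "ivl (- pi) pi"
  interpret finite_measure ?M by (rule finite_measure_ivl)
  have sets: "A \<in> sets borel" if "A \<in> sets ?M" for A
    using that unfolding ivl_def sets_restrict_space by auto
  have "Int_stable (range atMost :: real set set)" by (auto simp: Int_stable_def)
  moreover have "range atMost \<subseteq> Pow (UNIV :: real set)" by auto
  ultimately have "(LINT t|?M. indicator A t * d t) = 0" if "A \<in> sigma_sets UNIV (range atMost)" for A :: "real set"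
    using that
  proof (induction rule: sigma_sets_induct_disjoint)
    case (basic A)
    then obtain x :: real where A: "A = {..x}" by auto
    consider "x < - pi" | "- pi \<le> x" "x \<le> pi" | "pi < x" by linarith
    then show ?case
    proof cases
      case 1
      then have "(LINT t|?M. indicator A t * d t) = (LINT t|?M. 0)"
        by (intro Bochner_Integration.integral_cong) (auto simp: A)
      then show ?thesis by simp
    next
      case 2
      then show ?thesis using 0 by (simp add: primitive_def A)
    next
      case 3
      then have "(LINT t|?M. indicator A t * d t) = primitive d pi"
        unfolding primitive_def by (intro Bochner_Integration.integral_cong) (auto simp: A indicator_def)
      then show ?thesis using 0[of pi] by simp
    qed
  next
    case empty
    then show ?case by simp
  next
    case (compl A)
    then have A: "A \<in> sets borel" by (simp add: borel_eq_atMost)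
    have "(LINT t|?M. indicator (UNIV - A) t * d t) = (LINT t|?M. d t - indicator A t * d t)"
      by (intro Bochner_Integration.integral_cong) (auto simp: indicator_def)
    also have "\<dots> = primitive d pi - 0"
      using compl d integrable_indicator_mult[OF d A] by (simp add: primitive_pi)
    finally show ?case using 0[of pi] by simp
  next
    case (union A)
    then have A: "A i \<in> sets borel" for i by (auto simp: borel_eq_atMost)
    define B where "B i = A i \<inter> space ?M" for i
    have B: "B i \<in> sets ?M" for i unfolding B_def ivl_def sets_restrict_space using A by (auto simp: space_restrict_space)
    have "(LINT t|?M. indicator (\<Union>i. A i) t * d t) = (LINT t:(\<Union>i. B i)|?M. d t)"
      unfolding set_lebesgue_integral_def by (rule Bochner_Integration.integral_cong) (auto simp: B_def indicator_def)
    also have "\<dots> = (\<Sum>i. (LINT t:(B i)|?M. d t))"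
    proof (rule lebesgue_integral_countable_add[OF B])
      show "i \<noteq> j \<Longrightarrow> B i \<inter> B j = {}" for i j
        using union(1) by (auto simp: B_def disjoint_family_on_def)
      show "set_integrable ?M (\<Union>i. B i) d"
        unfolding set_integrable_def using B d by (intro integrable_mult_indicator) auto
    qed
    also have "(\<lambda>i. (LINT t:(B i)|?M. d t)) = (\<lambda>i. LINT t|?M. indicator (A i) t * d t)"
      unfolding set_lebesgue_integral_def
      by (intro ext Bochner_Integration.integral_cong) (auto simp: B_def indicator_def)
    finally show ?case using union by simp
  qed
  then have z: "(LINT t|?M. indicator A t * d t) = 0" if "A \<in> sets borel" for A
    using that by (simp add: borel_eq_atMost)
  show ?thesis
  proof (rule density_zero[OF d])
    fix A assume "A \<in> sets ?M"
    then show "set_lebesgue_integral ?M A d = 0"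
      using z[OF sets] by (simp add: set_lebesgue_integral_def)
  qed
qed

section \<open>Completeness of the trigonometric system and weak derivatives\<close>

lemma integral_ivl_const: "(LINT y|ivl (- pi) pi. k) = k * (2 * pi)" for k :: real
  by (subst FTC_ivl[where F = "\<lambda>y. k * y"]) (auto intro!: continuous_intros derivative_eq_intros)

text \<open>The Poisson means of \<open>E\<close> vanish and converge to \<open>E\<close> as \<open>r\<close> tends to \<open>1\<close>; away from \<open>x\<close> the
  difference \<open>E y - E x\<close> is dominated by \<open>1 - cos (y - x)\<close>, which compensates the pole of the kernel.\<close>

lemma trig_orthogonal_imp_zero:
  fixes E :: "real \<Rightarrow> real"
  assumes E: "continuous_on UNIV E"
    and cos: "\<And>j::nat. (LINT y|ivl (- pi) pi. E y * cos (real j * y)) = 0"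
    and sin: "\<And>j::nat. (LINT y|ivl (- pi) pi. E y * sin (real j * y)) = 0"
    and x: "- pi < x" "x < pi"
  shows "E x = 0"
proof (rule ccontr)
  assume "E x \<noteq> 0"
  define e where "e = \<bar>E x\<bar> / 2"
  have e: "0 < e" using \<open>E x \<noteq> 0\<close> by (simp add: e_def)
  let ?M = "ivl (- pi) pi"
  have cE: "continuous_on S E" for S using E by (rule continuous_on_subset) simp
  have iE: "integrable ?M E" by (intro integrable_ivl_continuous cE)
  have "compact (E ` {- pi..pi})" by (intro compact_continuous_image cE) simp
  from compact_imp_bounded[OF this] obtain B where B: "0 < B" "\<And>y. - pi \<le> y \<Longrightarrow> y \<le> pi \<Longrightarrow> \<bar>E y\<bar> \<le> B"
    unfolding bounded_pos by auto
  have "isCont E x" using E by (simp add: continuous_on_eq_continuous_at)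
  then obtain \<delta> where \<delta>: "0 < \<delta>" "\<And>y. \<bar>y - x\<bar> < \<delta> \<Longrightarrow> \<bar>E y - E x\<bar> < e"
    using e unfolding isCont_def LIM_eq by (metis diff_self abs_zero real_norm_def)
  \<comment> \<open>As \<open>x\<close> is interior, \<open>|y - x| < 2 * pi\<close> on the closed
    interval, so on the compact part away from \<open>x\<close> the cosine never returns to
    1.\<close>
  have "\<exists>c>0. \<forall>y\<in>{- pi..pi}. \<delta> \<le> \<bar>y - x\<bar> \<longrightarrow> c \<le> 1 - cos (y - x)"
  proof -
    let ?S = "{- pi..pi} \<inter> {y. \<delta> \<le> \<bar>y - x\<bar>}"
    have "closed {y. \<delta> \<le> \<bar>y - x\<bar>}" by (intro closed_Collect_le continuous_intros)
    then have cS: "compact ?S" by (intro compact_Int_closed) auto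
    show ?thesis
    proof (cases "?S = {}")
      case True
      then show ?thesis by (intro exI[of _ 1]) auto
    next
      case False
      have "continuous_on ?S (\<lambda>y. 1 - cos (y - x))" by (intro continuous_intros)
      from continuous_attains_inf[OF cS False this] obtain z where
        z: "z \<in> ?S" "\<And>y. y \<in> ?S \<Longrightarrow> 1 - cos (z - x) \<le> 1 - cos (y - x)" by blast
      have "cos (z - x) \<noteq> 1"
      proof
        assume "cos (z - x) = 1"
        then obtain m :: int where m: "z - x = of_int m * 2 * pi" using cos_one_2pi_int by blast
        have "\<bar>z - x\<bar> < 2 * pi" using z(1) x by auto
        then have "\<bar>of_int m\<bar> * (2 * pi) < 1 * (2 * pi)" unfolding m by (simp add: abs_mult)
        then have "\<bar>of_int m :: real\<bar> < 1" using mult_less_cancel_right_pos[of "2 * pi"] by simp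
        then have "m = 0" by linarith
        then show False using m z(1) \<delta>(1) by simp
      qed
      then have "0 < 1 - cos (z - x)" using cos_le_one[of "z - x"] by linarith
      then show ?thesis using z(2) by (intro exI[of _ "1 - cos (z - x)"]) auto
    qed
  qed
  then obtain c where c: "0 < c" "\<And>y. - pi \<le> y \<Longrightarrow> y \<le> pi \<Longrightarrow> \<delta> \<le> \<bar>y - x\<bar> \<Longrightarrow> c \<le> 1 - cos (y - x)" by auto
  \<comment> \<open>Chosen so that \<open>C * c = 2 * B\<close>, the bound for the oscillation of
    \<open>E\<close>.\<close>
  define C where "C = 2 * B / c"
  have C: "0 \<le> C" using B c by (simp add: C_def)
  have near: "\<bar>E x - E y\<bar> \<le> e + C * (1 - cos (y - x))" if y: "- pi \<le> y" "y \<le> pi" for y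
  proof (cases "\<bar>y - x\<bar> < \<delta>")
    case True
    have "0 \<le> C * (1 - cos (y - x))" using C by (intro mult_nonneg_nonneg) auto
    then show ?thesis using \<delta>(2)[OF True] by (simp add: abs_minus_commute)
  next
    case False
    have "\<bar>E x - E y\<bar> \<le> 2 * B" using B(2)[OF y] B(2)[of x] x by linarith
    also have "\<dots> = C * c" using c by (simp add: C_def)
    also have "\<dots> \<le> C * (1 - cos (y - x))" using c(2)[OF y] False C by (intro mult_left_mono) auto
    finally show ?thesis using e by linarith
  qed
  have main: "\<bar>E x\<bar> \<le> e + C * (1 - r\<^sup>2) / (2 * r)" if r: "0 < r" "r < 1" for r
  proof -
    let ?P = "\<lambda>y. (1 - r\<^sup>2) / pdenom r (y - x)"
    have r': "0 \<le> r" "r < 1" using r by auto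
    note P = integral_poisson_kernel[OF r', of x]
    have r2: "0 \<le> 1 - r\<^sup>2" using r by (simp add: power_le_one)
    note * = poisson_kernel_series[OF iE r', of x]
    have iEP: "integrable ?M (\<lambda>y. E y * ?P y)" by (rule *(1))
    have "(LINT y|?M. E y * cos (real j * (y - x))) = 0" for j
    proof -
      have "(LINT y|?M. E y * cos (real j * (y - x))) =
          (LINT y|?M. cos (real j * x) * (E y * cos (real j * y)) + sin (real j * x) * (E y * sin (real j * y)))"
        by (intro Bochner_Integration.integral_cong refl) (simp add: algebra_simps cos_diff)
      also have "\<dots> = cos (real j * x) * (LINT y|?M. E y * cos (real j * y)) + sin (real j * x) * (LINT y|?M. E y * sin (real j * y))"
        by (subst Bochner_Integration.integral_add) (auto intro!: integrable_mult_right integrable_ivl_continuous continuous_intros cE)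
      finally show ?thesis using cos sin by simp
    qed
    then have "(\<lambda>j. 0) sums (LINT y|?M. E y * ?P y)" using *(2) by simp
    then have zero: "(LINT y|?M. E y * ?P y) = 0" using sums_unique2 sums_zero by blast
    have "2 * pi * E x = E x * (LINT y|?M. ?P y) - (LINT y|?M. E y * ?P y)"
      unfolding P(2) zero by simp
    also have "\<dots> = (LINT y|?M. E x * ?P y - E y * ?P y)"
      using P(1) iEP by (subst Bochner_Integration.integral_diff) (auto simp only: integral_mult_right_zero integrable_mult_right)
    finally have "\<bar>2 * pi * E x\<bar> \<le> (LINT y|?M. \<bar>E x * ?P y - E y * ?P y\<bar>)" by (simp only: integral_abs_bound)
    also have "\<dots> \<le> (LINT y|?M. e * ?P y + C * (1 - r\<^sup>2) / (2 * r))"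
    proof (rule integral_mono)
      show "integrable ?M (\<lambda>y. \<bar>E x * ?P y - E y * ?P y\<bar>)"
        by (intro integrable_abs Bochner_Integration.integrable_diff integrable_mult_right P iEP)
      show "integrable ?M (\<lambda>y. e * ?P y + C * (1 - r\<^sup>2) / (2 * r))"
        by (intro Bochner_Integration.integrable_add integrable_mult_right P integrable_ivl_continuous continuous_intros)
      fix y assume "y \<in> space ?M"
      then have y: "- pi \<le> y" "y \<le> pi" by auto
      have D: "0 < pdenom r (y - x)" by (rule pdenom_pos[OF r'])
      then have P0: "0 \<le> ?P y" using r2 by simp
      \<comment> \<open>This cancels the pole: \<open>1 - cos\<close> times the kernel tends to 0 as
        \<open>r\<close> tends to 1, uniformly in \<open>y\<close>.\<close>
      have "2 * r * (1 - cos (y - x)) \<le> pdenom r (y - x)" unfolding pdenom_alt by simp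
      then have "(1 - cos (y - x)) / pdenom r (y - x) \<le> 1 / (2 * r)"
        using D r by (simp add: field_simps)
      then have "(1 - r\<^sup>2) * ((1 - cos (y - x)) / pdenom r (y - x)) \<le> (1 - r\<^sup>2) * (1 / (2 * r))"
        using r2 by (rule mult_left_mono)
      then have cp: "(1 - cos (y - x)) * ?P y \<le> (1 - r\<^sup>2) / (2 * r)" by (simp add: mult.commute)
      have "\<bar>E x * ?P y - E y * ?P y\<bar> = \<bar>E x - E y\<bar> * ?P y"
        using P0 by (simp only: left_diff_distrib[symmetric] abs_mult abs_of_nonneg)
      also have "\<dots> \<le> (e + C * (1 - cos (y - x))) * ?P y" by (rule mult_right_mono[OF near[OF y] P0])
      also have "\<dots> = e * ?P y + C * ((1 - cos (y - x)) * ?P y)" by (simp only: distrib_right mult.assoc)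
      also have "\<dots> \<le> e * ?P y + C * ((1 - r\<^sup>2) / (2 * r))" by (intro add_left_mono mult_left_mono cp C)
      finally show "\<bar>E x * ?P y - E y * ?P y\<bar> \<le> e * ?P y + C * (1 - r\<^sup>2) / (2 * r)" by simp
    qed
    also have "\<dots> = e * (LINT y|?M. ?P y) + (LINT y|?M. C * (1 - r\<^sup>2) / (2 * r))"
    proof -
      have ip: "integrable ?M (\<lambda>y. e * ?P y)" by (rule integrable_mult_right, rule P(1))
      have ic: "integrable ?M (\<lambda>y. C * (1 - r\<^sup>2) / (2 * r))"
        by (rule integrable_ivl_continuous, rule continuous_on_const)
      show ?thesis by (simp only: Bochner_Integration.integral_add[OF ip ic] integral_mult_right_zero)
    qed
    also have "(LINT y|?M. C * (1 - r\<^sup>2) / (2 * r)) = C * (1 - r\<^sup>2) / (2 * r) * (2 * pi)"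
      by (rule integral_ivl_const)
    finally have "2 * pi * \<bar>E x\<bar> \<le> 2 * pi * (e + C * (1 - r\<^sup>2) / (2 * r))"
      unfolding P(2) by (simp add: abs_mult algebra_simps)
    then show ?thesis by (simp only: mult_le_cancel_left_pos zero_less_mult_iff pi_gt_zero zero_less_numeral simp_thms)
  qed
  have "((\<lambda>r. e + C * (1 - r\<^sup>2) / (2 * r)) \<longlongrightarrow> e + C * (1 - 1\<^sup>2) / (2 * 1)) (at_left 1)"
    by (intro tendsto_intros) auto
  moreover have "\<forall>\<^sub>F r in at_left (1::real). \<bar>E x\<bar> \<le> e + C * (1 - r\<^sup>2) / (2 * r)"
    using eventually_at_left_real[of 0 1] by (auto elim!: eventually_mono intro!: main)
  ultimately have "\<bar>E x\<bar> \<le> e + C * (1 - 1\<^sup>2) / (2 * 1)"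
    by (intro tendsto_lowerbound[where F = "at_left (1::real)"]) auto
  then show False using e by (simp add: e_def)
qed

text \<open>The family is closed under differentiation, so the induction on the order runs over all
  \<open>a\<close> and \<open>b\<close> at once.\<close>

lemma smooth_trig: "smooth (\<lambda>x::real. a * cos (k * x) + b * sin (k * x))"
proof -
  have D: "((\<lambda>x. a * cos (k * x) + b * sin (k * x)) has_real_derivative (b * k) * cos (k * x) + (- a * k) * sin (k * x)) (at x)" for a b x
    by (auto intro!: derivative_eq_intros)
  have "C_k m (\<lambda>x. a * cos (k * x) + b * sin (k * x))" for m
  proof (induction m arbitrary: a b)
    case 0
    show ?case by (auto intro!: continuous_intros)
  next
    case (Suc m)
    have "frechet_derivative (\<lambda>x. a * cos (k * x) + b * sin (k * x)) (at x) v =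
        (b * k * v) * cos (k * x) + (- a * k * v) * sin (k * x)" for x v
      unfolding frechet_derivative_at[OF D[of a b x, unfolded has_field_derivative_def], symmetric]
      by (simp add: algebra_simps)
    moreover have "(\<lambda>x. a * cos (k * x) + b * sin (k * x)) differentiable (at x)" for x
      using D by (meson has_field_derivative_imp_has_derivative differentiableI)
    ultimately show ?case using Suc by (simp only: C_k.simps simp_thms)
  qed
  then show ?thesis by (simp add: smooth_def)
qed

text \<open>The du Bois-Reymond lemma on the circle, with trigonometric test functions only. The
  remainder \<open>d\<close> is merely integrable, so completeness is applied to its continuous
  primitive \<open>E\<close>: orthogonal to all nonconstant harmonics, \<open>E\<close> is constant,
  hence 0 by its value at \<open>- pi\<close>, and \<open>d\<close> vanishes almost
  everywhere.\<close>

lemma weak_derivative_primitive: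
  assumes G: "integrable (ivl (- pi) pi) G" and h: "integrable (ivl (- pi) pi) h"
    and weak: "\<And>\<psi>. \<psi> \<in> smooth_circle \<Longrightarrow> (LINT x:circle|lborel. G x * deriv \<psi> x) = - (LINT x:circle|lborel. h x * \<psi> x)"
  shows "\<exists>c. AE x in ivl (- pi) pi. G x = c + primitive h x"
proof -
  let ?M = "ivl (- pi) pi"
  let ?\<psi> = "\<lambda>a b (j::nat) x::real. a * cos (real j * x) + b * sin (real j * x)"
  let ?\<psi>' = "\<lambda>a b (j::nat) x::real. (b * real j) * cos (real j * x) + (- a * real j) * sin (real j * x)"
  have D: "(?\<psi> a b j has_real_derivative ?\<psi>' a b j x) (at x)" for a b j x
    by (auto intro!: derivative_eq_intros)
  have c\<psi>': "continuous_on S (?\<psi>' a b j)" for a b j S by (intro continuous_intros)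
  have per: "?\<psi> a b j pi = ?\<psi> a b j (- pi)" for a b j
    using sin_npi[of j] by (simp add: mult.commute)
  have sm: "?\<psi> a b j \<in> smooth_circle" for a b j
  proof -
    have "cos (real j * (x + 2 * pi)) = cos (real j * x)" "sin (real j * (x + 2 * pi)) = sin (real j * x)" for x
      using cos.plus_of_nat[of "real j * x" j] sin.plus_of_nat[of "real j * x" j] by (simp_all add: algebra_simps)
    then show ?thesis using smooth_trig[of a "real j" b] by (simp add: smooth_circle_def periodic_def)
  qed
  have weak': "(LINT x|?M. G x * ?\<psi>' a b j x) = - (LINT x|?M. h x * ?\<psi> a b j x)" for a b j
  proof -
    have "deriv (?\<psi> a b j) = ?\<psi>' a b j" using D by (auto intro!: DERIV_imp_deriv)
    with weak[OF sm[where a = a and b = b and j = j]] show ?thesis by (simp add: integral_ivl_Ioc)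
  qed
  \<comment> \<open>The constant test function shows that \<open>h\<close> has mean zero, so
    integration by parts against \<open>primitive h\<close> leaves no boundary term.\<close>
  have h0: "integral\<^sup>L ?M h = 0" using weak'[where a = 1 and b = 0 and j = 0] by simp
  have P: "continuous_on UNIV (primitive h)" by (rule primitive_continuous[OF h])
  have iP: "integrable ?M (primitive h)" by (rule integrable_ivl_continuous) (rule continuous_on_subset[OF P subset_UNIV])
  \<comment> \<open>A mean value, which gives \<open>d\<close> integral 0 and removes the boundary
    term for its primitive as well.\<close>
  define c where "c = (LINT x|?M. G x - primitive h x) / (2 * pi)"
  define d where "d x = G x - primitive h x - c" for x
  have ic: "integrable ?M (\<lambda>x. k)" for k :: real by (intro integrable_ivl_continuous continuous_intros)
  have d: "integrable ?M d" unfolding d_def by (intro Bochner_Integration.integrable_diff G iP ic)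
  have d0: "integral\<^sup>L ?M d = 0"
  proof -
    have "integral\<^sup>L ?M d = (LINT x|?M. G x - primitive h x) - (LINT x|?M. c)"
      unfolding d_def by (rule Bochner_Integration.integral_diff) (intro Bochner_Integration.integrable_diff G iP ic)+
    then show ?thesis unfolding integral_ivl_const by (simp add: c_def)
  qed
  have bd: "integrable ?M (\<lambda>x. f x * ?\<psi>' a b j x)" if "integrable ?M f" for f a b j
  proof (rule integrable_mult_bounded[OF that])
    fix x
    have "\<bar>?\<psi>' a b j x\<bar> \<le> \<bar>b * real j\<bar> * \<bar>cos (real j * x)\<bar> + \<bar>- a * real j\<bar> * \<bar>sin (real j * x)\<bar>"
      unfolding abs_mult[symmetric] by (rule abs_triangle_ineq)
    also have "\<dots> \<le> \<bar>b * real j\<bar> * 1 + \<bar>- a * real j\<bar> * 1" by (intro add_mono mult_left_mono) auto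
    finally show "\<bar>?\<psi>' a b j x\<bar> \<le> \<bar>b * real j\<bar> * 1 + \<bar>- a * real j\<bar> * 1" .
  qed measurable
  have d\<psi>: "(LINT x|?M. d x * ?\<psi>' a b j x) = 0" for a b j
  proof -
    have "(LINT x|?M. d x * ?\<psi>' a b j x) =
        (LINT x|?M. G x * ?\<psi>' a b j x - primitive h x * ?\<psi>' a b j x - c * ?\<psi>' a b j x)"
      unfolding d_def left_diff_distrib ..
    also have "\<dots> = (LINT x|?M. G x * ?\<psi>' a b j x) - (LINT x|?M. primitive h x * ?\<psi>' a b j x) - (LINT x|?M. c * ?\<psi>' a b j x)"
      by (simp only: Bochner_Integration.integral_diff Bochner_Integration.integrable_diff bd[OF G] bd[OF iP] bd[OF ic])
    also have "(LINT x|?M. primitive h x * ?\<psi>' a b j x) = - (LINT x|?M. h x * ?\<psi> a b j x)"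
      using primitive_integration_by_parts[OF h D[where a = a and b = b and j = j] c\<psi>'] h0 by simp
    also have "(LINT x|?M. c * ?\<psi>' a b j x) = c * (LINT x|?M. ?\<psi>' a b j x)" by (rule integral_mult_right_zero)
    also have "(LINT x|?M. ?\<psi>' a b j x) = ?\<psi> a b j pi - ?\<psi> a b j (- pi)"
      by (rule FTC_ivl[OF _ D c\<psi>']) simp
    also have "\<dots> = 0" using per by simp
    finally show ?thesis using weak'[where a = a and b = b and j = j] by simp
  qed
  have dc: "(LINT x|?M. d x * cos (real j * x)) = 0" and ds: "(LINT x|?M. d x * sin (real j * x)) = 0"
    if "j > 0" for j
    using d\<psi>[where a = 0 and b = "1 / real j" and j = j] d\<psi>[where a = "- 1 / real j" and b = 0 and j = j] that by simp_all
  define E where "E = primitive d"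
  have cE: "continuous_on S E" for S unfolding E_def by (rule continuous_on_subset[OF primitive_continuous[OF d] subset_UNIV])
  have iE: "integrable ?M E" by (intro integrable_ivl_continuous cE)
  have E\<psi>: "(LINT x|?M. E x * ?\<psi>' a b j x) = - (LINT x|?M. d x * ?\<psi> a b j x)" for a b j
    unfolding E_def using primitive_integration_by_parts[OF d D[where a = a and b = b and j = j] c\<psi>'] d0 by simp
  have Ec: "(LINT x|?M. E x * cos (real j * x)) = 0" and Es: "(LINT x|?M. E x * sin (real j * x)) = 0"
    if "j > 0" for j
    using E\<psi>[where a = 0 and b = "1 / real j" and j = j] E\<psi>[where a = "- 1 / real j" and b = 0 and j = j] dc[OF that] ds[OF that] that by simp_all
  define m where "m = integral\<^sup>L ?M E / (2 * pi)"
  have trig: "(LINT x|?M. cos (real j * x)) = 0" "(LINT x|?M. sin (real j * x)) = 0" if "j > 0" for j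
  proof -
    have "(LINT x|?M. ?\<psi>' a b j x) = 0" for a b
      using FTC_ivl[OF _ D[where a = a and b = b and j = j] c\<psi>', of "- pi" pi] per[where a = a and b = b and j = j] by simp
    from this[where a = 0 and b = "1 / real j"] this[where a = "- 1 / real j" and b = 0] that
    show "(LINT x|?M. cos (real j * x)) = 0" "(LINT x|?M. sin (real j * x)) = 0" by simp_all
  qed
  have Em: "E x - m = 0" if x: "- pi < x" "x < pi" for x
  proof (rule trig_orthogonal_imp_zero[where E = "\<lambda>x. E x - m", OF _ _ _ x])
    show "continuous_on UNIV (\<lambda>x. E x - m)" by (intro continuous_intros cE)
    have ic': "integrable ?M (\<lambda>x. E x * cos (real j * x))" "integrable ?M (\<lambda>x. m * cos (real j * x))"
      "integrable ?M (\<lambda>x. E x * sin (real j * x))" "integrable ?M (\<lambda>x. m * sin (real j * x))" for j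
      by (intro integrable_ivl_continuous continuous_intros cE)+
    show "(LINT y|?M. (E y - m) * cos (real j * y)) = 0" for j
    proof (cases "j = 0")
      case True
      have "(LINT y|?M. E y - m) = integral\<^sup>L ?M E - m * (2 * pi)"
        by (simp only: Bochner_Integration.integral_diff[OF iE ic] integral_ivl_const)
      then show ?thesis using True by (simp add: m_def)
    next
      case False
      then show ?thesis using Ec[of j] trig[of j] ic'[of j] by (simp add: left_diff_distrib)
    qed
    show "(LINT y|?M. (E y - m) * sin (real j * y)) = 0" for j
    proof (cases "j = 0")
      case False
      then show ?thesis using Es[of j] trig[of j] ic'[of j] by (simp add: left_diff_distrib)
    qed simp
  qed
  have Ecl: "E x = m" if "- pi \<le> x" "x \<le> pi" for x
  proof (rule continuous_constant_on_closure[where S = "{- pi<..<pi}" and f = E and a = m and x = x])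
    show "x \<in> closure {- pi<..<pi}" using that by (simp add: closure_greaterThanLessThan)
  qed (use Em cE in auto)
  moreover have "E (- pi) = 0" unfolding E_def by (rule primitive_minus_pi)
  ultimately have "m = 0" using pi_gt_zero by (metis less_imp_le neg_le_0_iff_le order_refl order_trans)
  then have "AE x in ?M. d x = 0" using Ecl unfolding E_def by (intro AE_eq_0_of_primitive[OF d]) auto
  then have "AE x in ?M. G x = c + primitive h x" by eventually_elim (simp add: d_def)
  then show ?thesis by blast
qed

text \<open>The increments of \<open>q\<^sup>2 / g\<close> are \<open>o(\<integral>\<bar>h\<bar>)\<close>, uniformly on \<open>[a, b]\<close>; this replaces the chain rule
  for absolutely continuous functions.\<close>

lemma square_ratio_constant:
  fixes g q h :: "real \<Rightarrow> real"
  assumes ab: "a \<le> b" and h: "integrable (ivl a b) h"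
    and cont: "continuous_on {a..b} g" "continuous_on {a..b} q" and nz: "\<And>x. x \<in> {a..b} \<Longrightarrow> g x \<noteq> 0"
    and g: "\<And>x y. a \<le> x \<Longrightarrow> x \<le> y \<Longrightarrow> y \<le> b \<Longrightarrow> g y - g x = integral\<^sup>L (ivl x y) h"
    and qg: "\<And>x y. a \<le> x \<Longrightarrow> x \<le> y \<Longrightarrow> y \<le> b \<Longrightarrow> q y * g y - q x * g x = 3 / 2 * (LINT t|ivl x y. q t * h t)"
  shows "(q b)\<^sup>2 / g b = (q a)\<^sup>2 / g a"
proof -
  obtain Q where Q: "0 < Q" "\<forall>x\<in>{a..b}. \<bar>q x\<bar> \<le> Q"
    using compact_imp_bounded[OF compact_continuous_image[OF cont(2) compact_Icc]] unfolding bounded_pos by auto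
  have "continuous_on {a..b} (\<lambda>x. \<bar>g x\<bar>)" by (intro continuous_intros cont)
  from continuous_attains_inf[OF compact_Icc _ this] ab obtain z where
    z: "z \<in> {a..b}" "\<forall>y\<in>{a..b}. \<bar>g z\<bar> \<le> \<bar>g y\<bar>" by auto
  define \<gamma> where "\<gamma> = \<bar>g z\<bar>"
  have \<gamma>: "0 < \<gamma>" "\<And>y. a \<le> y \<Longrightarrow> y \<le> b \<Longrightarrow> \<gamma> \<le> \<bar>g y\<bar>" using z nz by (auto simp: \<gamma>_def)
  have sub: "integrable (ivl x y) h" if "a \<le> x" "x \<le> y" "y \<le> b" for x y
  proof -
    have "integrable (ivl x b) h" using integral_ivl_split(2)[OF h, of x] that by simp
    then show ?thesis using integral_ivl_split(1)[of x b h y] that by simp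
  qed
  define R where "R x = (q x)\<^sup>2 / g x" for x
  \<comment> \<open>The numerator below is at most \<open>3 / 2 * Q * e * H + 3 * Q * e * H\<close>,
    the denominator at least \<open>\<gamma>^2\<close>.\<close>
  define C where "C = 9 / 2 * Q / \<gamma>\<^sup>2"
  have C: "0 < C" using Q \<gamma> by (simp add: C_def)
  have local: "\<bar>R y - R x\<bar> \<le> C * e * (LINT t|ivl x y. \<bar>h t\<bar>)"
    if xy: "a \<le> x" "x \<le> y" "y \<le> b" and e: "0 < e" and osc: "\<And>t. x \<le> t \<Longrightarrow> t \<le> y \<Longrightarrow> \<bar>q t - q x\<bar> \<le> e" for x y e
  proof -
    define H where "H = (LINT t|ivl x y. \<bar>h t\<bar>)"
    note hi = sub[OF xy]
    have H: "0 \<le> H" unfolding H_def by simp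
    have dg: "\<bar>g y - g x\<bar> \<le> H" unfolding g[OF xy] H_def by (rule integral_abs_bound)
    have cq: "continuous_on {x..y} q" by (rule continuous_on_subset[OF cont(2)]) (use xy in auto)
    have "integrable (ivl x y) (\<lambda>t. h t * (q t - q x))"
    proof (rule integrable_mult_bounded[OF hi])
      show "(\<lambda>t. q t - q x) \<in> borel_measurable (ivl x y)"
        by (rule borel_measurable_integrable, rule integrable_ivl_continuous) (intro continuous_intros cq)
      show "\<bar>q t - q x\<bar> \<le> e" if "t \<in> space (ivl x y)" for t using that osc by auto
    qed
    then have i: "integrable (ivl x y) (\<lambda>t. (q t - q x) * h t)" by (simp add: mult.commute)
    define r where "r = 3 / 2 * (LINT t|ivl x y. (q t - q x) * h t)"
    have r: "\<bar>r\<bar> \<le> 3 / 2 * e * H"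
    proof -
      have "\<bar>LINT t|ivl x y. (q t - q x) * h t\<bar> \<le> (LINT t|ivl x y. \<bar>(q t - q x) * h t\<bar>)" by (rule integral_abs_bound)
      also have "\<dots> \<le> (LINT t|ivl x y. e * \<bar>h t\<bar>)"
        by (rule integral_mono[OF integrable_abs[OF i] integrable_mult_right[OF integrable_abs[OF hi]]])
           (use osc in \<open>auto simp: abs_mult intro!: mult_right_mono\<close>)
      finally show ?thesis by (simp add: r_def H_def abs_mult)
    qed
    have "(LINT t|ivl x y. q t * h t) = (LINT t|ivl x y. (q t - q x) * h t + q x * h t)"
      by (simp add: algebra_simps)
    also have "\<dots> = (LINT t|ivl x y. (q t - q x) * h t) + q x * integral\<^sup>L (ivl x y) h"
      using i hi by simp
    finally have eq: "q y * g y - q x * g x = r + 3 / 2 * q x * (g y - g x)"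
      unfolding qg[OF xy] g[OF xy] r_def by (simp add: algebra_simps)
    have bx: "\<bar>q x\<bar> \<le> Q" "\<bar>q y\<bar> \<le> Q" "\<gamma> \<le> \<bar>g x\<bar>" "\<gamma> \<le> \<bar>g y\<bar>" using Q \<gamma> xy by auto
    \<comment> \<open>Elimination by \<open>eq\<close> leaves only terms of second order: the
      increment of \<open>g\<close> times that of \<open>q\<close>, and the remainder
      \<open>r\<close>, itself of size \<open>e * H\<close>.\<close>
    have id: "(q y)\<^sup>2 * g x - (q x)\<^sup>2 * g y =
        (g y - g x) * (1 / 2 * (q x - q y) * (q x + 2 * q y)) + r * (q x + q y)"
      using eq by algebra
    have "\<bar>(q y)\<^sup>2 * g x - (q x)\<^sup>2 * g y\<bar> \<le> \<bar>g y - g x\<bar> * (1 / 2 * \<bar>q x - q y\<bar> * \<bar>q x + 2 * q y\<bar>) + \<bar>r\<bar> * \<bar>q x + q y\<bar>"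
      unfolding id by (rule order_trans[OF abs_triangle_ineq]) (simp add: abs_mult)
    also have "\<dots> \<le> H * (1 / 2 * e * (3 * Q)) + 3 / 2 * e * H * (2 * Q)"
    proof (rule add_mono)
      have a: "\<bar>q x - q y\<bar> \<le> e" using osc[of y] xy by (simp add: abs_minus_commute)
      have b: "\<bar>q x + 2 * q y\<bar> \<le> 3 * Q" "\<bar>q x + q y\<bar> \<le> 2 * Q" using bx by linarith+
      have "1 / 2 * \<bar>q x - q y\<bar> * \<bar>q x + 2 * q y\<bar> \<le> 1 / 2 * e * (3 * Q)"
        by (rule mult_mono) (use a b e in auto)
      then show "\<bar>g y - g x\<bar> * (1 / 2 * \<bar>q x - q y\<bar> * \<bar>q x + 2 * q y\<bar>) \<le> H * (1 / 2 * e * (3 * Q))"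
        by (rule mult_mono[OF dg]) (use H in auto)
      show "\<bar>r\<bar> * \<bar>q x + q y\<bar> \<le> 3 / 2 * e * H * (2 * Q)"
        by (rule mult_mono[OF r b(2)]) (use e H in auto)
    qed
    also have "\<dots> = 9 / 2 * Q * e * H" by (simp add: field_simps)
    finally have num: "\<bar>(q y)\<^sup>2 * g x - (q x)\<^sup>2 * g y\<bar> \<le> 9 / 2 * Q * e * H" .
    have "\<gamma> * \<gamma> \<le> \<bar>g x\<bar> * \<bar>g y\<bar>" using bx \<gamma> by (intro mult_mono) auto
    then have den: "\<gamma>\<^sup>2 \<le> \<bar>g x * g y\<bar>" by (simp add: power2_eq_square abs_mult)
    have "R y - R x = ((q y)\<^sup>2 * g x - (q x)\<^sup>2 * g y) / (g x * g y)"
      using nz[of x] nz[of y] xy by (simp add: R_def field_simps)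
    then have "\<bar>R y - R x\<bar> = \<bar>(q y)\<^sup>2 * g x - (q x)\<^sup>2 * g y\<bar> / \<bar>g x * g y\<bar>" by (simp only: abs_divide)
    also have "\<dots> \<le> (9 / 2 * Q * e * H) / \<gamma>\<^sup>2"
      using num den \<gamma>(1) Q e H by (intro frac_le) auto
    finally show ?thesis by (simp add: C_def H_def)
  qed
  have all: "\<bar>R b - R a\<bar> \<le> C * e * (LINT t|ivl a b. \<bar>h t\<bar>)" if e: "0 < e" for e
  proof -
    have "uniformly_continuous_on {a..b} q" by (rule compact_uniformly_continuous[OF cont(2) compact_Icc])
    then obtain \<delta> where \<delta>: "0 < \<delta>" "\<And>x y. x \<in> {a..b} \<Longrightarrow> y \<in> {a..b} \<Longrightarrow> \<bar>y - x\<bar> < \<delta> \<Longrightarrow> \<bar>q y - q x\<bar> < e"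
      using e unfolding uniformly_continuous_on_def dist_real_def by meson
    obtain N :: nat where N: "(b - a) / \<delta> < real N" using reals_Archimedean2 by blast
    have Npos: "0 < real N" using N ab \<delta>(1) by (smt (verit) divide_nonneg_pos)
    define s where "s = (b - a) / real N"
    have s: "0 \<le> s" "s < \<delta>" "real N * s = b - a" using N Npos ab \<delta>(1) by (auto simp: s_def field_simps)
    have "\<bar>R (a + real i * s) - R a\<bar> \<le> C * e * (LINT t|ivl a (a + real i * s). \<bar>h t\<bar>)" if "i \<le> N" for i
      using that
    proof (induction i)
      case 0
      then show ?case using C e by simp
    next
      case (Suc i)
      let ?x = "a + real i * s" and ?y = "a + real (Suc i) * s"
      have "real (Suc i) * s \<le> real N * s" using Suc.prems s(1) by (intro mult_right_mono) auto
      then have xy: "a \<le> ?x" "?x \<le> ?y" "?y \<le> b" "?y - ?x = s" using s by (auto simp: algebra_simps)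
      have osc: "\<bar>q t - q ?x\<bar> \<le> e" if t: "?x \<le> t" "t \<le> ?y" for t
      proof (rule less_imp_le, rule \<delta>(2))
        show "?x \<in> {a..b}" using xy by auto
        show "t \<in> {a..b}" using xy(1,3) t by (simp only: atLeastAtMost_iff) linarith
        show "\<bar>t - ?x\<bar> < \<delta>" using xy(4) t s(2) by linarith
      qed
      have "integrable (ivl a ?y) (\<lambda>t. \<bar>h t\<bar>)" using xy by (intro integrable_abs sub) auto
      from integral_ivl_split(3)[OF this xy(1,2)]
      have "(LINT t|ivl a ?y. \<bar>h t\<bar>) = (LINT t|ivl a ?x. \<bar>h t\<bar>) + (LINT t|ivl ?x ?y. \<bar>h t\<bar>)" .
      moreover have "\<bar>R ?y - R ?x\<bar> \<le> C * e * (LINT t|ivl ?x ?y. \<bar>h t\<bar>)" by (rule local[OF xy(1-3) e osc])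
      moreover have "\<bar>R ?x - R a\<bar> \<le> C * e * (LINT t|ivl a ?x. \<bar>h t\<bar>)" using Suc by simp
      ultimately show ?case by (simp only: distrib_left)
    qed
    from this[of N] show ?thesis using s(3) by simp
  qed
  have "\<bar>R b - R a\<bar> \<le> 0"
  proof (rule field_le_epsilon)
    fix e :: real assume e: "0 < e"
    define H where "H = (LINT t|ivl a b. \<bar>h t\<bar>)"
    have H: "0 \<le> H" unfolding H_def by simp
    \<comment> \<open>\<open>H + 1\<close> instead of \<open>H\<close> avoids a division by zero
      when \<open>h\<close> vanishes.\<close>
    have "\<bar>R b - R a\<bar> \<le> C * (e / (C * (H + 1))) * H"
      unfolding H_def[symmetric] using all[of "e / (C * (H + 1))"] C e H by (simp add: H_def[symmetric])
    also have "\<dots> = e * (H / (H + 1))" using C by simp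
    also have "\<dots> \<le> e * 1" using e H by (intro mult_left_mono) auto
    finally show "\<bar>R b - R a\<bar> \<le> 0 + e" by simp
  qed
  then show ?thesis by (simp add: R_def)
qed

section \<open>Uniqueness\<close>

text \<open>The coincidence set is closed and of full measure in an open interval, hence contains
  it.\<close>

lemma continuous_eq_of_AE:
  fixes f g :: "real \<Rightarrow> real"
  assumes "continuous_on UNIV f" "continuous_on UNIV g" "AE x in ivl a b. f x = g x" "a < x" "x < b"
  shows "f x = g x"
proof -
  have "closed {x. f x = g x}" using assms(1,2) by (intro closed_Collect_eq)
  moreover have "AE x\<in>{a<..<b} in lebesgue. x \<in> {x. f x = g x}"
    using assms(3) unfolding AE_ivl_iff by (intro AE_completion) (auto elim!: eventually_mono)
  ultimately have "x \<in> {a<..<b} \<Longrightarrow> x \<in> {x. f x = g x}"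
    by (rule mem_closed_if_AE_lebesgue_open[OF open_greaterThanLessThan])
  then show ?thesis using assms(4,5) by simp
qed

text \<open>Translations by \<open>T\<close> and reflection bring every point into the open half
  period, except the multiples of \<open>T / 2\<close>. Only countably many affine images of the
  exceptional set occur, so it stays null.\<close>

lemma AE_of_half_period:
  assumes T: "0 < T" and p: "odd_fun p" "periodic T p" and f: "odd_fun f" "periodic T f"
    and m: "p \<in> borel_measurable borel" "f \<in> borel_measurable borel"
    and ae: "AE x in lborel. 0 < x \<and> x < T / 2 \<longrightarrow> p x = f x"
  shows "AE x in lborel. p x = f x"
proof -
  note [measurable] = m
  define N where "N x \<longleftrightarrow> (0 < x \<and> x < T / 2 \<longrightarrow> p x = f x)" for x
  have Nm: "Measurable.pred borel N" unfolding N_def[abs_def] by measurable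
  have "AE x in lborel. N x" using ae by (simp add: N_def)
  then have N: "AE x in lborel. N (t + c * x)" if "c \<noteq> 0" for t c using that by (intro AE_borel_affine Nm)
  have "AE x in lborel. \<forall>k::int. N (of_int k * T + x) \<and> N (of_int k * T - x) \<and> x \<noteq> of_int k * (T / 2)"
  proof (intro AE_all_countable[THEN iffD2] allI AE_conjI)
    show "AE x in lborel. N (of_int k * T + x)" for k :: int using N[of 1 "of_int k * T"] by simp
    show "AE x in lborel. N (of_int k * T - x)" for k :: int using N[of "-1" "of_int k * T"] by simp
    show "AE x in lborel. x \<noteq> of_int k * (T / 2)" for k :: int by (rule AE_lborel_singleton)
  qed
  then show ?thesis
  proof eventually_elim
    fix x assume x: "\<forall>k::int. N (of_int k * T + x) \<and> N (of_int k * T - x) \<and> x \<noteq> of_int k * (T / 2)"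
    define k where "k = \<lfloor>x / T\<rfloor>"
    have k: "of_int k * T \<le> x" "x < of_int (k + 1) * T"
    proof -
      have "of_int k \<le> x / T" "x / T < of_int (k + 1)" unfolding k_def by linarith+
      then show "of_int k * T \<le> x" "x < of_int (k + 1) * T"
        using T by (simp_all only: pos_le_divide_eq pos_divide_less_eq)
    qed
    have "x \<noteq> of_int (2 * k) * (T / 2)" "x \<noteq> of_int (2 * k + 1) * (T / 2)" using x by blast+
    then have ne: "x \<noteq> of_int k * T" "x \<noteq> of_int k * T + T / 2" by (auto simp: algebra_simps)
    have shift: "u (of_int k * T + x) = u x" "u (of_int k * T - x) = - u x" if "odd_fun u" "periodic T u" for u and k :: int
      using periodic_int[OF that(2), of x k] periodic_int[OF that(2), of "- x" k] that(1)
      by (simp_all add: odd_fun_def algebra_simps)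
    show "p x = f x"
    proof (cases "x < of_int k * T + T / 2")
      case True
      have "N (of_int (- k) * T + x)" using x by blast
      moreover have "0 < of_int (- k) * T + x" "of_int (- k) * T + x < T / 2" using True k ne by auto
      ultimately have "p (of_int (- k) * T + x) = f (of_int (- k) * T + x)" unfolding N_def by blast
      then show ?thesis unfolding shift(1)[OF p] shift(1)[OF f] .
    next
      case False
      have "N (of_int (k + 1) * T - x)" using x by blast
      moreover have "0 < of_int (k + 1) * T - x" using k by auto
      moreover have "of_int (k + 1) * T - x < T / 2" using False ne by (simp add: algebra_simps)
      ultimately have "p (of_int (k + 1) * T - x) = f (of_int (k + 1) * T - x)" unfolding N_def by blast
      then show ?thesis unfolding shift(2)[OF p] shift(2)[OF f] by simp
    qed
  qed
qed

text \<open>The weak equation says that \<open>q * S_op q\<close> has weak derivative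
  \<open>3 / 2 * q * h\<close>, so it agrees almost everywhere with a continuous \<open>v\<close>.
  Where \<open>S_op q\<close> has no zero, \<open>v / S_op q\<close> is a continuous representative
  of \<open>q\<close>, and \<open>square_ratio_constant\<close> applies on compact subintervals. The
  endpoints, where \<open>S_op q\<close> may vanish, are never touched.\<close>

lemma weak_solution_square:
  assumes q: "weak_solution 2 q" and cg: "continuous_on UNIV (S_op q)"
    and I: "- pi \<le> a" "a < b" "b \<le> pi" and nz: "\<And>x. a < x \<Longrightarrow> x < b \<Longrightarrow> S_op q x \<noteq> 0"
  shows "\<exists>v c. continuous_on UNIV v \<and> (AE x in ivl a b. q x = v x / S_op q x) \<and>
    (\<forall>x. a < x \<longrightarrow> x < b \<longrightarrow> (v x / S_op q x)\<^sup>2 = c * S_op q x)"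
proof -
  let ?M = "ivl (- pi) pi"
  define g where "g = S_op q"
  note cg = cg[folded g_def] and nz = nz[folded g_def]
  obtain h where h: "L2_circle h" and L: "L2_circle q"
    and wg: "\<And>\<psi>. \<psi> \<in> smooth_circle \<Longrightarrow> (LINT x:circle|lborel. g x * deriv \<psi> x) = - (LINT x:circle|lborel. h x * \<psi> x)"
    and wq: "\<And>\<psi>. \<psi> \<in> smooth_circle \<Longrightarrow> - 2 * (LINT x:circle|lborel. q x * g x * deriv \<psi> x) = (2 + 1) * (LINT x:circle|lborel. q x * h x * \<psi> x)"
    using q unfolding weak_solution_def weak_deriv_circle_def g_def by auto
  note hi = L2_circle_integrable[OF h] and qi = L2_circle_integrable[OF L]
  note [measurable] = borel_measurable_integrable[OF hi(1)] borel_measurable_integrable[OF qi(1)]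
  have gi: "integrable ?M g" by (intro integrable_ivl_continuous continuous_on_subset[OF cg]) simp
  have "compact (g ` {- pi..pi})" by (intro compact_continuous_image continuous_on_subset[OF cg]) auto
  from compact_imp_bounded[OF this] obtain B where B: "\<forall>x\<in>{- pi..pi}. \<bar>g x\<bar> \<le> B"
    unfolding bounded_pos by auto
  have qgi: "integrable ?M (\<lambda>x. q x * g x)"
    by (rule integrable_mult_bounded[OF qi(1) borel_measurable_integrable[OF gi], of B]) (use B in auto)
  have qhi: "integrable ?M (\<lambda>x. q x * h x)" by (rule integrable_mult_L2) (use hi qi in auto)
  then have qhi': "integrable ?M (\<lambda>x. 3 / 2 * (q x * h x))" by (rule integrable_mult_right)
  obtain c1 where "AE x in ?M. g x = c1 + primitive h x" using weak_derivative_primitive[OF gi hi(1) wg] by blast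
  then have g1: "g x = c1 + primitive h x" if "- pi < x" "x < pi" for x
    using that by (intro continuous_eq_of_AE[of _ _ "- pi" pi]) (auto intro!: continuous_intros cg primitive_continuous hi)
  have "(LINT x:circle|lborel. q x * g x * deriv \<psi> x) = - (LINT x:circle|lborel. 3 / 2 * (q x * h x) * \<psi> x)"
    if "\<psi> \<in> smooth_circle" for \<psi>
    using wq[OF that] by (simp only: mult.assoc set_integral_mult_right) simp
  from weak_derivative_primitive[OF qgi qhi' this] obtain c2 where
    c2: "AE x in ?M. q x * g x = c2 + primitive (\<lambda>x. 3 / 2 * (q x * h x)) x" by blast
  define v where "v x = c2 + primitive (\<lambda>x. 3 / 2 * (q x * h x)) x" for x
  have cv: "continuous_on UNIV v" unfolding v_def by (intro continuous_intros primitive_continuous qhi')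
  define r where "r x = v x / g x" for x
  have AEq: "AE x in ivl a b. q x = r x"
  proof -
    have "AE x in lborel. - pi < x \<and> x < pi \<longrightarrow> q x * g x = v x" using c2 unfolding AE_ivl_iff v_def .
    then show ?thesis unfolding AE_ivl_iff
      by eventually_elim (use I nz in \<open>auto simp: r_def field_simps\<close>)
  qed
  have ratio: "(r y)\<^sup>2 / g y = (r x)\<^sup>2 / g x" if xy: "a < x" "x \<le> y" "y < b" for x y
  proof (rule square_ratio_constant[where h = h])
    show "x \<le> y" by fact
    have sub: "integrable (ivl s t) u" if "integrable ?M u" "x \<le> s" "s \<le> t" "t \<le> y" for s t and u :: "real \<Rightarrow> real"
    proof -
      have "integrable (ivl s pi) u" using integral_ivl_split(2)[OF that(1), of s] that xy I by simp
      then show ?thesis using integral_ivl_split(1)[of s pi u t] that xy I by simp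
    qed
    show "integrable (ivl x y) h" using sub[OF hi(1)] xy by simp
    show nz': "g t \<noteq> 0" if "t \<in> {x..y}" for t using that xy nz by auto
    show cg': "continuous_on {x..y} g" by (rule continuous_on_subset[OF cg]) simp
    show "continuous_on {x..y} r"
      unfolding r_def using nz' by (intro continuous_on_divide continuous_on_subset[OF cv] cg') auto
    fix s t assume st: "x \<le> s" "s \<le> t" "t \<le> y"
    then have st': "- pi \<le> s" "s \<le> t" "t \<le> pi" using xy I by auto
    show "g t - g s = integral\<^sup>L (ivl s t) h"
      using primitive_diff[OF hi(1) st'] g1[of s] g1[of t] st xy I by simp
    have "r t * g t = v t" "r s * g s = v s" using nz'[of t] nz'[of s] st by (auto simp: r_def)
    then have "r t * g t - r s * g s = (LINT x|ivl s t. 3 / 2 * (q x * h x))"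
      using primitive_diff[OF qhi' st'] by (simp add: v_def)
    also have "\<dots> = 3 / 2 * (LINT x|ivl s t. q x * h x)" by simp
    also have "(LINT x|ivl s t. q x * h x) = (LINT x|ivl s t. r x * h x)"
    proof (rule integral_cong_AE)
      have ae: "AE x in ivl s t. q x = r x"
        using AEq unfolding AE_ivl_iff by eventually_elim (use st xy in auto)
      then show "AE x in ivl s t. q x * h x = r x * h x" by eventually_elim simp
      show "(\<lambda>x. q x * h x) \<in> borel_measurable (ivl s t)" using sub[OF qhi] st by (intro borel_measurable_integrable) auto
      have "h \<in> borel_measurable (ivl s t)" using sub[OF hi(1)] st by (intro borel_measurable_integrable) auto
      moreover have "r \<in> borel_measurable (ivl s t)"
        unfolding r_def using cv cg by (intro borel_measurable_ivlI borel_measurable_divide borel_measurable_continuous_onI)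
      ultimately show "(\<lambda>x. r x * h x) \<in> borel_measurable (ivl s t)" by measurable
    qed
    finally show "r t * g t - r s * g s = 3 / 2 * (LINT x|ivl s t. r x * h x)" .
  qed
  define m where "m = (a + b) / 2"
  define c where "c = (r m)\<^sup>2 / g m"
  have m: "a < m" "m < b" using I by (auto simp: m_def)
  have "(r x)\<^sup>2 = c * g x" if x: "a < x" "x < b" for x
  proof -
    have "(r x)\<^sup>2 / g x = c"
    proof (cases "x \<le> m")
      case True
      then show ?thesis using ratio[OF x(1) True m(2)] by (simp add: c_def)
    next
      case False
      then show ?thesis using ratio[OF m(1) _ x(2)] by (simp add: c_def)
    qed
    then show ?thesis using nz[OF x] by (simp add: field_simps)
  qed
  then show ?thesis using cv AEq unfolding r_def g_def by blast
qed

lemma constant_sign: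
  fixes u :: "real \<Rightarrow> real"
  assumes "continuous_on {a<..<b} u" "\<And>x. a < x \<Longrightarrow> x < b \<Longrightarrow> u x \<noteq> 0"
  obtains s where "s = 1 \<or> s = - 1" "\<And>x. a < x \<Longrightarrow> x < b \<Longrightarrow> 0 < s * u x"
proof -
  have c: "connected (u ` {a<..<b})" by (intro connected_continuous_image assms connected_Ioo)
  have "0 \<notin> u ` {a<..<b}" using assms(2) by auto
  then have "(\<forall>y\<in>u ` {a<..<b}. 0 < y) \<or> (\<forall>y\<in>u ` {a<..<b}. y < 0)"
    using c unfolding connected_iff_interval by (metis not_less_iff_gr_or_eq less_imp_le)
  then show thesis
  proof
    assume "\<forall>y\<in>u ` {a<..<b}. 0 < y"
    then show thesis by (intro that[of 1]) auto
  next
    assume "\<forall>y\<in>u ` {a<..<b}. y < 0"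
    then show thesis by (intro that[of "- 1"]) auto
  qed
qed

section \<open>Identification of an arbitrary solution with the fixed point\<close>

context n_fold
begin

lemma solution_unique:
  assumes \<phi>: "fixed_point \<phi>" and q: "L2_circle q" "AE_odd q" "AE_periodic (2 * pi / real n) q"
    and sol: "weak_solution 2 q" and nz: "\<And>x. 0 < x \<Longrightarrow> x < pi / real n \<Longrightarrow> S_op q x \<noteq> 0"
  shows "\<exists>c. AE x in lborel. q x = c * sqrt (K \<phi> (real n * x))"
proof -
  have n: "1 \<le> real n" using n_ge_3 by simp
  define \<eta> where "\<eta> y = q (y / real n)" for y
  note S = S_op_symmetric[OF q, folded \<eta>_def]
  have \<eta>: "L2_half \<eta>" and S: "S_op q x = - K \<eta> (real n * x)" for x
    using S_op_symmetric[OF q] unfolding \<eta>_def[abs_def] by auto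
  have cK: "continuous_on UNIV (\<lambda>x. K \<eta> (real n * x))"
    by (rule continuous_on_compose2[OF K_continuous[OF \<eta>]]) (auto intro!: continuous_intros)
  have cS: "continuous_on UNIV (S_op q)" unfolding S[abs_def] by (intro continuous_intros cK)
  have pin: "0 < pi / real n" "pi / real n \<le> pi" using n by (simp_all add: field_simps)
  obtain v c where v: "continuous_on UNIV v" "AE x in ivl 0 (pi / real n). q x = v x / S_op q x"
    "\<And>x. 0 < x \<Longrightarrow> x < pi / real n \<Longrightarrow> (v x / S_op q x)\<^sup>2 = c * S_op q x"
    using weak_solution_square[OF sol cS _ pin nz] pin by auto
  define u where "u y = v (y / real n) / S_op q (y / real n)" for y
  have rng: "0 < y / real n" "y / real n < pi / real n" if "0 < y" "y < pi" for y
    using that n by (simp_all add: divide_strict_right_mono)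
  have Ky: "S_op q (y / real n) = - K \<eta> y" for y using S n by simp
  have u2: "(u y)\<^sup>2 = - c * K \<eta> y" if "0 < y" "y < pi" for y
    using v(3)[OF rng[OF that]] unfolding u_def Ky by simp
  have Knz: "K \<eta> y \<noteq> 0" if "0 < y" "y < pi" for y using nz[OF rng[OF that]] unfolding Ky by simp
  have um: "u \<in> borel_measurable (ivl 0 pi)"
  proof -
    have "(\<lambda>x. v x / S_op q x) \<in> borel_measurable borel"
      using v(1) cS by (intro borel_measurable_divide borel_measurable_continuous_onI)
    then show ?thesis unfolding u_def[abs_def] by (rule measurable_compose[rotated]) measurable
  qed
  have AEu: "AE y in ivl 0 pi. \<eta> y = u y"
  proof -
    define P where "P x \<longleftrightarrow> (0 < x \<and> x < pi / real n \<longrightarrow> q x = v x / S_op q x)" for x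
    have [measurable]: "q \<in> borel_measurable borel" "v \<in> borel_measurable borel" "S_op q \<in> borel_measurable borel"
      using q(1) v(1) cS by (auto simp: L2_circle_def intro: borel_measurable_continuous_onI)
    have "Measurable.pred borel P" unfolding P_def[abs_def] by measurable
    moreover have "AE x in lborel. P x" using v(2) unfolding AE_ivl_iff P_def .
    moreover have "1 / real n \<noteq> 0" using n by simp
    ultimately have "AE y in lborel. P (0 + 1 / real n * y)" by (intro AE_borel_affine)
    then show ?thesis unfolding AE_ivl_iff
    proof eventually_elim
      fix y assume "P (0 + 1 / real n * y)"
      then show "0 < y \<and> y < pi \<longrightarrow> \<eta> y = u y"
        using rng[of y] by (simp add: P_def \<eta>_def u_def)
    qed
  qed
  \<comment> \<open>For \<open>c = 0\<close> the function \<eta> would vanish almost everywhere on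
    (0, pi) and \<open>K \<eta>\<close> identically, against the hypothesis at the point 1 of (0,
    pi).\<close>
  have c0: "c \<noteq> 0"
  proof
    assume "c = 0"
    then have "u y = 0" if "0 < y" "y < pi" for y using u2[OF that] by simp
    then have "AE y in ivl 0 pi. u y = 0" by (rule AE_ivlI)
    with AEu have "AE y in ivl 0 pi. \<eta> y = 0" by (rule eventually_elim2) simp
    then have "K \<eta> 1 = K (\<lambda>_. 0) 1" by (intro K_cong_AE L2_half_measurable[OF \<eta>]) auto
    also have "\<dots> = 0" by (simp add: K_def sine_coeff_def)
    finally show False using Knz[of 1] pi_gt3 by simp
  qed
  have cu: "continuous_on {0<..<pi} u"
    unfolding u_def
  proof (intro continuous_on_divide)
    have cn: "continuous_on {0<..<pi} (\<lambda>y. y / real n)" using n by (intro continuous_intros) auto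
    show "continuous_on {0<..<pi} (\<lambda>y. v (y / real n))" by (rule continuous_on_compose2[OF v(1) cn]) simp
    show "continuous_on {0<..<pi} (\<lambda>y. S_op q (y / real n))" by (rule continuous_on_compose2[OF cS cn]) simp
    show "\<forall>y\<in>{0<..<pi}. S_op q (y / real n) \<noteq> 0" using Knz by (simp add: Ky)
  qed
  have unz: "u y \<noteq> 0" if "0 < y" "y < pi" for y using u2[OF that] c0 Knz[OF that] by auto
  obtain s where s: "s = 1 \<or> s = - 1" "\<And>y. 0 < y \<Longrightarrow> y < pi \<Longrightarrow> 0 < s * u y"
    using constant_sign[OF cu unz] by blast
  \<comment> \<open>The equation is quadratic on one side and linear on the other, so scaling by
    \<open>1 / |c|\<close> removes the constant; \<open>s\<close> makes the result positive.\<close>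
  define p where "p y = s / \<bar>c\<bar> * u y" for y
  have ppos: "0 < p y" if "0 < y" "y < pi" for y
    using s(2)[OF that] c0 by (simp add: p_def)
  have Lu: "L2_half u"
  proof -
    have "integrable (ivl 0 pi) (\<lambda>y. (u y)\<^sup>2) = integrable (ivl 0 pi) (\<lambda>y. (\<eta> y)\<^sup>2)"
    proof (rule integrable_cong_AE)
      show "(\<lambda>y. (u y)\<^sup>2) \<in> borel_measurable (ivl 0 pi)" using um by measurable
      show "(\<lambda>y. (\<eta> y)\<^sup>2) \<in> borel_measurable (ivl 0 pi)" using L2_half_measurable[OF \<eta>] by measurable
      show "AE y in ivl 0 pi. (u y)\<^sup>2 = (\<eta> y)\<^sup>2" using AEu by eventually_elim simp
    qed
    then show ?thesis using \<eta> um by (simp add: L2_half_def)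
  qed
  have Lp: "L2_half p" unfolding p_def[abs_def] by (rule L2_half_scale[OF Lu])
  have Ku: "K u y = K \<eta> y" for y
    using AEu um L2_half_measurable[OF \<eta>] by (intro K_cong_AE) (auto elim: eventually_mono)
  have Kp: "K p y = s / \<bar>c\<bar> * K \<eta> y" for y unfolding p_def[abs_def] K_scale[OF Lu] Ku ..
  have "fixed_point p"
    unfolding fixed_point_def
  proof (intro conjI allI impI Lp)
    fix y assume y: "0 < y" "y < pi"
    show "0 < p y" by (rule ppos[OF y])
    \<comment> \<open>The signs of \<open>c\<close> and \<open>K \<eta>\<close> are unknown, so
      \<open>(p y)^2\<close> is computed as an absolute value; positivity of \<open>K\<close>
      removes it.\<close>
    have "0 \<le> K p y" using ppos by (intro K_nonneg Lp y less_imp_le)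
    have s2: "s\<^sup>2 = 1" and sabs: "\<bar>s\<bar> = 1" using s(1) by auto
    have "(p y)\<^sup>2 = (u y)\<^sup>2 / \<bar>c\<bar>\<^sup>2" by (simp add: p_def power_mult_distrib power_divide s2)
    also have "(u y)\<^sup>2 = \<bar>c\<bar> * \<bar>K \<eta> y\<bar>"
    proof -
      have "(u y)\<^sup>2 = \<bar>(u y)\<^sup>2\<bar>" by simp
      also have "\<dots> = \<bar>c\<bar> * \<bar>K \<eta> y\<bar>" unfolding u2[OF y] by (simp add: abs_mult)
      finally show ?thesis .
    qed
    also have "\<bar>c\<bar> * \<bar>K \<eta> y\<bar> / \<bar>c\<bar>\<^sup>2 = \<bar>K p y\<bar>"
    proof -
      have "t * X / t\<^sup>2 = X / t" for t X :: real by (simp add: power2_eq_square)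
      from this[of "\<bar>c\<bar>"] show ?thesis unfolding Kp by (simp only: abs_mult abs_divide abs_abs sabs) simp
    qed
    also have "\<dots> = K p y" using \<open>0 \<le> K p y\<close> by simp
    finally show "(p y)\<^sup>2 = K p y" .
  qed
  then have pf: "p y = sqrt (K \<phi> y)" if y: "0 < y" "y < pi" for y
  proof -
    have "p y = \<phi> y" by (rule fixed_point_unique[OF \<open>fixed_point p\<close> \<phi> y])
    moreover have "0 < \<phi> y \<and> (\<phi> y)\<^sup>2 = K \<phi> y" using \<phi> y by (simp add: fixed_point_def)
    ultimately show ?thesis by (metis less_imp_le real_sqrt_unique)
  qed
  \<comment> \<open>Inverts the scaling: \<open>C * p y = s^2 * u y = u y\<close>.\<close>
  define C where "C = s * \<bar>c\<bar>"
  have uC: "u y = C * sqrt (K \<phi> y)" if "0 < y" "y < pi" for y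
  proof -
    have "C * p y = u y" using s(1) c0 by (auto simp: C_def p_def)
    then show ?thesis using pf[OF that] by simp
  qed
  define f where "f x = C * sqrt (K \<phi> (real n * x))" for x
  have \<phi>L: "L2_half \<phi>" using \<phi> by (simp add: fixed_point_def)
  have fodd: "odd_fun f" unfolding odd_fun_def f_def using K_odd[OF \<phi>L] by (simp add: real_sqrt_minus)
  have fper: "periodic (2 * pi / real n) f"
    unfolding periodic_def f_def using n K_periodic[of \<phi>] by (simp add: distrib_left)
  have fm: "f \<in> borel_measurable borel" unfolding f_def[abs_def] by measurable
  have qm: "q \<in> borel_measurable borel" using q(1) by (simp add: L2_circle_def)
  \<comment> \<open>The symmetries of \<open>q\<close> hold only almost everywhere, so an exactly
    symmetric representative is compared with \<open>f\<close> on one half period and the equality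
    is then propagated.\<close>
  obtain w where w: "w \<in> borel_measurable borel" "AE x in lborel. q x = w x" "odd_fun w" "periodic (2 * pi / real n) w"
    by (rule exact_symmetric_representative[OF qm q(2,3)])
  have "AE x in lborel. w x = f x"
  proof (rule AE_of_half_period[OF _ w(3,4) fodd fper w(1) fm])
    show "0 < 2 * pi / real n" using n by simp
    have "AE x in lborel. 0 < x \<and> x < pi / real n \<longrightarrow> q x = v x / S_op q x" using v(2) unfolding AE_ivl_iff .
    with w(2) show "AE x in lborel. 0 < x \<and> x < 2 * pi / real n / 2 \<longrightarrow> w x = f x"
    proof eventually_elim
      fix x assume *: "q x = w x" "0 < x \<and> x < pi / real n \<longrightarrow> q x = v x / S_op q x"
      show "0 < x \<and> x < 2 * pi / real n / 2 \<longrightarrow> w x = f x"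
      proof
        assume x: "0 < x \<and> x < 2 * pi / real n / 2"
        then have "w x = v x / S_op q x" using * by simp
        also have "\<dots> = u (real n * x)" using n by (simp add: u_def)
        also have "\<dots> = f x" unfolding f_def using x n by (intro uC) (auto simp: field_simps)
        finally show "w x = f x" .
      qed
    qed
  qed
  with w(2) have "AE x in lborel. q x = C * sqrt (K \<phi> (real n * x))"
    by eventually_elim (simp add: f_def)
  then show ?thesis by blast
qed

end

theorem theorem1p1:
  fixes n :: nat
  assumes "n \<ge> 3"
  shows "\<exists>f :: real \<Rightarrow> real.
    odd_fun f \<and> periodic (2 * pi / real n) f \<and> holder_circle (1/2) f \<and>
    fourier_coeff f (int n) \<noteq> 0 \<and>
    weak_solution 2 f \<and>
    n_fold_symmetric n (Theta f) \<and> sqg_stationary (Theta f) (neg_inv_Lambda_Theta f) \<and>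
    (\<forall>q :: real \<Rightarrow> real.
       L2_circle q \<and> AE_odd q \<and> AE_periodic (2 * pi / real n) q \<and> weak_solution 2 q \<and>
       (\<forall>x\<in>{0<..<pi / real n}. S_op q x \<noteq> 0)
       \<longrightarrow> (\<exists>c::real. AE x in lborel. q x = c * f x))"
proof -
  interpret n_fold n using assms by unfold_locales
  obtain \<phi> where \<phi>: "fixed_point \<phi>" using fixed_point_exists by blast
  define f where "f x = sqrt (K \<phi> (real n * x))" for x
  note f = solution_on_circle[OF \<phi>, folded f_def]
  obtain g' where g': "continuous_on UNIV g'" "\<And>x. ((\<lambda>x. K \<phi> (real n * x)) has_real_derivative g' x) (at x)"
    using f(7) by blast
  have "periodic (2 * pi / real n) (\<lambda>x. K \<phi> (real n * x))"
    unfolding periodic_def using assms K_periodic[of \<phi>] by (simp add: distrib_left)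
  from periodic_nat_multiple[OF this, of n] assms
  have "periodic (2 * pi) (\<lambda>x. K \<phi> (real n * x))" by simp
  then have "sqg_stationary (Theta f) (neg_inv_Lambda_Theta f)"
    using f(5) unfolding f_def by (intro sqg_stationary_Theta[OF _ g'(2,1)])
  moreover have "n_fold_symmetric n (Theta f)" using assms f(2) by (intro n_fold_symmetric_Theta) auto
  moreover have "\<exists>c. AE x in lborel. q x = c * f x"
    if "L2_circle q" "AE_odd q" "AE_periodic (2 * pi / real n) q" "weak_solution 2 q"
      "\<forall>x\<in>{0<..<pi / real n}. S_op q x \<noteq> 0" for q
    unfolding f_def using that by (intro solution_unique[OF \<phi>]) auto
  ultimately show ?thesis using f(1-4,6) by (intro exI[of _ f]) blast
qed

end
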